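(* Let $\mathcal{T}_\ell\in\mathbb{T}$, let $\bar{\mathfrak u}_\ell\in\mathbb{U}_{ad}$ be any solution of the semi-discrete problem on $\mathcal{T}_\ell$, with associated discrete state $\bar y_\ell(\bar{\mathfrak u}_\ell)$ and discrete adjoint state $\bar p_\ell$. Then for every $T\in\mathcal{T}_\ell$, \begin{align*} E_{st,T}^2+E_{adj,T}^2+E_{adj,\infty,T}^2\lesssim\;&(1+h_T^4+h_T^{4-d})\|\bar y-\bar y_\ell(\bar{\mathfrak u}_\ell)\|_{L^2(\mathcal{N}_T)}^2+(1+h_T^d)\|\bar p-\bar p_\ell\|_{L^\infty(\mathcal{N}_T)}^2\\ &+h_T^{4-d}\|\bar u-\bar{\mathfrak u}_\ell\|_{L^1(\mathcal{N}_T)}^2+\sum_{T'\in\mathcal{N}_T}h_T^4\|\bar{\mathfrak u}_\ell-\Pi_{T'}\bar{\mathfrak u}_\ell\|_{L^2(T')}^2\\ &+\sum_{T'\in\mathcal{N}_T}(h_T^4+h_T^{4-d})\|y_\Omega-\Pi_{T'}y_\Omega\|_{L^2(T')}^2, \end{align*} with a hidden constant independent of the continuous and discrete optimal variables, the element sizes of $\mathcal{T}_\ell$, and $\#\mathcal{T}_\ell$.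
   Context: Let $\Omega\subset\mathbb{R}^d$, $d\in\{2,3\}$, be an open, bounded, convex polygonal/polyhedral domain; $\|\cdot\|_G$ and $(\cdot,\cdot)_G$ denote the $L^2(G)$ norm and inner product. Let $y_\Omega\in L^2(\Omega)$, $a<b$ real, and $\mathbb{U}_{ad}:=\{v\in L^2(\Omega): a\le v\le b \text{ a.e.}\}$. For $u\in L^2(\Omega)$ let $y_u\in H^1_0(\Omega)$ solve $(\nabla y_u,\nabla v)_\Omega=(u,v)_\Omega$ for all $v\in H_0^1(\Omega)$. The continuous problem is: minimize $J(u)=\frac12\|y_u-y_\Omega\|_\Omega^2$ over $u\in\mathbb{U}_{ad}$; it has a unique solution $\bar u$, with state $\bar y=y_{\bar u}$ and adjoint state $\bar p\in H_0^1(\Omega)$ solving $(\nabla v,\nabla\bar p)_\Omega=(\bar y-y_\Omega,v)_\Omega$ for all $v\in H^1_0(\Omega)$. Let $\mathbb{T}$ be a family of conforming, shape-regular simplicial triangulations of $\overline\Omega$, all refinements of an initial mesh $\mathcal{T}_0$; for $T\in\mathcal{T}_\ell\in\mathbb{T}$, $h_T=\operatorname{diam}(T)$. $\mathcal{E}_\ell$ is the set of interior $(d-1)$-dimensional sides of $\mathcal{T}_\ell$, and $\mathcal{E}_T$ the set of interior sides of $T$. The patch of $T$ is $\mathcal{N}_T:=\{T'\in\mathcal{T}_\ell:\mathcal{E}_T\cap\mathcal{E}_{T'}\neq\emptyset\}$ (also identified with the union of its elements). $\mathbb{V}_\ell$ is the space of continuous, piecewise linear functions on $\mathcal{T}_\ell$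 vanishing on $\partial\Omega$. For $v_\ell\in\mathbb{V}_\ell$ and $e=T^+\cap T^-\in\mathcal{E}_\ell$, the jump is $\llbracket\nabla v_\ell\cdot\mathbf n\rrbracket|_e:=\mathbf n^+\cdot\nabla v_\ell|_{T^+}+\mathbf n^-\cdot\nabla v_\ell|_{T^-}$, with $\mathbf n^\pm$ the unit outward normals of $T^\pm$. For $T'\in\mathcal{T}_\ell$, $\Pi_{T'}v:=\frac{1}{|T'|}\int_{T'}v$ is the $L^2(T')$-orthogonal projection onto constants. Semi-discrete (variational discretization) problem on $\mathcal{T}_\ell$: minimize $\frac12\|y_\ell(\mathfrak u)-y_\Omega\|_\Omega^2$ over $\mathfrak u\in\mathbb{U}_{ad}$ (control not discretized), where $y_\ell(\mathfrak u)\in\mathbb{V}_\ell$ solves $(\nabla y_\ell(\mathfrak u),\nabla v_\ell)_\Omega=(\mathfrak u,v_\ell)_\Omega$ for all $v_\ell\in\mathbb{V}_\ell$. For a solution $\bar{\mathfrak u}_\ell$, the discrete adjoint $\bar p_\ell\in\mathbb{V}_\ell$ solves $(\nabla v_\ell,\nabla\bar p_\ell)_\Omega=(\bar y_\ell(\bar{\mathfrak u}_\ell)-y_\Omega,v_\ell)_\Omega$ for all $v_\ell\in\mathbb{V}_\ell$. Local indicators: $E_{st,T}^2:=h_T^4\|\bar{\mathfrak u}_\ell\|_T^2+\sum_{e\in\mathcal{E}_T}h_T^3\|\llbracket\nabla\bar y_\ell(\bar{\mathfrak u}_\ell)\cdot\mathbf n\rrbracket|_e\|_e^2$; $E_{adj,T}^2:=h_T^4\|\bar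 y_\ell(\bar{\mathfrak u}_\ell)-y_\Omega\|_T^2+\sum_{e\in\mathcal{E}_T}h_T^3\|\llbracket\nabla\bar p_\ell\cdot\mathbf n\rrbracket|_e\|_e^2$; $E_{adj,\infty,T}:=h_T^{2-d/2}\|\bar y_\ell(\bar{\mathfrak u}_\ell)-y_\Omega\|_T+h_T\max_{e\in\mathcal{E}_T}\|\llbracket\nabla\bar p_\ell\cdot\mathbf n\rrbracket|_e\|_{L^\infty(e)}$. $A\lesssim B$ means $A\le CB$ with $C$ as described in the claim.
   Formalization: The patch of T is taken to contain T itself always; with the literal definition it is empty when T has no interior side (a mesh with a single element), where the right-hand side would be 0 and the estimate false. All other cases are unchanged. *)

theory Defs
  imports "HOL-Analysis.Analysis" "HOL-Probability.Essential_Supremum"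
begin

definition L2fun :: "'a::euclidean_space set \<Rightarrow> ('a \<Rightarrow> real) \<Rightarrow> bool" where
  "L2fun S f \<longleftrightarrow> f \<in> borel_measurable (lebesgue_on S) \<and>
     integrable (lebesgue_on S) (\<lambda>x. (f x)\<^sup>2)"

definition L2norm :: "'a::euclidean_space set \<Rightarrow> ('a \<Rightarrow> real) \<Rightarrow> real" where
  "L2norm S f = sqrt (LINT x|lebesgue_on S. (f x)\<^sup>2)"

definition L1norm :: "'a::euclidean_space set \<Rightarrow> ('a \<Rightarrow> real) \<Rightarrow> real" where
  "L1norm S f = (LINT x|lebesgue_on S. \<bar>f x\<bar>)"

definition Linfnorm :: "'a::euclidean_space set \<Rightarrow> ('a \<Rightarrow> real) \<Rightarrow> real" where
  "Linfnorm S f = real_of_ereal (esssup (lebesgue_on S) (\<lambda>x. ereal \<bar>f x\<bar>))"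

definition avg :: "'a::euclidean_space set \<Rightarrow> ('a \<Rightarrow> real) \<Rightarrow> real" where
  "avg T f = (LINT x|lebesgue_on T. f x) / measure lebesgue T"

definition C1c :: "'a::euclidean_space set \<Rightarrow> ('a \<Rightarrow> real) \<Rightarrow> ('a \<Rightarrow> 'a) \<Rightarrow> bool" where
  "C1c \<Omega> \<phi> g \<longleftrightarrow> (\<forall>x. (\<phi> has_derivative (\<lambda>h. g x \<bullet> h)) (at x)) \<and> continuous_on UNIV g \<and>
     (\<exists>K. compact K \<and> K \<subseteq> \<Omega> \<and> (\<forall>x. x \<notin> K \<longrightarrow> \<phi> x = 0))"

text \<open>y \<in> H^1_0(\<Omega>) with weak gradient G: the H^1 limit of C^1_c(\<Omega>) functions\<close>
definition H10 :: "'a::euclidean_space set \<Rightarrow> ('a \<Rightarrow> real) \<Rightarrow> ('a \<Rightarrow> 'a) \<Rightarrow> bool" where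
  "H10 \<Omega> y G \<longleftrightarrow> L2fun \<Omega> y \<and> G \<in> borel_measurable (lebesgue_on \<Omega>) \<and>
     integrable (lebesgue_on \<Omega>) (\<lambda>x. (norm (G x))\<^sup>2) \<and>
     (\<exists>\<phi> g. (\<forall>k. C1c \<Omega> (\<phi> k) (g k)) \<and>
        (\<lambda>k. LINT x|lebesgue_on \<Omega>. (\<phi> k x - y x)\<^sup>2) \<longlonglongrightarrow> 0 \<and>
        (\<lambda>k. LINT x|lebesgue_on \<Omega>. (norm (g k x - G x))\<^sup>2) \<longlonglongrightarrow> 0)"

definition weak_sol :: "'a::euclidean_space set \<Rightarrow> ('a \<Rightarrow> real) \<Rightarrow> ('a \<Rightarrow> real) \<Rightarrow> bool" where
  "weak_sol \<Omega> f y \<longleftrightarrow> (\<exists>G. H10 \<Omega> y G \<and>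
     (\<forall>v Gv. H10 \<Omega> v Gv \<longrightarrow>
        (LINT x|lebesgue_on \<Omega>. G x \<bullet> Gv x) = (LINT x|lebesgue_on \<Omega>. f x * v x)))"

definition Uad :: "'a::euclidean_space set \<Rightarrow> real \<Rightarrow> real \<Rightarrow> ('a \<Rightarrow> real) set" where
  "Uad \<Omega> a b = {v. L2fun \<Omega> v \<and> (AE x in lebesgue_on \<Omega>. a \<le> v x \<and> v x \<le> b)}"

definition costJ :: "'a::euclidean_space set \<Rightarrow> ('a \<Rightarrow> real) \<Rightarrow> ('a \<Rightarrow> real) \<Rightarrow> real" where
  "costJ \<Omega> y\<^sub>\<Omega> y = (1/2) * (L2norm \<Omega> (\<lambda>x. y x - y\<^sub>\<Omega> x))\<^sup>2"

definition cont_opt :: "'a::euclidean_space set \<Rightarrow> ('a \<Rightarrow> real) \<Rightarrow> real \<Rightarrow> real \<Rightarrow> ('a \<Rightarrow> real) \<Rightarrow> bool" where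
  "cont_opt \<Omega> y\<^sub>\<Omega> a b u \<longleftrightarrow> u \<in> Uad \<Omega> a b \<and> (\<exists>y. weak_sol \<Omega> u y) \<and>
     (\<forall>y. weak_sol \<Omega> u y \<longrightarrow> (\<forall>u' \<in> Uad \<Omega> a b. \<forall>y'. weak_sol \<Omega> u' y' \<longrightarrow>
         costJ \<Omega> y\<^sub>\<Omega> y \<le> costJ \<Omega> y\<^sub>\<Omega> y'))"

definition triangulation :: "'a::euclidean_space set \<Rightarrow> 'a set set \<Rightarrow> bool" where
  "triangulation \<Omega> \<T> \<longleftrightarrow> finite \<T> \<and> (\<forall>T\<in>\<T>. (int DIM('a)) simplex T) \<and> \<Union>\<T> = closure \<Omega> \<and>
     (\<forall>T\<in>\<T>. \<forall>T'\<in>\<T>. (T \<inter> T') face_of T \<and> (T \<inter> T') face_of T')"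

definition refines :: "'a set set \<Rightarrow> 'a set set \<Rightarrow> bool" where
  "refines \<T> \<T>0 \<longleftrightarrow> (\<forall>T\<in>\<T>. \<exists>T0\<in>\<T>0. T \<subseteq> T0)"

definition inradius :: "'a::euclidean_space set \<Rightarrow> real" where
  "inradius T = Sup {r. \<exists>x. ball x r \<subseteq> T}"

definition shape_regular :: "'a::euclidean_space set set set \<Rightarrow> bool" where
  "shape_regular \<TT> \<longleftrightarrow> (\<exists>\<sigma>. \<forall>\<T>\<in>\<TT>. \<forall>T\<in>\<T>. diameter T \<le> \<sigma> * inradius T)"

definition sides :: "'a::euclidean_space set set \<Rightarrow> 'a set \<Rightarrow> 'a set set" where
  "sides \<T> T = {T \<inter> T' | T'. T' \<in> \<T> \<and> T' \<noteq> T \<and> aff_dim (T \<inter> T') = int DIM('a) - 1}"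

definition patch :: "'a::euclidean_space set set \<Rightarrow> 'a set \<Rightarrow> 'a set set" where
  "patch \<T> T = insert T {T' \<in> \<T>. sides \<T> T \<inter> sides \<T> T' \<noteq> {}}"

definition grad_on :: "'a::euclidean_space set \<Rightarrow> ('a \<Rightarrow> real) \<Rightarrow> 'a" where
  "grad_on T v = (SOME g. \<exists>c. \<forall>x\<in>T. v x = g \<bullet> x + c)"

definition pw_grad :: "'a::euclidean_space set set \<Rightarrow> ('a \<Rightarrow> real) \<Rightarrow> 'a \<Rightarrow> 'a" where
  "pw_grad \<T> v x = grad_on (SOME T. T \<in> \<T> \<and> x \<in> T) v"

definition Vh :: "'a::euclidean_space set \<Rightarrow> 'a set set \<Rightarrow> ('a \<Rightarrow> real) set" where
  "Vh \<Omega> \<T> = {v. continuous_on UNIV v \<and> (\<forall>x. x \<notin> \<Omega> \<longrightarrow> v x = 0) \<and>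
                 (\<forall>T\<in>\<T>. \<exists>g c. \<forall>x\<in>T. v x = g \<bullet> x + c)}"

definition side_normal :: "'a::euclidean_space set \<Rightarrow> 'a" where
  "side_normal e = (SOME n. norm n = 1 \<and> (\<forall>x\<in>e. \<forall>y\<in>e. n \<bullet> (x - y) = 0))"

definition side_elems :: "'a set set \<Rightarrow> 'a set \<Rightarrow> 'a set \<times> 'a set" where
  "side_elems \<T> e = (SOME (Tp, Tm). Tp \<in> \<T> \<and> Tm \<in> \<T> \<and> Tp \<noteq> Tm \<and> e = Tp \<inter> Tm)"

text \<open>normal jump n+ . grad v|T+ + n- . grad v|T- (n- = -n+); constant on e\<close>
definition jump :: "'a::euclidean_space set set \<Rightarrow> ('a \<Rightarrow> real) \<Rightarrow> 'a set \<Rightarrow> real" where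
  "jump \<T> v e = (case side_elems \<T> e of (Tp, Tm) \<Rightarrow>
      side_normal e \<bullet> grad_on Tp v + (- side_normal e) \<bullet> grad_on Tm v)"

text \<open>(d-1)-dimensional measure of a flat side: volume of the unit-height right prism over it\<close>
definition side_measure :: "'a::euclidean_space set \<Rightarrow> real" where
  "side_measure e = measure lebesgue {x + t *\<^sub>R side_normal e | x t. x \<in> e \<and> t \<in> {0..1}}"

definition dsol :: "'a::euclidean_space set \<Rightarrow> 'a set set \<Rightarrow> ('a \<Rightarrow> real) \<Rightarrow> ('a \<Rightarrow> real) \<Rightarrow> bool" where
  "dsol \<Omega> \<T> f y \<longleftrightarrow> y \<in> Vh \<Omega> \<T> \<and> (\<forall>v\<in>Vh \<Omega> \<T>.
     (LINT x|lebesgue_on \<Omega>. pw_grad \<T> y x \<bullet> pw_grad \<T> v x) = (LINT x|lebesgue_on \<Omega>. f x * v x))"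

definition semi_opt :: "'a::euclidean_space set \<Rightarrow> 'a set set \<Rightarrow> ('a \<Rightarrow> real) \<Rightarrow> real \<Rightarrow> real \<Rightarrow> ('a \<Rightarrow> real) \<Rightarrow> bool" where
  "semi_opt \<Omega> \<T> y\<^sub>\<Omega> a b u \<longleftrightarrow> u \<in> Uad \<Omega> a b \<and> (\<exists>y. dsol \<Omega> \<T> u y) \<and>
     (\<forall>y. dsol \<Omega> \<T> u y \<longrightarrow> (\<forall>u' \<in> Uad \<Omega> a b. \<forall>y'. dsol \<Omega> \<T> u' y' \<longrightarrow>
         costJ \<Omega> y\<^sub>\<Omega> y \<le> costJ \<Omega> y\<^sub>\<Omega> y'))"

definition E_st2 :: "'a::euclidean_space set set \<Rightarrow> ('a \<Rightarrow> real) \<Rightarrow> ('a \<Rightarrow> real) \<Rightarrow> 'a set \<Rightarrow> real" where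
  "E_st2 \<T> u y T = diameter T ^ 4 * (L2norm T u)\<^sup>2 +
     (\<Sum>e\<in>sides \<T> T. diameter T ^ 3 * ((jump \<T> y e)\<^sup>2 * side_measure e))"

definition E_adj2 :: "'a::euclidean_space set set \<Rightarrow> ('a \<Rightarrow> real) \<Rightarrow> ('a \<Rightarrow> real) \<Rightarrow> ('a \<Rightarrow> real) \<Rightarrow> 'a set \<Rightarrow> real" where
  "E_adj2 \<T> y\<^sub>\<Omega> y p T = diameter T ^ 4 * (L2norm T (\<lambda>x. y x - y\<^sub>\<Omega> x))\<^sup>2 +
     (\<Sum>e\<in>sides \<T> T. diameter T ^ 3 * ((jump \<T> p e)\<^sup>2 * side_measure e))"

definition E_adj_inf :: "'a::euclidean_space set set \<Rightarrow> ('a \<Rightarrow> real) \<Rightarrow> ('a \<Rightarrow> real) \<Rightarrow> ('a \<Rightarrow> real) \<Rightarrow> 'a set \<Rightarrow> real" where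
  "E_adj_inf \<T> y\<^sub>\<Omega> y p T = diameter T powr (2 - real DIM('a) / 2) * L2norm T (\<lambda>x. y x - y\<^sub>\<Omega> x) +
     diameter T * Max (insert 0 ((\<lambda>e. \<bar>jump \<T> p e\<bar>) ` sides \<T> T))"

end

theory Submission
  imports Defs
begin


text \<open>
  Every term of the indicator is bounded by testing the weak formulation with an explicit \<open>C\<^sup>2\<close> bump
  \<open>v = (1 - |x - x\<^sub>0|\<^sup>2/r\<^sup>2)\<^sub>+\<^sup>3\<close>, \<open>r\<close> comparable to \<open>h\<^sub>T\<close>: for a weak solution \<open>y\<close> with right-hand side \<open>f\<close>,
  \<open>\<integral> y \<Delta>v = - \<integral> f v\<close>. If the ball lies in an element, the discrete function drops out and \<open>\<integral> q v = q(x\<^sub>0) \<integral> v\<close>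
  controls the affine part \<open>q\<close> of the data at two points of the element, hence everywhere on it. If the ball is
  centred on a side, the discrete function is an affine function plus a multiple \<open>J/2\<close> of \<open>|n \<bullet> (x - x\<^sub>0)|\<close>, where
  \<open>J\<close> is the normal jump up to sign, and \<open>\<integral> |n \<bullet> (x - x\<^sub>0)| \<Delta>v\<close> is comparable to \<open>r\<^sup>d\<^sup>-\<^sup>1\<close>; no integration over sides
  is needed.

  The \<open>L\<^sup>\<infinity>\<close> norm of the adjoint error is a real number which is \<open>0\<close> for unbounded functions, so the
  essential boundedness of the adjoint state has to be proved. Testing with \<open>\<psi>'(u) b\<close>, where \<open>\<psi>(t) = sqrt (1 + t\<^sup>2) - 1\<close> and
  \<open>b\<close> is a regularised fundamental solution, bounds the means of \<open>\<psi>(u)\<close> over small balls because \<open>b\<close> is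
  uniformly in \<open>L\<^sup>2\<close> for \<open>d \<le> 3\<close>; a Vitali covering turns this into a pointwise bound.
\<close>

section \<open>Integration by parts\<close>

text \<open>The claim measures errors in L1, L2 and L\<infinity> only, never through gradients. Two
  integrations by parts move both derivatives onto the test function, which must then be C^2 across
  element interfaces; the usual element and side bubbles are not, a cubed radial cutoff is. The
  cutoff is bounded by 1 and its Laplacian by a multiple of r^(-2), so every error enters through an
  L1 norm on a ball. Let h be the diameter of the element and d the dimension. On balls of radius at
  most h, let A h^d bound the L1 error of the discrete function and \<Phi> h^d the L1 distance of
  the data to an elementwise affine function. Then the affine data are bounded by a multiple of W =
  \<Phi> + A / h^2 and the jumps by a multiple of h W. Up to oscillation, the three squared
  indicators thus reduce to h^4 W^2 or h^4 h^d W^2. The state takes A from the L2 error and \<Phi>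
  from the L1 control error and the oscillation; the adjoint takes A from the L\<infinity> error and
  \<Phi> from the L2 state error and the oscillation. Inserting these produces the powers h^4, h^d
  and h^(4-d).\<close>

lemma integral_directional_derivative_eq_0:
  fixes F D :: "'a::euclidean_space \<Rightarrow> real"
  assumes lip: "\<And>x y. \<bar>F x - F y\<bar> \<le> L * norm (x - y)"
    and supp: "\<And>x. norm x > R \<Longrightarrow> F x = 0"
    and der: "AE x in lebesgue. ((\<lambda>t. F (x + t *\<^sub>R w)) has_real_derivative D x) (at 0)"
    and D: "D \<in> borel_measurable lebesgue"
  shows "integrable lebesgue D" "integral\<^sup>L lebesgue D = 0"
proof -
  have "continuous_on UNIV F"
  proof (rule continuous_on_iff[THEN iffD2], intro ballI allI impI)
    fix x :: 'a and e :: real assume e: "e > 0"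
    have "\<bar>L\<bar> + 1 > 0" by simp
    show "\<exists>d>0. \<forall>x'\<in>UNIV. dist x' x < d \<longrightarrow> dist (F x') (F x) < e"
    proof (intro exI conjI ballI impI)
      show "e / (\<bar>L\<bar> + 1) > 0" using e by simp
      fix y assume "dist y x < e / (\<bar>L\<bar> + 1)"
      then have "(\<bar>L\<bar> + 1) * norm (y - x) < e"
        using \<open>\<bar>L\<bar> + 1 > 0\<close> by (simp add: dist_norm field_simps)
      moreover have "L * norm (y - x) \<le> (\<bar>L\<bar> + 1) * norm (y - x)"
        by (intro mult_right_mono) auto
      ultimately show "dist (F y) (F x) < e" using lip[of y x] by (simp add: dist_norm)
    qed
  qed
  then have Fm[measurable]: "F \<in> borel_measurable borel" by (rule borel_measurable_continuous_onI)
  \<comment> \<open>Difference quotients in direction \<open>w\<close>. Each integrates to 0 by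
    translation invariance, and the Lipschitz constant dominates all of them by one multiple of the
    indicator of a ball, so dominated convergence passes the value 0 on to \<open>D\<close>. An
    almost everywhere derivative suffices, which later admits the kink of |n . (x - x0)|.\<close>
  define s where "s n x = (F (x + (1 / Suc n) *\<^sub>R w) - F x) * Suc n" for n x
  \<comment> \<open>The steps are at most 1, so shifting the support enlarges its radius by at most
    \<open>norm w\<close>.\<close>
  define R' where "R' = \<bar>R\<bar> + norm w"
  let ?g = "\<lambda>x. (L * norm w) * indicator (cball 0 R') x"
  have sb: "\<bar>s n x\<bar> \<le> ?g x" for n x
  proof (cases "x \<in> cball 0 R'")
    case True
    have "\<bar>F (x + (1 / Suc n) *\<^sub>R w) - F x\<bar> \<le> L * norm ((1 / Suc n) *\<^sub>R w)"
      using lip[of "x + (1 / Suc n) *\<^sub>R w" x] by simp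
    also have "\<dots> = L * norm w / Suc n" by simp
    finally have "\<bar>F (x + (1 / Suc n) *\<^sub>R w) - F x\<bar> * Suc n \<le> L * norm w" by (simp add: pos_le_divide_eq)
    then show ?thesis using True unfolding s_def abs_mult by simp
  next
    case False
    then have "norm x > \<bar>R\<bar> + norm w" by (simp add: R'_def)
    moreover have "norm ((1 / Suc n) *\<^sub>R w) \<le> norm w"
      using mult_left_le[of "1 / real (Suc n)" "norm w"] by simp
    moreover have "norm x \<le> norm (x + (1 / Suc n) *\<^sub>R w) + norm ((1 / Suc n) *\<^sub>R w)"
      by (metis add_diff_cancel norm_triangle_ineq4)
    ultimately have "norm (x + (1 / Suc n) *\<^sub>R w) > R" "norm x > R"
      using norm_ge_zero[of w] by linarith+
    then show ?thesis using False supp by (simp add: s_def)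
  qed
  have Fint: "integrable lborel F"
  proof (rule Bochner_Integration.integrable_bound)
    show "integrable lborel (\<lambda>x. \<bar>\<bar>L\<bar> * (2 * \<bar>R\<bar> + 1 )\<bar> * indicator (cball 0 \<bar>R\<bar>) x :: real)"
      by (intro integrable_mult_right integrable_real_indicator) (use emeasure_bounded_finite[OF bounded_cball] in auto)
    show "AE x in lborel. norm (F x) \<le> norm (\<bar>\<bar>L\<bar> * (2 * \<bar>R\<bar> + 1)\<bar> * indicator (cball 0 \<bar>R\<bar>) x :: real)"
    proof (intro AE_I2)
      fix x :: 'a
      show "norm (F x) \<le> norm (\<bar>\<bar>L\<bar> * (2 * \<bar>R\<bar> + 1)\<bar> * indicator (cball 0 \<bar>R\<bar>) x :: real)"
      proof (cases "norm x \<le> \<bar>R\<bar>")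
        case True
        obtain b :: 'a where b: "b \<in> Basis" using nonempty_Basis by blast
        \<comment> \<open>A point outside the support: comparison with the value 0 there turns the
          Lipschitz condition into a bound on \<open>F\<close>.\<close>
        define y where "y = (\<bar>R\<bar> + 1) *\<^sub>R b"
        have ny: "norm y = \<bar>R\<bar> + 1" using b by (simp add: y_def)
        have "F y = 0" using supp[of y] ny by simp
        then have "\<bar>F x\<bar> \<le> L * norm (x - y)" using lip[of x y] by simp
        also have "\<dots> \<le> \<bar>L\<bar> * norm (x - y)" by (intro mult_right_mono) auto
        also have "\<dots> \<le> \<bar>L\<bar> * (2 * \<bar>R\<bar> + 1)"
          using norm_triangle_ineq4[of x y] ny True by (intro mult_left_mono) auto
        finally show ?thesis using True by simp
      next
        case False then show ?thesis using supp[of x] by simp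
      qed
    qed
  qed simp
  have tr: "integral\<^sup>L lborel (\<lambda>x. F (x + c)) = integral\<^sup>L lborel F"
    and tri: "integrable lborel (\<lambda>x. F (x + c))" for c
  proof -
    have "integral\<^sup>L lborel F = integral\<^sup>L (distr lborel borel ((+) c)) F" by (simp add: lborel_distr_plus)
    also have "\<dots> = integral\<^sup>L lborel (\<lambda>x. F (c + x))" by (subst integral_distr) auto
    finally show "integral\<^sup>L lborel (\<lambda>x. F (x + c)) = integral\<^sup>L lborel F" by (simp add: add.commute)
    have "integrable (distr lborel borel ((+) c)) F" using Fint by (simp add: lborel_distr_plus)
    then show "integrable lborel (\<lambda>x. F (x + c))" by (subst (asm) integrable_distr_eq) (auto simp: add.commute)
  qed
  have sm: "s n \<in> borel_measurable borel" for n
    unfolding s_def[abs_def] by measurable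
  have s0: "integral\<^sup>L lebesgue (s n) = 0" for n
  proof -
    have "integral\<^sup>L lebesgue (s n) = integral\<^sup>L lborel (s n)"
      by (rule integral_completion) (use sm in simp)
    also have "\<dots> = 0" unfolding s_def using tr tri Fint by simp
    finally show ?thesis .
  qed
  have smeas: "s n \<in> borel_measurable lebesgue" for n
    by (rule measurable_completion) (use sm in simp)
  have gint: "integrable lebesgue ?g"
    by (intro integrable_mult_right integrable_real_indicator) (use emeasure_bounded_finite[OF bounded_cball] in auto)
  have lim: "AE x in lebesgue. (\<lambda>n. s n x) \<longlonglongrightarrow> D x"
    using der
  proof eventually_elim
    fix x assume d: "((\<lambda>t. F (x + t *\<^sub>R w)) has_real_derivative D x) (at 0)"
    then have lim0: "((\<lambda>h. (F (x + h *\<^sub>R w) - F x) / h) \<longlongrightarrow> D x) (at 0)"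
      by (simp add: DERIV_def)
    have "filterlim (\<lambda>n. 1 / real (Suc n)) (at 0) sequentially"
      unfolding filterlim_at using LIMSEQ_inverse_real_of_nat by (auto simp: inverse_eq_divide)
    from filterlim_compose[OF lim0 this] show "(\<lambda>n. s n x) \<longlonglongrightarrow> D x"
      by (simp add: s_def)
  qed
  show "integrable lebesgue D"
    by (rule integrable_dominated_convergence[OF D smeas gint lim]) (use sb in auto)
  have "(\<lambda>n. integral\<^sup>L lebesgue (s n)) \<longlonglongrightarrow> integral\<^sup>L lebesgue D"
    by (rule integral_dominated_convergence[OF D smeas gint lim]) (use sb in auto)
  then show "integral\<^sup>L lebesgue D = 0" by (simp add: s0 LIMSEQ_const_iff)
qed

text \<open>Off the ball \<open>F\<close> is locally zero and so is its gradient; on the ball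
  compactness bounds the gradient. The mean value inequality then applies on the whole
  space.\<close>

lemma lipschitz_of_C1_bounded_support:
  fixes F :: "'a::euclidean_space \<Rightarrow> real" and g :: "'a \<Rightarrow> 'a"
  assumes der: "\<And>x. (F has_derivative (\<lambda>h. g x \<bullet> h)) (at x)"
    and cont: "continuous_on UNIV g"
    and supp: "\<And>x. norm x > R \<Longrightarrow> F x = 0"
  obtains L where "L \<ge> 0" "\<And>x y. \<bar>F x - F y\<bar> \<le> L * norm (x - y)"
proof -
  have g0: "g x = 0" if "norm x > R" for x
  proof -
    have op: "open {x::'a. norm x > R}" by (rule open_Collect_less) (auto intro: continuous_on_norm_id)
    have "((\<lambda>_. 0) has_derivative (\<lambda>h. g x \<bullet> h)) (at x)"
      by (rule has_derivative_transform_within_open[OF der op]) (use that supp in simp_all)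
    from has_derivative_unique[OF this has_derivative_const] have "(\<lambda>h. g x \<bullet> h) = (\<lambda>h. 0)" .
    then have "g x \<bullet> g x = 0" by (rule fun_cong)
    then show ?thesis by simp
  qed
  have "bounded (g ` cball 0 \<bar>R\<bar>)"
    by (intro compact_imp_bounded compact_continuous_image continuous_on_subset[OF cont]) auto
  then obtain B where B: "\<And>x. x \<in> cball 0 \<bar>R\<bar> \<Longrightarrow> norm (g x) \<le> B"
    unfolding bounded_iff by blast
  define L where "L = \<bar>B\<bar>"
  have gB: "norm (g x) \<le> L" for x
    using B[of x] g0[of x] by (cases "norm x \<le> \<bar>R\<bar>") (auto simp: L_def)
  have "norm (F x - F y) \<le> L * norm (x - y)" for x y
  proof (rule differentiable_bound[of UNIV F "\<lambda>x h. g x \<bullet> h"])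
    show "onorm (\<lambda>h. g x \<bullet> h) \<le> L" for x
    proof (rule onorm_bound)
      show "norm (g x \<bullet> h) \<le> L * norm h" for h
        using Cauchy_Schwarz_ineq2[of "g x" h] mult_right_mono[OF gB[of x], of "norm h"] by simp
    qed (simp add: L_def)
  qed (use der in auto)
  then show ?thesis using that[of L] by (auto simp: L_def)
qed

lemma has_real_derivative_directional:
  assumes "(F has_derivative (\<lambda>h. g \<bullet> h)) (at x)"
  shows "((\<lambda>t. F (x + t *\<^sub>R w)) has_real_derivative g \<bullet> w) (at 0)"
proof -
  have "((\<lambda>t. x + t *\<^sub>R w) has_derivative (\<lambda>t. t *\<^sub>R w)) (at 0)"
    by (auto intro!: derivative_eq_intros)
  from diff_chain_at[OF this, of F "\<lambda>h. g \<bullet> h"] assms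
  have "((\<lambda>t. F (x + t *\<^sub>R w)) has_derivative (\<lambda>t. g \<bullet> (t *\<^sub>R w))) (at 0)" by (simp add: o_def)
  then show ?thesis unfolding has_field_derivative_def by (simp add: mult.commute[of _ "g \<bullet> w"])
qed

lemma integral_gradient_eq_0:
  fixes F :: "'a::euclidean_space \<Rightarrow> real" and g :: "'a \<Rightarrow> 'a"
  assumes der: "\<And>x. (F has_derivative (\<lambda>h. g x \<bullet> h)) (at x)"
    and cont: "continuous_on UNIV g"
    and supp: "\<And>x. norm x > R \<Longrightarrow> F x = 0"
  shows "integrable lebesgue (\<lambda>x. g x \<bullet> w)" "(LINT x|lebesgue. g x \<bullet> w) = 0"
proof -
  obtain L where L: "\<And>x y. \<bar>F x - F y\<bar> \<le> L * norm (x - y)"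
    using lipschitz_of_C1_bounded_support[OF der cont supp] by metis
  have m: "(\<lambda>x. g x \<bullet> w) \<in> borel_measurable lebesgue"
    by (intro measurable_completion borel_measurable_continuous_onI)
      (auto intro!: borel_measurable_continuous_onI continuous_intros cont)
  have d: "AE x in lebesgue. ((\<lambda>t. F (x + t *\<^sub>R w)) has_real_derivative g x \<bullet> w) (at 0)"
    by (intro AE_I2 has_real_derivative_directional der)
  show "integrable lebesgue (\<lambda>x. g x \<bullet> w)" "(LINT x|lebesgue. g x \<bullet> w) = 0"
    using integral_directional_derivative_eq_0[OF L supp d m] by auto
qed


section \<open>The bump function\<close>

text \<open>Only t = 0 is delicate: there the difference quotient is at most |h|^(k-1), which tends
  to 0 because k \<ge> 2.\<close>

lemma has_real_derivative_max_0_power: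
  assumes "k \<ge> 2"
  shows "((\<lambda>t::real. (max 0 t) ^ k) has_real_derivative real k * (max 0 t) ^ (k - 1)) (at t)"
proof -
  obtain m where k: "k = Suc (Suc m)" using assms by (metis add_2_eq_Suc le_Suc_ex)
  show ?thesis
  proof (cases t "0::real" rule: linorder_cases)
    case less
    have "((\<lambda>t::real. 0) has_real_derivative 0) (at t)" by simp
    then have "((\<lambda>t::real. (max 0 t) ^ k) has_real_derivative 0) (at t)"
      by (rule has_field_derivative_transform_within_open[where S = "{..<0}"]) (use less assms in auto)
    then show ?thesis using less by (simp add: k)
  next
    case greater
    have "((\<lambda>t::real. t ^ k) has_real_derivative real k * t ^ (k - 1)) (at t)"
      by (auto intro!: derivative_eq_intros)
    then have "((\<lambda>t::real. (max 0 t) ^ k) has_real_derivative real k * t ^ (k - 1)) (at t)"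
      by (rule has_field_derivative_transform_within_open[where S = "{0<..}"]) (use greater in auto)
    then show ?thesis using greater by simp
  next
    case equal
    have b: "norm (((max 0 h) ^ k - (max 0 0) ^ k) / h) \<le> \<bar>h\<bar> ^ (k - 1)" for h :: real
    proof (cases "h > 0")
      case True
      then show ?thesis by (simp add: k)
    next
      case False
      then have "(max 0 h) ^ k = 0" "(max 0 (0::real)) ^ k = 0" by (simp_all add: k)
      then show ?thesis by (simp only:) simp
    qed
    have "((\<lambda>h::real. \<bar>h\<bar> ^ (k - 1)) \<longlongrightarrow> \<bar>0\<bar> ^ (k - 1)) (at 0)" by (intro tendsto_intros)
    then have z: "((\<lambda>h::real. \<bar>h\<bar> ^ (k - 1)) \<longlongrightarrow> 0) (at 0)" by (simp add: k)
    have "((\<lambda>h::real. ((max 0 h) ^ k - (max 0 0) ^ k) / h) \<longlongrightarrow> 0) (at 0)"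
      by (rule Lim_null_comparison[OF _ z]) (use b in auto)
    then show ?thesis using equal by (simp add: DERIV_def k)
  qed
qed

text \<open>Only Lipschitz across the sphere of radius \<open>r\<close>; its k-th power is of class
  C^(k-1) there. The cube is the test function, the square a C^1 cutoff, and the fourth power serves
  as an antiderivative.\<close>

definition bump :: "'a::euclidean_space \<Rightarrow> real \<Rightarrow> 'a \<Rightarrow> real" where
  "bump x0 r x = max 0 (1 - (norm (x - x0))\<^sup>2 / r\<^sup>2)"

lemma continuous_on_bump [continuous_intros]: "continuous_on A (bump x0 r)"
  unfolding bump_def[abs_def] divide_inverse by (intro continuous_intros)

lemma bump_nonneg [simp]: "0 \<le> bump x0 r x"
  by (simp add: bump_def)

lemma bump_le_1: "bump x0 r x \<le> 1"
  by (simp add: bump_def)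

lemma bump_eq_0: "r > 0 \<Longrightarrow> norm (x - x0) \<ge> r \<Longrightarrow> bump x0 r x = 0"
  by (simp add: bump_def power_mono)

lemma bump_ge: "r > 0 \<Longrightarrow> norm (x - x0) \<le> r / 2 \<Longrightarrow> bump x0 r x \<ge> 3 / 4"
proof -
  assume r: "r > 0" and "norm (x - x0) \<le> r / 2"
  then have "(norm (x - x0))\<^sup>2 \<le> (r / 2)\<^sup>2" by (intro power_mono) auto
  then have "(norm (x - x0))\<^sup>2 / r\<^sup>2 \<le> 1 / 4" using r by (simp add: field_simps power2_eq_square)
  then show ?thesis unfolding bump_def by linarith
qed

section \<open>Derivatives of powers of the bump up to second order\<close>

lemma has_derivative_norm_square:
  "((\<lambda>x. (norm (x - x0))\<^sup>2) has_derivative (\<lambda>h. (2 *\<^sub>R (x - x0)) \<bullet> h)) (at x)"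
  for x :: "'a::euclidean_space"
  unfolding power2_norm_eq_inner
  by (auto intro!: derivative_eq_intros simp: inner_commute)

lemma has_derivative_comp_real:
  assumes "(f has_derivative (\<lambda>h. g \<bullet> h)) (at x)" "(p has_real_derivative p') (at (f x))"
  shows "((\<lambda>x. p (f x)) has_derivative (\<lambda>h. (p' *\<^sub>R g) \<bullet> h)) (at x)"
proof -
  have "((\<lambda>x. p (f x)) has_derivative (\<lambda>h. p' * (g \<bullet> h))) (at x)"
    using diff_chain_at[OF assms(1), of p "\<lambda>h. p' * h"] assms(2)
    by (simp add: has_field_derivative_def o_def)
  then show ?thesis by simp
qed

lemma has_derivative_inner_mult:
  fixes a b :: "'a::euclidean_space \<Rightarrow> real"
  assumes "(a has_derivative (\<lambda>h. ga \<bullet> h)) (at x)" "(b has_derivative (\<lambda>h. gb \<bullet> h)) (at x)"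
  shows "((\<lambda>x. a x * b x) has_derivative (\<lambda>h. (b x *\<^sub>R ga + a x *\<^sub>R gb) \<bullet> h)) (at x)"
  by (rule has_derivative_eq_rhs[OF has_derivative_mult[OF assms]]) (auto simp: algebra_simps)

lemma has_derivative_inner_const: "((\<lambda>x. (x - x0) \<bullet> w) has_derivative (\<lambda>h. w \<bullet> h)) (at x)"
  for x :: "'a::euclidean_space"
  by (auto intro!: derivative_eq_intros simp: inner_commute)

lemma has_derivative_bump_power:
  fixes x0 :: "'a::euclidean_space"
  assumes "k \<ge> 2"
  shows "((\<lambda>x. bump x0 r x ^ k) has_derivative
    (\<lambda>h. ((- 2 * real k / r\<^sup>2 * bump x0 r x ^ (k - 1)) *\<^sub>R (x - x0)) \<bullet> h)) (at x)"
proof -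
  have "((\<lambda>s. (max 0 (1 - s / r\<^sup>2)) ^ k) has_real_derivative
      real k * (max 0 (1 - s / r\<^sup>2)) ^ (k - 1) * (- (1 / r\<^sup>2))) (at s)" for s
    using DERIV_diff[OF DERIV_const DERIV_cdivide[OF DERIV_ident, of "r\<^sup>2"], of 1 s UNIV]
    by (intro DERIV_chain2[OF has_real_derivative_max_0_power[OF assms]]) simp
  from has_derivative_comp_real[OF has_derivative_norm_square[of x0 x] this]
  have D: "((\<lambda>x. bump x0 r x ^ k) has_derivative
    (\<lambda>h. ((real k * bump x0 r x ^ (k - 1) * (- (1 / r\<^sup>2))) *\<^sub>R 2 *\<^sub>R (x - x0)) \<bullet> h)) (at x)"
    unfolding bump_def[abs_def] .
  have "real k * m * (- (1 / r\<^sup>2)) * 2 = - 2 * real k / r\<^sup>2 * m" for m by simp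
  with D show ?thesis by (simp only: scaleR_scaleR)
qed

text \<open>The Laplacian of \<open>bump x0 r x ^ 3\<close>; \<open>bump_lap_eq\<close> recovers it
  as the trace of the Hessian.\<close>

definition bump_lap :: "'a::euclidean_space \<Rightarrow> real \<Rightarrow> 'a \<Rightarrow> real" where
  "bump_lap x0 r x = - 6 * real DIM('a) / r\<^sup>2 * bump x0 r x ^ 2
     + 24 / r ^ 4 * bump x0 r x * (norm (x - x0))\<^sup>2"

definition bump_grad :: "'a::euclidean_space \<Rightarrow> real \<Rightarrow> 'a \<Rightarrow> 'a" where
  "bump_grad x0 r x = (- 6 / r\<^sup>2 * bump x0 r x ^ 2) *\<^sub>R (x - x0)"

lemma has_derivative_bump3:
  "((\<lambda>x. bump x0 r x ^ 3) has_derivative (\<lambda>h. bump_grad x0 r x \<bullet> h)) (at x)"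
  using has_derivative_bump_power[of 3 x0 r x] by (simp add: bump_grad_def)

text \<open>The Hessian of the cubed bump applied to \<open>w\<close>, that is, the gradient of the
  \<open>w\<close>-component of \<open>bump_grad\<close>.\<close>

definition bump_hess :: "'a::euclidean_space \<Rightarrow> real \<Rightarrow> 'a \<Rightarrow> 'a \<Rightarrow> 'a" where
  "bump_hess x0 r w x = (- 6 / r\<^sup>2 * bump x0 r x ^ 2) *\<^sub>R w
     + (24 / r ^ 4 * bump x0 r x * ((x - x0) \<bullet> w)) *\<^sub>R (x - x0)"

lemma has_derivative_bump_grad:
  "((\<lambda>x. bump_grad x0 r x \<bullet> w) has_derivative (\<lambda>h. bump_hess x0 r w x \<bullet> h)) (at x)"
proof -
  have "((\<lambda>x. (- 6 / r\<^sup>2) * (bump x0 r x ^ 2 * ((x - x0) \<bullet> w))) has_derivative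
    (\<lambda>h. (- 6 / r\<^sup>2) * ((((x - x0) \<bullet> w) *\<^sub>R ((- 2 * real 2 / r\<^sup>2 * bump x0 r x ^ (2 - 1)) *\<^sub>R (x - x0))
        + bump x0 r x ^ 2 *\<^sub>R w) \<bullet> h))) (at x)"
    by (intro has_derivative_mult_right has_derivative_inner_mult has_derivative_bump_power
      has_derivative_inner_const) simp
  moreover have "(\<lambda>x. bump_grad x0 r x \<bullet> w) = (\<lambda>x. (- 6 / r\<^sup>2) * (bump x0 r x ^ 2 * ((x - x0) \<bullet> w)))"
    by (simp add: fun_eq_iff bump_grad_def)
  moreover have "(- 6 / r\<^sup>2) * ((((x - x0) \<bullet> w) *\<^sub>R ((- 2 * real 2 / r\<^sup>2 * bump x0 r x ^ (2 - 1)) *\<^sub>R (x - x0))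
        + bump x0 r x ^ 2 *\<^sub>R w) \<bullet> h) = bump_hess x0 r w x \<bullet> h" for h
  proof -
    define a where "a = 1 / r\<^sup>2"
    have a: "- 6 / r\<^sup>2 = - 6 * a" "- 2 * real 2 / r\<^sup>2 = - 4 * a" "24 / r ^ 4 = 24 * (a * a)"
      by (simp_all add: a_def power4_eq_xxxx power2_eq_square)
    show ?thesis unfolding bump_hess_def a by (simp add: inner_left_distrib algebra_simps)
  qed
  ultimately show ?thesis by simp
qed

lemma bump_lap_eq:
  fixes x :: "'a::euclidean_space"
  shows "bump_lap x0 r x = (\<Sum>i\<in>Basis. bump_hess x0 r i x \<bullet> i)"
proof -
  have n: "(norm (x - x0))\<^sup>2 = (\<Sum>i\<in>Basis. ((x - x0) \<bullet> i) * ((x - x0) \<bullet> i))"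
    unfolding power2_norm_eq_inner by (rule euclidean_inner)
  have "bump_hess x0 r i x \<bullet> i = - 6 / r\<^sup>2 * bump x0 r x ^ 2
      + (24 / r ^ 4 * bump x0 r x) * (((x - x0) \<bullet> i) * ((x - x0) \<bullet> i))" if "i \<in> Basis" for i
    using that unfolding bump_hess_def inner_left_distrib inner_scaleR_left by simp
  then have "(\<Sum>i\<in>Basis. bump_hess x0 r i x \<bullet> i) = (\<Sum>i\<in>(Basis :: 'a set). - 6 / r\<^sup>2 * bump x0 r x ^ 2
      + (24 / r ^ 4 * bump x0 r x) * (((x - x0) \<bullet> i) * ((x - x0) \<bullet> i)))"
    by (rule sum.cong[OF refl])
  also have "\<dots> = bump_lap x0 r x"
    unfolding sum.distrib sum_distrib_left[symmetric] n[symmetric] bump_lap_def by simp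
  finally show ?thesis by simp
qed

lemma continuous_on_bump_grad [continuous_intros]: "continuous_on A (bump_grad x0 r)"
  unfolding bump_grad_def[abs_def] by (intro continuous_intros)

lemma continuous_on_bump_hess [continuous_intros]: "continuous_on A (bump_hess x0 r w)"
  unfolding bump_hess_def[abs_def] by (intro continuous_intros)

lemma continuous_on_bump_lap [continuous_intros]: "continuous_on A (bump_lap x0 r)"
  unfolding bump_lap_def[abs_def] by (intro continuous_intros)

lemma bump_grad_eq_0: "r > 0 \<Longrightarrow> norm (x - x0) \<ge> r \<Longrightarrow> bump_grad x0 r x = 0"
  by (simp add: bump_grad_def bump_eq_0)

lemma bump_lap_eq_0: "r > 0 \<Longrightarrow> norm (x - x0) \<ge> r \<Longrightarrow> bump_lap x0 r x = 0"
  by (simp add: bump_lap_def bump_eq_0)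

text \<open>On the ball both \<open>bump\<close> and |x - x0| / r are at most 1, so the two summands
  contribute 6 d and 24. This constant reappears in every residual estimate.\<close>

lemma bump_lap_bound:
  fixes x0 :: "'a::euclidean_space"
  assumes "r > 0"
  shows "\<bar>bump_lap x0 r x\<bar> \<le> (6 * real DIM('a) + 24) / r\<^sup>2"
proof (cases "norm (x - x0) \<ge> r")
  case True then show ?thesis using assms by (simp add: bump_lap_eq_0)
next
  case False
  then have n: "(norm (x - x0))\<^sup>2 \<le> r\<^sup>2" by (intro power_mono) auto
  have A: "\<bar>- 6 * real DIM('a) / r\<^sup>2 * bump x0 r x ^ 2\<bar> \<le> 6 * real DIM('a) / r\<^sup>2"
    using power_le_one[OF bump_nonneg bump_le_1, of x0 r x 2]
    by (auto simp: abs_mult intro!: divide_right_mono mult_left_le)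
  have "\<bar>24 / r ^ 4 * bump x0 r x * (norm (x - x0))\<^sup>2\<bar> \<le> 24 / r ^ 4 * 1 * r\<^sup>2"
    unfolding abs_mult using n bump_le_1[of x0 r x] assms
    by (intro mult_mono) auto
  also have "24 / r ^ 4 * 1 * r\<^sup>2 = 24 / r\<^sup>2"
    using assms by (simp add: power4_eq_xxxx power2_eq_square)
  finally show ?thesis unfolding bump_lap_def add_divide_distrib
    by (intro order_trans[OF abs_triangle_ineq] add_mono A)
qed


text \<open>The component of \<phi> V along i is differentiated in direction i and the results are
  summed. Only the product has to have bounded support, so an affine \<phi> may be paired with a
  compactly supported field and conversely.\<close>

lemma integral_divergence_eq_0:
  fixes \<phi> :: "'a::euclidean_space \<Rightarrow> real" and V g :: "'a \<Rightarrow> 'a"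
  assumes d\<phi>: "\<And>x. (\<phi> has_derivative (\<lambda>h. g x \<bullet> h)) (at x)" and cg: "continuous_on UNIV g"
    and dV: "\<And>i x. i \<in> Basis \<Longrightarrow> ((\<lambda>x. V x \<bullet> i) has_derivative (\<lambda>h. H i x \<bullet> h)) (at x)"
    and cV: "continuous_on UNIV V" and cH: "\<And>i. i \<in> Basis \<Longrightarrow> continuous_on UNIV (H i)"
    and supp: "\<And>x. norm x > R \<Longrightarrow> \<phi> x = 0 \<or> V x = 0"
  shows "integrable lebesgue (\<lambda>x. g x \<bullet> V x + \<phi> x * (\<Sum>i\<in>Basis. H i x \<bullet> i))"
    and "(LINT x|lebesgue. g x \<bullet> V x + \<phi> x * (\<Sum>i\<in>Basis. H i x \<bullet> i)) = 0"
proof -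
  define G where "G i x = (V x \<bullet> i) *\<^sub>R g x + \<phi> x *\<^sub>R H i x" for i x
  have c\<phi>: "continuous_on UNIV \<phi>"
    by (intro continuous_at_imp_continuous_on ballI has_derivative_continuous[OF d\<phi>])
  have *: "integrable lebesgue (\<lambda>x. G i x \<bullet> i)" "(LINT x|lebesgue. G i x \<bullet> i) = 0" if i: "i \<in> Basis" for i
  proof -
    have d: "((\<lambda>x. \<phi> x * (V x \<bullet> i)) has_derivative (\<lambda>h. G i x \<bullet> h)) (at x)" for x
      unfolding G_def by (rule has_derivative_inner_mult[OF d\<phi> dV[OF i]])
    have c: "continuous_on UNIV (G i)"
      unfolding G_def[abs_def] by (intro continuous_intros cV cg c\<phi> cH i)
    have s: "\<phi> x * (V x \<bullet> i) = 0" if "norm x > R" for x using supp[OF that] by auto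
    show "integrable lebesgue (\<lambda>x. G i x \<bullet> i)" "(LINT x|lebesgue. G i x \<bullet> i) = 0"
      using integral_gradient_eq_0[OF d c s] by auto
  qed
  have eq: "g x \<bullet> V x + \<phi> x * (\<Sum>i\<in>Basis. H i x \<bullet> i) = (\<Sum>i\<in>Basis. G i x \<bullet> i)" for x
    by (simp add: G_def inner_left_distrib sum.distrib sum_distrib_left euclidean_inner[of "g x" "V x"] mult.commute)
  show "integrable lebesgue (\<lambda>x. g x \<bullet> V x + \<phi> x * (\<Sum>i\<in>Basis. H i x \<bullet> i))"
    and "(LINT x|lebesgue. g x \<bullet> V x + \<phi> x * (\<Sum>i\<in>Basis. H i x \<bullet> i)) = 0"
    unfolding eq using * by (auto simp: Bochner_Integration.integral_sum)
qed

lemma outside_cball: "norm x > norm x0 + r \<Longrightarrow> norm (x - x0) \<ge> r"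
  for x :: "'a::real_normed_vector"
  using norm_triangle_ineq2[of x x0] by linarith

text \<open>Up to the factor -8 / r^2 the integrand is a directional derivative of the fourth power
  of the bump. Consequently an affine function tested with the cubed bump yields its value at the
  centre.\<close>

lemma integral_inner_bump3_eq_0:
  fixes x0 g :: "'a::euclidean_space"
  assumes "r > 0"
  shows "(LINT x|lebesgue. (g \<bullet> (x - x0)) * bump x0 r x ^ 3) = 0"
proof -
  have d: "((\<lambda>x. bump x0 r x ^ 4) has_derivative
      (\<lambda>h. ((- 2 * real 4 / r\<^sup>2 * bump x0 r x ^ (4 - 1)) *\<^sub>R (x - x0)) \<bullet> h)) (at x)" for x
    by (rule has_derivative_bump_power) simp
  have s: "bump x0 r x ^ 4 = 0" if "norm x > norm x0 + r" for x
    using outside_cball[OF that] assms by (simp add: bump_eq_0)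
  have c: "continuous_on UNIV (\<lambda>x. (- 2 * real 4 / r\<^sup>2 * bump x0 r x ^ (4 - 1)) *\<^sub>R (x - x0))"
    by (intro continuous_intros)
  have "(LINT x|lebesgue. ((- 2 * real 4 / r\<^sup>2 * bump x0 r x ^ (4 - 1)) *\<^sub>R (x - x0)) \<bullet> g) = 0"
    by (rule integral_gradient_eq_0(2)[OF d c s])
  moreover have "((- 2 * real 4 / r\<^sup>2 * bump x0 r x ^ (4 - 1)) *\<^sub>R (x - x0)) \<bullet> g
      = (- 8 / r\<^sup>2) * ((g \<bullet> (x - x0)) * bump x0 r x ^ 3)" for x
    by (simp add: inner_commute)
  ultimately show ?thesis using assms by (simp only: integral_mult_right_zero) simp
qed

text \<open>Affine functions are harmonic. The first integration by parts leaves the constant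
  gradient \<open>g\<close> against \<open>bump_grad\<close>, and the second annihilates it.\<close>

lemma integral_affine_bump_lap_eq_0:
  fixes x0 g :: "'a::euclidean_space"
  assumes "r > 0"
  shows "(LINT x|lebesgue. (g \<bullet> x + c) * bump_lap x0 r x) = 0"
proof -
  have s: "bump_grad x0 r x = 0" "bump x0 r x ^ 3 = 0" if "norm x > norm x0 + r" for x
    using outside_cball[OF that] assms by (auto simp: bump_eq_0 bump_grad_eq_0)
  have a: "((\<lambda>x. g \<bullet> x + c) has_derivative (\<lambda>h. g \<bullet> h)) (at x)" for x
    by (auto intro!: derivative_eq_intros)
  have s': "g \<bullet> x + c = 0 \<or> bump_grad x0 r x = 0" if "norm x > norm x0 + r" for x
    using s(1)[OF that] by simp
  note I = integral_divergence_eq_0[where \<phi> = "\<lambda>x. g \<bullet> x + c" and g = "\<lambda>x. g", OF a _ has_derivative_bump_grad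
     continuous_on_bump_grad continuous_on_bump_hess s', folded bump_lap_eq, simplified]
  note J = integral_gradient_eq_0[where w = g, OF has_derivative_bump3[of x0 r] continuous_on_bump_grad s(2), simplified]
  have "(LINT x|lebesgue. (g \<bullet> x + c) * bump_lap x0 r x)
     = (LINT x|lebesgue. (g \<bullet> bump_grad x0 r x + (g \<bullet> x + c) * bump_lap x0 r x) - bump_grad x0 r x \<bullet> g)"
    by (intro Bochner_Integration.integral_cong) (auto simp: inner_commute)
  also have "\<dots> = (LINT x|lebesgue. g \<bullet> bump_grad x0 r x + (g \<bullet> x + c) * bump_lap x0 r x) - (LINT x|lebesgue. bump_grad x0 r x \<bullet> g)"
    by (rule Bochner_Integration.integral_diff[OF I(1) J(1)])
  also have "\<dots> = 0" using I(2) J(2) by simp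
  finally show ?thesis .
qed

lemma integrable_lebesgue_continuous_compact_support:
  fixes f :: "'a::euclidean_space \<Rightarrow> real"
  assumes c: "continuous_on UNIV f" and s: "\<And>x. norm x > R \<Longrightarrow> f x = 0"
  shows "integrable lebesgue f"
proof -
  have "bounded (f ` cball 0 \<bar>R\<bar>)"
    by (intro compact_imp_bounded compact_continuous_image continuous_on_subset[OF c]) auto
  then obtain B where B: "\<And>x. x \<in> cball 0 \<bar>R\<bar> \<Longrightarrow> norm (f x) \<le> B" unfolding bounded_iff by blast
  show ?thesis
  proof (rule Bochner_Integration.integrable_bound)
    show "integrable lebesgue (\<lambda>x. B * indicator (cball 0 \<bar>R\<bar>) x :: real)"
      by (intro integrable_mult_right integrable_real_indicator) (use emeasure_bounded_finite[OF bounded_cball] in auto)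
    show "f \<in> borel_measurable lebesgue"
      by (intro measurable_completion) (use borel_measurable_continuous_onI[OF c] in simp)
    show "AE x in lebesgue. norm (f x) \<le> norm (B * indicator (cball 0 \<bar>R\<bar>) x :: real)"
    proof (intro AE_I2)
      fix x show "norm (f x) \<le> norm (B * indicator (cball 0 \<bar>R\<bar>) x :: real)"
        using B[of x] s[of x] by (cases "norm x \<le> \<bar>R\<bar>") auto
    qed
  qed
qed

lemma negligible_level_set_inner:
  fixes n x0 :: "'a::euclidean_space"
  assumes "n \<noteq> 0"
  shows "{x. n \<bullet> (x - x0) = 0} \<in> null_sets lebesgue"
proof -
  have "{x. n \<bullet> (x - x0) = 0} = {x. n \<bullet> x = n \<bullet> x0}" by (auto simp: inner_diff_right)
  then show ?thesis using negligible_hyperplane[of n "n \<bullet> x0"] assms by (simp add: negligible_iff_null_sets)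
qed

lemma has_real_derivative_abs:
  assumes "t \<noteq> 0"
  shows "((\<lambda>y::real. \<bar>y\<bar>) has_real_derivative sgn t) (at t)"
proof (cases "t > 0")
  case True
  have "((\<lambda>y::real. y) has_real_derivative 1) (at t)" by simp
  then have "((\<lambda>y::real. \<bar>y\<bar>) has_real_derivative 1) (at t)"
    by (rule has_field_derivative_transform_within_open[where S = "{0<..}"]) (use True in auto)
  then show ?thesis using True by simp
next
  case False
  have "((\<lambda>y::real. - y) has_real_derivative - 1) (at t)" by (auto intro!: derivative_eq_intros)
  then have "((\<lambda>y::real. \<bar>y\<bar>) has_real_derivative - 1) (at t)"
    by (rule has_field_derivative_transform_within_open[where S = "{..<0}"]) (use False assms in auto)
  then show ?thesis using False assms by simp
qed

text \<open>The distributional Laplacian of |t|, t = n . (x - x0), is twice the surface measure of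
  the hyperplane. A single integration by parts avoids it: the gradient of the cubed bump is -6 /
  r^2 times \<open>bump\<close> squared times (x - x0), and sgn(t) n . (x - x0) = |t|.\<close>

lemma integral_abs_bump_lap:
  fixes x0 n :: "'a::euclidean_space"
  assumes r: "r > 0" and n: "norm n = 1"
  shows "(LINT x|lebesgue. \<bar>n \<bullet> (x - x0)\<bar> * bump_lap x0 r x)
      = 6 / r\<^sup>2 * (LINT x|lebesgue. bump x0 r x ^ 2 * \<bar>n \<bullet> (x - x0)\<bar>)"
proof -
  let ?t = "\<lambda>x. n \<bullet> (x - x0)"
  \<comment> \<open>The derivative of |t| times the i-th component of \<open>bump_grad\<close> in
    direction i, valid off the null set t = 0.\<close>
  define D where "D i x = sgn (?t x) * (n \<bullet> i) * (bump_grad x0 r x \<bullet> i) + \<bar>?t x\<bar> * (bump_hess x0 r i x \<bullet> i)" for i x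
  have s: "bump_grad x0 r x = 0" if "norm (x - x0) \<ge> r" for x
    using that r by (simp add: bump_grad_eq_0)
  have s2: "bump_grad x0 r x = 0" if "norm x > norm x0 + r" for x
    using outside_cball[OF that] s by simp
  have t_lip: "\<bar>\<bar>?t x\<bar> - \<bar>?t y\<bar>\<bar> \<le> norm (x - y)" for x y
  proof -
    have "\<bar>\<bar>?t x\<bar> - \<bar>?t y\<bar>\<bar> \<le> \<bar>?t x - ?t y\<bar>" by simp
    also have "?t x - ?t y = n \<bullet> (x - y)" by (simp add: inner_diff_right)
    also have "\<bar>n \<bullet> (x - y)\<bar> \<le> norm (x - y)" using Cauchy_Schwarz_ineq2[of n "x - y"] n by simp
    finally show ?thesis .
  qed
  have ne: "AE x in lebesgue. ?t x \<noteq> 0"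
    proof -
    have "n \<noteq> 0" using n by auto
    from AE_not_in[OF negligible_level_set_inner[OF this, of x0]] show ?thesis by simp
  qed
  have Di: "integrable lebesgue (D i)" "integral\<^sup>L lebesgue (D i) = 0" if i: "i \<in> Basis" for i
  proof -
    let ?U = "\<lambda>x. bump_grad x0 r x \<bullet> i"
    obtain L where L: "L \<ge> 0" "\<And>x y. \<bar>?U x - ?U y\<bar> \<le> L * norm (x - y)"
      by (rule lipschitz_of_C1_bounded_support[OF has_derivative_bump_grad continuous_on_bump_hess, of "norm x0 + r" x0 r i])
        (use s2 in auto)
    have Ub: "\<bar>?U x\<bar> \<le> 6 / r" for x
    proof (cases "norm (x - x0) \<ge> r")
      case True then show ?thesis using s r by simp
    next
      case False
      have "\<bar>?U x\<bar> = 6 / r\<^sup>2 * bump x0 r x ^ 2 * \<bar>(x - x0) \<bullet> i\<bar>"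
        by (simp add: bump_grad_def abs_mult)
      also have "\<dots> \<le> 6 / r\<^sup>2 * 1 * r"
        using False Basis_le_norm[OF i, of "x - x0"] r power_le_one[OF bump_nonneg bump_le_1, of x0 r x 2]
        by (intro mult_mono) auto
      also have "\<dots> = 6 / r" using r by (simp add: power2_eq_square)
      finally show ?thesis .
    qed
    \<comment> \<open>The factor |t| is unbounded, but it is at most \<open>r\<close> as soon as one
      of the two points lies in the ball; if neither does, both products vanish.\<close>
    have in1: "\<bar>\<bar>?t x\<bar> * ?U x - \<bar>?t y\<bar> * ?U y\<bar> \<le> (r * L + 6 / r) * norm (x - y)" if "norm (x - x0) < r" for x y
    proof -
      have tx: "\<bar>?t x\<bar> \<le> r" using Cauchy_Schwarz_ineq2[of n "x - x0"] n that by simp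
      have "\<bar>?t x\<bar> * ?U x - \<bar>?t y\<bar> * ?U y = \<bar>?t x\<bar> * (?U x - ?U y) + (\<bar>?t x\<bar> - \<bar>?t y\<bar>) * ?U y"
        by (simp add: algebra_simps)
      also have "\<bar>\<dots>\<bar> \<le> \<bar>\<bar>?t x\<bar> * (?U x - ?U y)\<bar> + \<bar>(\<bar>?t x\<bar> - \<bar>?t y\<bar>) * ?U y\<bar>" by (rule abs_triangle_ineq)
      also have "\<dots> \<le> r * (L * norm (x - y)) + norm (x - y) * (6 / r)"
        unfolding abs_mult abs_abs using tx L(2)[of x y] t_lip[of x y] Ub[of y] r by (intro add_mono mult_mono) auto
      finally show ?thesis by (simp add: algebra_simps)
    qed
    have lip: "\<bar>\<bar>?t x\<bar> * ?U x - \<bar>?t y\<bar> * ?U y\<bar> \<le> (r * L + 6 / r) * norm (x - y)" for x y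
    proof (cases "norm (x - x0) < r \<or> norm (y - x0) < r")
      case True
      then show ?thesis using in1[of x y] in1[of y x] by (auto simp: norm_minus_commute abs_minus_commute)
    next
      case False
      then show ?thesis using s[of x] s[of y] L(1) r by simp
    qed
    have supp: "\<bar>?t x\<bar> * ?U x = 0" if "norm x > norm x0 + r" for x using s2[OF that] by simp
    have der: "AE x in lebesgue. ((\<lambda>t. \<bar>?t (x + t *\<^sub>R i)\<bar> * ?U (x + t *\<^sub>R i)) has_real_derivative D i x) (at 0)"
      using ne
    proof eventually_elim
      fix x assume "?t x \<noteq> 0"
      then have "((\<lambda>y. \<bar>y\<bar>) has_real_derivative sgn (?t x)) (at (?t x))"
        by (rule has_real_derivative_abs)
      moreover have "(?t has_derivative (\<lambda>h. n \<bullet> h)) (at x)"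
        using has_derivative_inner_const[of x0 n x] by (simp add: inner_commute)
      ultimately have "((\<lambda>x. \<bar>?t x\<bar>) has_derivative (\<lambda>h. (sgn (?t x) *\<^sub>R n) \<bullet> h)) (at x)"
        by (intro has_derivative_comp_real)
      from has_real_derivative_directional[OF has_derivative_inner_mult[OF this has_derivative_bump_grad[of x0 r i x]], of i]
      show "((\<lambda>t. \<bar>?t (x + t *\<^sub>R i)\<bar> * ?U (x + t *\<^sub>R i)) has_real_derivative D i x) (at 0)"
        by (simp add: D_def inner_left_distrib mult_ac)
    qed
    have "D i \<in> borel_measurable borel"
      unfolding D_def[abs_def] sgn_real_def
      by (intro borel_measurable_add borel_measurable_times measurable_If borel_measurable_continuous_onI
         continuous_intros) auto
    then have Dm: "D i \<in> borel_measurable lebesgue"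
      by (intro measurable_completion) simp
    show "integrable lebesgue (D i)" "integral\<^sup>L lebesgue (D i) = 0"
      using integral_directional_derivative_eq_0[OF lip supp der Dm] by auto
  qed
  have eq: "(\<Sum>i\<in>Basis. D i x) = - (6 / r\<^sup>2) * (bump x0 r x ^ 2 * \<bar>?t x\<bar>) + \<bar>?t x\<bar> * bump_lap x0 r x" for x
  proof -
    have "(\<Sum>i\<in>Basis. D i x) = sgn (?t x) * (n \<bullet> bump_grad x0 r x) + \<bar>?t x\<bar> * bump_lap x0 r x"
      by (simp add: D_def sum.distrib euclidean_inner[of n "bump_grad x0 r x"] bump_lap_eq sum_distrib_left mult.assoc)
    also have "sgn (?t x) * (n \<bullet> bump_grad x0 r x) = - (6 / r\<^sup>2) * (bump x0 r x ^ 2 * \<bar>?t x\<bar>)"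
      unfolding bump_grad_def inner_scaleR_right by (simp add: abs_sgn)
    finally show ?thesis .
  qed
  have i1: "integrable lebesgue (\<lambda>x. bump x0 r x ^ 2 * \<bar>?t x\<bar>)"
    by (rule integrable_lebesgue_continuous_compact_support[of _ "norm x0 + r"])
      (use outside_cball[of x0 r] r in \<open>auto intro!: continuous_intros simp: bump_eq_0\<close>)
  have i2: "integrable lebesgue (\<lambda>x. \<bar>?t x\<bar> * bump_lap x0 r x)"
    by (rule integrable_lebesgue_continuous_compact_support[of _ "norm x0 + r"])
      (use outside_cball[of x0 r] r in \<open>auto intro!: continuous_intros simp: bump_lap_eq_0\<close>)
  have "0 = (LINT x|lebesgue. (\<Sum>i\<in>Basis. D i x))" using Di by (simp add: Bochner_Integration.integral_sum)
  also have "\<dots> = - (6 / r\<^sup>2) * (LINT x|lebesgue. bump x0 r x ^ 2 * \<bar>?t x\<bar>) + (LINT x|lebesgue. \<bar>?t x\<bar> * bump_lap x0 r x)"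
    unfolding eq using i1 i2 by (subst Bochner_Integration.integral_add) auto
  finally show ?thesis by simp
qed

text \<open>The integral is restricted to a small ball moved off the hyperplane by r/4 along the
  normal. There \<open>bump\<close> is at least 3/4 and |t| at least r/8, and 6 * 9/16 * 1/8 =
  27/64.\<close>

lemma integral_abs_bump_lap_ge:
  fixes x0 n :: "'a::euclidean_space"
  assumes r: "r > 0" and n: "norm n = 1"
  shows "27 / 64 * unit_ball_vol DIM('a) / 8 ^ DIM('a) * r ^ DIM('a) / r \<le> (LINT x|lebesgue. \<bar>n \<bullet> (x - x0)\<bar> * bump_lap x0 r x)"
proof -
  let ?t = "\<lambda>x. n \<bullet> (x - x0)"
  let ?B = "ball (x0 + (r / 4) *\<^sub>R n) (r / 8)"
  have i1: "integrable lebesgue (\<lambda>x. bump x0 r x ^ 2 * \<bar>?t x\<bar>)"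
    by (rule integrable_lebesgue_continuous_compact_support[of _ "norm x0 + r"])
      (use outside_cball[of x0 r] r in \<open>auto intro!: continuous_intros simp: bump_eq_0\<close>)
  have b: "(9 / 16) * (r / 8) * indicator ?B x \<le> bump x0 r x ^ 2 * \<bar>?t x\<bar>" for x
  proof (cases "x \<in> ?B")
    case True
    define z where "z = x - x0 - (r / 4) *\<^sub>R n"
    have z: "norm z < r / 8" using True by (simp add: z_def dist_norm norm_minus_commute algebra_simps)
    have xz: "x - x0 = z + (r / 4) *\<^sub>R n" by (simp add: z_def)
    have "norm (x - x0) \<le> norm z + r / 4" unfolding xz using norm_triangle_ineq[of z "(r / 4) *\<^sub>R n"] n r by simp
    then have "bump x0 r x \<ge> 3 / 4" using z r by (intro bump_ge) auto
    then have "bump x0 r x ^ 2 \<ge> (3 / 4)\<^sup>2" by (intro power_mono) auto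
    moreover have "?t x = n \<bullet> z + r / 4" unfolding xz using n by (simp add: inner_right_distrib norm_eq_1)
    then have "\<bar>?t x\<bar> \<ge> r / 8" using z Cauchy_Schwarz_ineq2[of n z] n by simp
    ultimately have "(3 / 4)\<^sup>2 * (r / 8) \<le> bump x0 r x ^ 2 * \<bar>?t x\<bar>" using r by (intro mult_mono) auto
    then show ?thesis using True by (simp add: power2_eq_square)
  qed simp
  have "(LINT x|lebesgue. (9 / 16) * (r / 8) * indicator ?B x) \<le> (LINT x|lebesgue. bump x0 r x ^ 2 * \<bar>?t x\<bar>)"
    using b i1 by (intro integral_mono integrable_mult_right integrable_real_indicator)
      (use emeasure_bounded_finite[OF bounded_ball] in auto)
  also have "(LINT x|lebesgue. (9 / 16) * (r / 8) * indicator ?B x) = (9 / 16) * (r / 8) * (unit_ball_vol DIM('a) * (r / 8) ^ DIM('a))"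
    using r by (simp add: content_ball)
  finally have "6 / r\<^sup>2 * ((9 / 16) * (r / 8) * (unit_ball_vol DIM('a) * (r / 8) ^ DIM('a)))
      \<le> 6 / r\<^sup>2 * (LINT x|lebesgue. bump x0 r x ^ 2 * \<bar>?t x\<bar>)"
    by (intro mult_left_mono) auto
  also have "6 / r\<^sup>2 * ((9 / 16) * (r / 8) * (unit_ball_vol DIM('a) * (r / 8) ^ DIM('a)))
     = 27 / 64 * unit_ball_vol DIM('a) / 8 ^ DIM('a) * r ^ DIM('a) / r"
    using r by (simp add: power_divide power2_eq_square field_simps)
  finally show ?thesis unfolding integral_abs_bump_lap[OF r n] .
qed

text \<open>On the concentric ball of half the radius the bump is at least 3/4, and its cube at
  least 27/64.\<close>

lemma integral_bump3_ge:
  fixes x0 :: "'a::euclidean_space"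
  assumes r: "r > 0"
  shows "27 / 64 * unit_ball_vol DIM('a) / 2 ^ DIM('a) * r ^ DIM('a) \<le> (LINT x|lebesgue. bump x0 r x ^ 3)"
    and "integrable lebesgue (\<lambda>x. bump x0 r x ^ 3)"
proof -
  show i1: "integrable lebesgue (\<lambda>x. bump x0 r x ^ 3)"
    by (rule integrable_lebesgue_continuous_compact_support[of _ "norm x0 + r"])
      (use outside_cball[of x0 r] r in \<open>auto intro!: continuous_intros simp: bump_eq_0\<close>)
  have b: "(3 / 4) ^ 3 * indicator (cball x0 (r / 2)) x \<le> bump x0 r x ^ 3" for x
  proof (cases "x \<in> cball x0 (r / 2)")
    case True
    then have "bump x0 r x \<ge> 3 / 4" using r by (intro bump_ge) (auto simp: dist_norm norm_minus_commute)
    then have "bump x0 r x ^ 3 \<ge> (3 / 4) ^ 3" by (intro power_mono) auto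
    then show ?thesis using True by simp
  qed simp
  have "(LINT x|lebesgue. (3 / 4) ^ 3 * indicator (cball x0 (r / 2)) x) \<le> (LINT x|lebesgue. bump x0 r x ^ 3)"
    using b i1 by (intro integral_mono integrable_mult_right integrable_real_indicator)
      (use emeasure_bounded_finite[OF bounded_cball] in auto)
  also have "(LINT x|lebesgue. (3 / 4) ^ 3 * indicator (cball x0 (r / 2)) x) = (3 / 4) ^ 3 * (unit_ball_vol DIM('a) * (r / 2) ^ DIM('a))"
    using r by (simp add: content_cball)
  also have "\<dots> = 27 / 64 * unit_ball_vol DIM('a) / 2 ^ DIM('a) * r ^ DIM('a)"
    by (simp add: power_divide power3_eq_cube)
  finally show "27 / 64 * unit_ball_vol DIM('a) / 2 ^ DIM('a) * r ^ DIM('a) \<le> (LINT x|lebesgue. bump x0 r x ^ 3)" .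
qed


section \<open>Weakly differentiable functions\<close>

lemma continuous_measurable_lebesgue_on:
  fixes f :: "'a::euclidean_space \<Rightarrow> 'b::euclidean_space"
  assumes "continuous_on UNIV f"
  shows "f \<in> borel_measurable (lebesgue_on S)"
  by (intro measurable_restrict_space1 measurable_completion) (use borel_measurable_continuous_onI[OF assms] in simp)

lemma integrable_continuous_lebesgue_on:
  fixes f :: "'a::euclidean_space \<Rightarrow> 'b::euclidean_space"
  assumes c: "continuous_on UNIV f" and S: "bounded S" "S \<in> sets lebesgue"
  shows "integrable (lebesgue_on S) f"
proof -
  have "bounded (f ` closure S)"
    by (intro compact_imp_bounded compact_continuous_image continuous_on_subset[OF c]) (use S in auto)
  then obtain B where B: "\<And>x. x \<in> closure S \<Longrightarrow> norm (f x) \<le> B" unfolding bounded_iff by blast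
  interpret finite_measure "lebesgue_on S"
    by (rule finite_measure_lebesgue_on) (use S in \<open>simp add: bounded_set_imp_lmeasurable\<close>)
  show ?thesis
    by (rule integrable_const_bound[of _ B])
      (auto intro!: AE_I2 continuous_measurable_lebesgue_on c B subsetD[OF closure_subset])
qed

section \<open>L2 pairings and their limits\<close>

lemma Cauchy_Schwarz_integral:
  fixes f g :: "'a \<Rightarrow> real"
  assumes [measurable]: "f \<in> borel_measurable M" "g \<in> borel_measurable M"
    and f2: "integrable M (\<lambda>x. (f x)\<^sup>2)" and g2: "integrable M (\<lambda>x. (g x)\<^sup>2)"
  shows "integrable M (\<lambda>x. f x * g x)"
    and "(LINT x|M. \<bar>f x * g x\<bar>)\<^sup>2 \<le> (LINT x|M. (f x)\<^sup>2) * (LINT x|M. (g x)\<^sup>2)"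
proof -
  show i: "integrable M (\<lambda>x. f x * g x)"
  proof (rule Bochner_Integration.integrable_bound)
    show "integrable M (\<lambda>x. (f x)\<^sup>2 + (g x)\<^sup>2)" using f2 g2 by simp
    show "AE x in M. norm (f x * g x) \<le> norm ((f x)\<^sup>2 + (g x)\<^sup>2)"
    proof (intro AE_I2)
      fix x
      have "0 \<le> (\<bar>f x\<bar> - \<bar>g x\<bar>)\<^sup>2" by simp
      then have "2 * (\<bar>f x\<bar> * \<bar>g x\<bar>) \<le> (f x)\<^sup>2 + (g x)\<^sup>2" by (simp add: power2_diff)
      then show "norm (f x * g x) \<le> norm ((f x)\<^sup>2 + (g x)\<^sup>2)"
        using mult_nonneg_nonneg[of "\<bar>f x\<bar>" "\<bar>g x\<bar>"] unfolding real_norm_def abs_mult by linarith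
    qed
  qed simp
  let ?F = "\<lambda>x. ennreal \<bar>f x\<bar>" and ?G = "\<lambda>x. ennreal \<bar>g x\<bar>"
  have "(\<integral>\<^sup>+x. ?F x * ?G x \<partial>M)\<^sup>2 \<le> (\<integral>\<^sup>+x. ?F x ^ 2 \<partial>M) * (\<integral>\<^sup>+x. ?G x ^ 2 \<partial>M)"
    by (rule Cauchy_Schwarz_nn_integral) auto
  moreover have "(\<integral>\<^sup>+x. ?F x * ?G x \<partial>M) = ennreal (LINT x|M. \<bar>f x * g x\<bar>)"
    using nn_integral_eq_integral[OF integrable_abs[OF i]] by (simp add: ennreal_mult abs_mult)
  moreover have "(\<integral>\<^sup>+x. ?F x ^ 2 \<partial>M) = ennreal (LINT x|M. (f x)\<^sup>2)"
    using f2 by (subst nn_integral_eq_integral[symmetric]) (auto simp: ennreal_power)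
  moreover have "(\<integral>\<^sup>+x. ?G x ^ 2 \<partial>M) = ennreal (LINT x|M. (g x)\<^sup>2)"
    using g2 by (subst nn_integral_eq_integral[symmetric]) (auto simp: ennreal_power)
  ultimately have "ennreal ((LINT x|M. \<bar>f x * g x\<bar>)\<^sup>2) \<le> ennreal ((LINT x|M. (f x)\<^sup>2) * (LINT x|M. (g x)\<^sup>2))"
    by (simp add: ennreal_power ennreal_mult)
  then show "(LINT x|M. \<bar>f x * g x\<bar>)\<^sup>2 \<le> (LINT x|M. (f x)\<^sup>2) * (LINT x|M. (g x)\<^sup>2)"
    by (subst (asm) ennreal_le_iff) auto
qed

lemma integrable_inner_L2:
  fixes u v :: "'a \<Rightarrow> 'b::euclidean_space"
  assumes [measurable]: "u \<in> borel_measurable M" "v \<in> borel_measurable M"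
    and u2: "integrable M (\<lambda>x. (norm (u x))\<^sup>2)" and v2: "integrable M (\<lambda>x. (norm (v x))\<^sup>2)"
  shows "integrable M (\<lambda>x. u x \<bullet> v x)"
    and "(LINT x|M. u x \<bullet> v x)\<^sup>2 \<le> (LINT x|M. (norm (u x))\<^sup>2) * (LINT x|M. (norm (v x))\<^sup>2)"
proof -
  have "integrable M (\<lambda>x. norm (u x) * norm (v x))"
    by (rule Cauchy_Schwarz_integral) (use u2 v2 in auto)
  then show i: "integrable M (\<lambda>x. u x \<bullet> v x)"
    by (rule Bochner_Integration.integrable_bound) (auto intro!: AE_I2 simp: Cauchy_Schwarz_ineq2)
  have "\<bar>LINT x|M. u x \<bullet> v x\<bar> \<le> (LINT x|M. \<bar>u x \<bullet> v x\<bar>)"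
    using integral_norm_bound[of M "\<lambda>x. u x \<bullet> v x"] by simp
  also have "\<dots> \<le> (LINT x|M. \<bar>norm (u x) * norm (v x)\<bar>)"
    by (intro integral_mono integrable_abs i \<open>integrable M (\<lambda>x. norm (u x) * norm (v x))\<close>)
      (auto simp: Cauchy_Schwarz_ineq2)
  finally have "\<bar>LINT x|M. u x \<bullet> v x\<bar>\<^sup>2 \<le> (LINT x|M. \<bar>norm (u x) * norm (v x)\<bar>)\<^sup>2"
    by (intro power_mono) auto
  also have "\<dots> \<le> (LINT x|M. (norm (u x))\<^sup>2) * (LINT x|M. (norm (v x))\<^sup>2)"
    by (rule Cauchy_Schwarz_integral) (use u2 v2 in auto)
  finally show "(LINT x|M. u x \<bullet> v x)\<^sup>2 \<le> (LINT x|M. (norm (u x))\<^sup>2) * (LINT x|M. (norm (v x))\<^sup>2)" by simp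
qed

lemma norm_add_square_le: "(norm (a + b))\<^sup>2 \<le> 2 * (norm a)\<^sup>2 + 2 * (norm b)\<^sup>2"
  for a b :: "'a::real_normed_vector"
proof -
  have "(norm (a + b))\<^sup>2 \<le> (norm a + norm b)\<^sup>2" by (intro power_mono norm_triangle_ineq) simp
  also have "\<dots> \<le> 2 * (norm a)\<^sup>2 + 2 * (norm b)\<^sup>2"
    using zero_le_power2[of "norm a - norm b"] by (simp add: power2_sum power2_diff)
  finally show ?thesis .
qed

lemma integrable_norm_square_add:
  fixes u v :: "'a \<Rightarrow> 'b::euclidean_space"
  assumes [measurable]: "u \<in> borel_measurable M" "v \<in> borel_measurable M"
    and u2: "integrable M (\<lambda>x. (norm (u x))\<^sup>2)" and v2: "integrable M (\<lambda>x. (norm (v x))\<^sup>2)"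
  shows "integrable M (\<lambda>x. (norm (u x + v x))\<^sup>2)"
proof (rule Bochner_Integration.integrable_bound)
  show "integrable M (\<lambda>x. 2 * (norm (u x))\<^sup>2 + 2 * (norm (v x))\<^sup>2)" using u2 v2 by simp
  show "AE x in M. norm ((norm (u x + v x))\<^sup>2) \<le> norm (2 * (norm (u x))\<^sup>2 + 2 * (norm (v x))\<^sup>2)"
    by (intro AE_I2) (use norm_add_square_le in simp)
qed simp

lemma integrable_norm_square_diff:
  fixes u v :: "'a \<Rightarrow> 'b::euclidean_space"
  assumes "u \<in> borel_measurable M" "v \<in> borel_measurable M"
    and "integrable M (\<lambda>x. (norm (u x))\<^sup>2)" and "integrable M (\<lambda>x. (norm (v x))\<^sup>2)"
  shows "integrable M (\<lambda>x. (norm (u x - v x))\<^sup>2)"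
  using integrable_norm_square_add[of u M "\<lambda>x. - v x"] assms by simp

lemma tendsto_integral_inner_L2:
  fixes u :: "nat \<Rightarrow> 'a \<Rightarrow> 'b::euclidean_space"
  assumes m: "\<And>k. u k \<in> borel_measurable M" "w \<in> borel_measurable M" "v \<in> borel_measurable M"
    and i: "\<And>k. integrable M (\<lambda>x. (norm (u k x))\<^sup>2)" "integrable M (\<lambda>x. (norm (w x))\<^sup>2)"
      "integrable M (\<lambda>x. (norm (v x))\<^sup>2)"
    and lim: "(\<lambda>k. LINT x|M. (norm (u k x - w x))\<^sup>2) \<longlonglongrightarrow> 0"
  shows "(\<lambda>k. LINT x|M. u k x \<bullet> v x) \<longlonglongrightarrow> (LINT x|M. w x \<bullet> v x)"
proof -
  have d: "integrable M (\<lambda>x. (norm (u k x - w x))\<^sup>2)" for k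
    by (intro integrable_norm_square_diff m i)
  have md: "(\<lambda>x. u k x - w x) \<in> borel_measurable M" for k using m by simp
  have eq: "(LINT x|M. u k x \<bullet> v x) - (LINT x|M. w x \<bullet> v x) = (LINT x|M. (u k x - w x) \<bullet> v x)" for k
    using integrable_inner_L2(1)[OF m(1) m(3) i(1) i(3), of k] integrable_inner_L2(1)[OF m(2) m(3) i(2) i(3)]
    by (simp add: inner_diff_left)
  have b: "norm ((LINT x|M. u k x \<bullet> v x) - (LINT x|M. w x \<bullet> v x))
      \<le> sqrt ((LINT x|M. (norm (u k x - w x))\<^sup>2) * (LINT x|M. (norm (v x))\<^sup>2))" for k
    unfolding eq real_norm_def by (rule real_le_rsqrt) (use integrable_inner_L2(2)[OF md m(3) d i(3)] in simp)
  have "(\<lambda>k. sqrt ((LINT x|M. (norm (u k x - w x))\<^sup>2) * (LINT x|M. (norm (v x))\<^sup>2))) \<longlonglongrightarrow>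
      sqrt (0 * (LINT x|M. (norm (v x))\<^sup>2))"
    by (intro tendsto_intros lim)
  then have "(\<lambda>k. (LINT x|M. u k x \<bullet> v x) - (LINT x|M. w x \<bullet> v x)) \<longlonglongrightarrow> 0"
    using Lim_null_comparison[OF always_eventually[OF allI[OF b]]] by simp
  then show ?thesis by (rule LIM_zero_cancel)
qed

lemma C1c_grad_eq_0:
  assumes "\<And>x. (\<phi> has_derivative (\<lambda>h. g x \<bullet> h)) (at x)" and K: "closed K" "\<And>x. x \<notin> K \<Longrightarrow> \<phi> x = 0" and x: "x \<notin> K"
  shows "g x = (0 :: 'a::euclidean_space)"
proof -
  have "((\<lambda>_. 0) has_derivative (\<lambda>h. g x \<bullet> h)) (at x)"
    by (rule has_derivative_transform_within_open[OF assms(1), of "- K"]) (use K x in auto)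
  from has_derivative_unique[OF this has_derivative_const] have "(\<lambda>h. g x \<bullet> h) = (\<lambda>h. 0)" .
  then have "g x \<bullet> g x = 0" by (rule fun_cong)
  then show ?thesis by simp
qed

lemma C1c_continuous:
  assumes "C1c \<Omega> \<phi> g"
  shows "continuous_on UNIV \<phi>" "continuous_on UNIV g"
  using assms unfolding C1c_def
  by (auto intro!: continuous_at_imp_continuous_on dest: has_derivative_continuous)

text \<open>The compact support of \<phi> inside \<Omega> makes the integral over \<Omega> agree
  with the one over the whole space, so \<open>V\<close> may be arbitrary near the boundary and no
  boundary term appears.\<close>

lemma C1c_integral_divergence:
  fixes V :: "'a::euclidean_space \<Rightarrow> 'a"
  assumes C: "C1c \<Omega> \<phi> g" and \<Omega>: "\<Omega> \<in> sets lebesgue"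
    and dV: "\<And>i x. i \<in> Basis \<Longrightarrow> ((\<lambda>x. V x \<bullet> i) has_derivative (\<lambda>h. H i x \<bullet> h)) (at x)"
    and cV: "continuous_on UNIV V" and cH: "\<And>i. i \<in> Basis \<Longrightarrow> continuous_on UNIV (H i)"
  shows "(LINT x|lebesgue_on \<Omega>. g x \<bullet> V x + \<phi> x * (\<Sum>i\<in>Basis. H i x \<bullet> i)) = 0"
proof -
  obtain K where K: "compact K" "K \<subseteq> \<Omega>" "\<And>x. x \<notin> K \<Longrightarrow> \<phi> x = 0"
    and d: "\<And>x. (\<phi> has_derivative (\<lambda>h. g x \<bullet> h)) (at x)"
    and c: "continuous_on UNIV g" using C by (auto simp: C1c_def)
  obtain R where R: "\<And>x. x \<in> K \<Longrightarrow> norm x \<le> R" using compact_imp_bounded[OF K(1)] unfolding bounded_iff by blast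
  have s: "\<phi> x = 0 \<or> V x = 0" if "norm x > R" for x using K(3)[of x] R[of x] that by auto
  have g0: "g x = 0" if "x \<notin> K" for x
    by (rule C1c_grad_eq_0[OF d compact_imp_closed[OF K(1)] K(3) that])
  have "(LINT x|lebesgue_on \<Omega>. g x \<bullet> V x + \<phi> x * (\<Sum>i\<in>Basis. H i x \<bullet> i))
      = (LINT x|lebesgue. indicator \<Omega> x *\<^sub>R (g x \<bullet> V x + \<phi> x * (\<Sum>i\<in>Basis. H i x \<bullet> i)))"
    using \<Omega> by (intro integral_restrict_space) simp
  also have "\<dots> = (LINT x|lebesgue. g x \<bullet> V x + \<phi> x * (\<Sum>i\<in>Basis. H i x \<bullet> i))"
  proof (intro Bochner_Integration.integral_cong refl)
    fix x show "indicator \<Omega> x *\<^sub>R (g x \<bullet> V x + \<phi> x * (\<Sum>i\<in>Basis. H i x \<bullet> i)) = g x \<bullet> V x + \<phi> x * (\<Sum>i\<in>Basis. H i x \<bullet> i)"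
      using subsetD[OF K(2), of x] K(3)[of x] g0[of x] by (cases "x \<in> \<Omega>"; cases "x \<in> K") auto
  qed
  also have "\<dots> = 0" by (rule integral_divergence_eq_0(2)[OF d c dV cV cH s])
  finally show ?thesis .
qed

lemma continuous_square_integrable:
  fixes f :: "'a::euclidean_space \<Rightarrow> 'b::euclidean_space"
  assumes "continuous_on UNIV f" "bounded S" "S \<in> sets lebesgue"
  shows "integrable (lebesgue_on S) (\<lambda>x. (norm (f x))\<^sup>2)"
  by (intro integrable_continuous_lebesgue_on continuous_intros assms)

text \<open>The identity holds along the approximating C^1 functions. \<open>V\<close> and its
  divergence are continuous, hence square integrable on the bounded domain, and both L2 pairings
  pass to the limit.\<close>

lemma H10_integral_divergence:
  fixes V :: "'a::euclidean_space \<Rightarrow> 'a"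
  assumes y: "H10 \<Omega> y G" and \<Omega>: "\<Omega> \<in> sets lebesgue" "bounded \<Omega>"
    and dV: "\<And>i x. i \<in> Basis \<Longrightarrow> ((\<lambda>x. V x \<bullet> i) has_derivative (\<lambda>h. H i x \<bullet> h)) (at x)"
    and cV: "continuous_on UNIV V" and cH: "\<And>i. i \<in> Basis \<Longrightarrow> continuous_on UNIV (H i)"
  shows "(LINT x|lebesgue_on \<Omega>. G x \<bullet> V x) = - (LINT x|lebesgue_on \<Omega>. y x * (\<Sum>i\<in>Basis. H i x \<bullet> i))"
proof -
  let ?M = "lebesgue_on \<Omega>"
  define D where "D x = (\<Sum>i\<in>Basis. H i x \<bullet> i)" for x
  have cD: "continuous_on UNIV D" unfolding D_def[abs_def] by (intro continuous_intros cH)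
  obtain \<phi> g where C: "\<And>k. C1c \<Omega> (\<phi> k) (g k)"
    and l1: "(\<lambda>k. LINT x|?M. (\<phi> k x - y x)\<^sup>2) \<longlonglongrightarrow> 0"
    and l2: "(\<lambda>k. LINT x|?M. (norm (g k x - G x))\<^sup>2) \<longlonglongrightarrow> 0"
    and ym: "y \<in> borel_measurable ?M" and y2: "integrable ?M (\<lambda>x. (y x)\<^sup>2)"
    and Gm: "G \<in> borel_measurable ?M" and G2: "integrable ?M (\<lambda>x. (norm (G x))\<^sup>2)"
    using y unfolding H10_def L2fun_def by auto
  note c1 = C1c_continuous(1)[OF C] and c2 = C1c_continuous(2)[OF C]
  note mc = continuous_measurable_lebesgue_on and ic = continuous_square_integrable[OF _ \<Omega>(2,1)]
  have A: "(\<lambda>k. LINT x|?M. g k x \<bullet> V x) \<longlonglongrightarrow> (LINT x|?M. G x \<bullet> V x)"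
    by (rule tendsto_integral_inner_L2[OF mc[OF c2] Gm mc[OF cV] ic[OF c2] G2 ic[OF cV] l2])
  have B: "(\<lambda>k. LINT x|?M. \<phi> k x \<bullet> D x) \<longlonglongrightarrow> (LINT x|?M. y x \<bullet> D x)"
    by (rule tendsto_integral_inner_L2[OF mc[OF c1] ym mc[OF cD] ic[OF c1] _ ic[OF cD]]) (use y2 l1 in auto)
  have Z: "(LINT x|?M. g k x \<bullet> V x) + (LINT x|?M. \<phi> k x \<bullet> D x) = 0" for k
  proof -
    have "(LINT x|?M. g k x \<bullet> V x) + (LINT x|?M. \<phi> k x \<bullet> D x) = (LINT x|?M. g k x \<bullet> V x + \<phi> k x \<bullet> D x)"
      by (intro Bochner_Integration.integral_add[symmetric] integrable_continuous_lebesgue_on continuous_intros c1 c2 cV cD \<Omega>)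
    also have "\<dots> = 0" using C1c_integral_divergence[OF C \<Omega>(1) dV cV cH] by (simp add: D_def)
    finally show ?thesis .
  qed
  have "(LINT x|?M. G x \<bullet> V x) + (LINT x|?M. y x \<bullet> D x) = 0"
    using tendsto_add[OF A B] unfolding Z by (simp add: LIMSEQ_const_iff)
  then show ?thesis by (simp add: D_def)
qed

lemma C1c_imp_H10:
  assumes C: "C1c \<Omega> \<phi> g" and \<Omega>: "\<Omega> \<in> sets lebesgue" "bounded \<Omega>"
  shows "H10 \<Omega> \<phi> g"
proof -
  note c1 = C1c_continuous(1)[OF C] and c2 = C1c_continuous(2)[OF C]
  note mc = continuous_measurable_lebesgue_on and ic = continuous_square_integrable[OF _ \<Omega>(2,1)]
  show ?thesis unfolding H10_def L2fun_def
    using mc[OF c1, of \<Omega>] mc[OF c2, of \<Omega>] ic[OF c1] ic[OF c2] C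
    by (auto intro!: exI[of _ "\<lambda>_::nat. \<phi>"] exI[of _ "\<lambda>_::nat. g"])
qed

text \<open>The cubed bump is an admissible test function, and a second integration by parts moves
  the remaining derivative from \<open>y\<close> to the bump. In this very weak form the gradient of
  \<open>y\<close> no longer occurs.\<close>

lemma weak_sol_bump:
  fixes x0 :: "'a::euclidean_space"
  assumes w: "weak_sol \<Omega> f y" and \<Omega>: "\<Omega> \<in> sets lebesgue" "bounded \<Omega>" and r: "r > 0" "cball x0 r \<subseteq> \<Omega>"
  shows "(LINT x|lebesgue_on \<Omega>. y x * bump_lap x0 r x) = - (LINT x|lebesgue_on \<Omega>. f x * bump x0 r x ^ 3)"
proof -
  have C: "C1c \<Omega> (\<lambda>x. bump x0 r x ^ 3) (bump_grad x0 r)"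
    unfolding C1c_def
  proof (intro conjI exI[of _ "cball x0 r"] allI impI)
    show "bump x0 r x ^ 3 = 0" if "x \<notin> cball x0 r" for x
      using that r by (subst bump_eq_0) (auto simp: dist_norm norm_minus_commute)
  qed (use r in \<open>auto intro: has_derivative_bump3 continuous_on_bump_grad\<close>)
  obtain G where G: "H10 \<Omega> y G" "\<And>v Gv. H10 \<Omega> v Gv \<Longrightarrow>
        (LINT x|lebesgue_on \<Omega>. G x \<bullet> Gv x) = (LINT x|lebesgue_on \<Omega>. f x * v x)"
    using w unfolding weak_sol_def by blast
  have "(LINT x|lebesgue_on \<Omega>. G x \<bullet> bump_grad x0 r x) = (LINT x|lebesgue_on \<Omega>. f x * bump x0 r x ^ 3)"
    by (rule G(2)[OF C1c_imp_H10[OF C \<Omega>]])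
  moreover have "(LINT x|lebesgue_on \<Omega>. G x \<bullet> bump_grad x0 r x) = - (LINT x|lebesgue_on \<Omega>. y x * bump_lap x0 r x)"
    unfolding bump_lap_eq
    by (rule H10_integral_divergence[OF G(1) \<Omega> has_derivative_bump_grad continuous_on_bump_grad continuous_on_bump_hess])
  ultimately show ?thesis by simp
qed


text \<open>The compositions of \<eta> with the approximating functions approximate the composition
  with u. In the gradients, \<eta>1(\<phi>) (g - G) is controlled by the L2 convergence of the
  gradients, whereas (\<eta>1(\<phi>) - \<eta>1(u)) G needs pointwise convergence because \<eta>1 is
  merely continuous and bounded. The condition \<eta>(0) = 0 preserves the compact supports.\<close>

lemma H10_compose:
  fixes u :: "'a::euclidean_space \<Rightarrow> real"
  assumes u: "H10 \<Omega> u G" and \<Omega>: "\<Omega> \<in> sets lebesgue" "bounded \<Omega>"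
    and der: "\<And>t. (\<eta> has_real_derivative \<eta>1 t) (at t)" and c1: "continuous_on UNIV \<eta>1"
    and bd: "\<And>t. \<bar>\<eta>1 t\<bar> \<le> L" and \<eta>0: "\<eta> 0 = 0"
  shows "H10 \<Omega> (\<lambda>x. \<eta> (u x)) (\<lambda>x. \<eta>1 (u x) *\<^sub>R G x)"
proof -
  let ?M = "lebesgue_on \<Omega>"
  obtain \<phi> g where C: "\<And>k. C1c \<Omega> (\<phi> k) (g k)"
    and l1: "(\<lambda>k. LINT x|?M. (\<phi> k x - u x)\<^sup>2) \<longlonglongrightarrow> 0"
    and l2: "(\<lambda>k. LINT x|?M. (norm (g k x - G x))\<^sup>2) \<longlonglongrightarrow> 0"
    and um[measurable]: "u \<in> borel_measurable ?M" and u2: "integrable ?M (\<lambda>x. (u x)\<^sup>2)"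
    and Gm[measurable]: "G \<in> borel_measurable ?M" and G2: "integrable ?M (\<lambda>x. (norm (G x))\<^sup>2)"
    using u unfolding H10_def L2fun_def by auto
  note cp = C1c_continuous(1)[OF C] and cg = C1c_continuous(2)[OF C]
  have pm[measurable]: "\<phi> k \<in> borel_measurable ?M" and gm[measurable]: "g k \<in> borel_measurable ?M" for k
    by (rule continuous_measurable_lebesgue_on[OF cp], rule continuous_measurable_lebesgue_on[OF cg])
  have [measurable]: "\<eta>1 \<in> borel_measurable borel" by (rule borel_measurable_continuous_onI[OF c1])
  have c\<eta>: "continuous_on UNIV \<eta>"
    by (intro continuous_at_imp_continuous_on ballI DERIV_isCont[OF der])
  then have [measurable]: "\<eta> \<in> borel_measurable borel" by (rule borel_measurable_continuous_onI)
  have L0: "L \<ge> 0" using bd[of 0] by simp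
  have lip: "\<bar>\<eta> s - \<eta> t\<bar> \<le> L * \<bar>s - t\<bar>" for s t
    using field_differentiable_bound[of UNIV \<eta> \<eta>1 L s t] der bd by simp
  have lip2: "(\<eta> s - \<eta> t)\<^sup>2 \<le> L\<^sup>2 * (s - t)\<^sup>2" for s t
    using power_mono[OF lip[of s t], of 2] by (simp add: power_mult_distrib)
  have d2: "integrable ?M (\<lambda>x. (\<phi> k x - u x)\<^sup>2)" for k
    using integrable_norm_square_diff[of "\<phi> k" ?M u] continuous_square_integrable[OF cp \<Omega>(2,1)] u2 by simp
  have dg2: "integrable ?M (\<lambda>x. (norm (g k x - G x))\<^sup>2)" for k
    using integrable_norm_square_diff[of "g k" ?M G] continuous_square_integrable[OF cg \<Omega>(2,1)] G2 by simp
  \<comment> \<open>L2 convergence gives almost everywhere convergence only along a subsequence;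
    both approximating sequences are replaced by it.\<close>
  obtain r where r: "strict_mono r" and ae0: "AE x in ?M. (\<lambda>n. (\<phi> (r n) x - u x)\<^sup>2) \<longlonglongrightarrow> 0"
    using tendsto_L1_AE_subseq[of ?M "\<lambda>n x. (\<phi> n x - u x)\<^sup>2"] d2 l1 by auto
  have ae: "AE x in ?M. (\<lambda>n. \<phi> (r n) x) \<longlonglongrightarrow> u x"
    using ae0
  proof eventually_elim
    fix x assume "(\<lambda>n. (\<phi> (r n) x - u x)\<^sup>2) \<longlonglongrightarrow> 0"
    then have "(\<lambda>n. sqrt ((\<phi> (r n) x - u x)\<^sup>2)) \<longlonglongrightarrow> sqrt 0" by (rule tendsto_real_sqrt)
    then have "(\<lambda>n. \<bar>\<phi> (r n) x - u x\<bar>) \<longlonglongrightarrow> 0" by simp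
    then show "(\<lambda>n. \<phi> (r n) x) \<longlonglongrightarrow> u x" by (simp add: LIM_zero_cancel tendsto_rabs_zero_iff)
  qed
  define p where "p n x = \<eta> (\<phi> (r n) x)" for n x
  define q where "q n x = \<eta>1 (\<phi> (r n) x) *\<^sub>R g (r n) x" for n x
  have Cq: "C1c \<Omega> (p n) (q n)" for n
  proof -
    obtain K where K: "compact K" "K \<subseteq> \<Omega>" "\<And>x. x \<notin> K \<Longrightarrow> \<phi> (r n) x = 0"
      and d: "\<And>x. (\<phi> (r n) has_derivative (\<lambda>h. g (r n) x \<bullet> h)) (at x)"
      using C[of "r n"] by (auto simp: C1c_def)
    have "(p n has_derivative (\<lambda>h. q n x \<bullet> h)) (at x)" for x
      unfolding p_def[abs_def] q_def by (rule has_derivative_comp_real[OF d der])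
    moreover have "continuous_on UNIV (q n)"
      unfolding q_def[abs_def] by (intro continuous_intros cg continuous_on_compose2[OF c1 cp]) simp
    moreover have "p n x = 0" if "x \<notin> K" for x using K(3)[OF that] \<eta>0 by (simp add: p_def)
    ultimately show ?thesis unfolding C1c_def using K(1,2) by blast
  qed
  have lr1: "(\<lambda>n. LINT x|?M. (\<phi> (r n) x - u x)\<^sup>2) \<longlonglongrightarrow> 0"
    using LIMSEQ_subseq_LIMSEQ[OF l1 r] by (simp add: o_def)
  have lr2: "(\<lambda>n. LINT x|?M. (norm (g (r n) x - G x))\<^sup>2) \<longlonglongrightarrow> 0"
    using LIMSEQ_subseq_LIMSEQ[OF l2 r] by (simp add: o_def)
  have e2: "integrable ?M (\<lambda>x. (\<eta> (u x))\<^sup>2)"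
    by (rule Bochner_Integration.integrable_bound[of _ "\<lambda>x. L\<^sup>2 * (u x)\<^sup>2"])
      (use u2 lip2[of _ 0] \<eta>0 in \<open>auto intro!: AE_I2\<close>)
  have h2: "integrable ?M (\<lambda>x. (norm (\<eta>1 (u x) *\<^sub>R G x))\<^sup>2)"
  proof (rule Bochner_Integration.integrable_bound[of _ "\<lambda>x. L\<^sup>2 * (norm (G x))\<^sup>2"])
    show "AE x in ?M. norm ((norm (\<eta>1 (u x) *\<^sub>R G x))\<^sup>2) \<le> norm (L\<^sup>2 * (norm (G x))\<^sup>2)"
    proof (intro AE_I2)
      fix x show "norm ((norm (\<eta>1 (u x) *\<^sub>R G x))\<^sup>2) \<le> norm (L\<^sup>2 * (norm (G x))\<^sup>2)"
        using mult_right_mono[OF power_mono[OF bd[of "u x"], of 2], of "(norm (G x))\<^sup>2"]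
        by (simp add: power_mult_distrib)
    qed
  qed (use G2 in auto)
  have lim1: "(\<lambda>n. LINT x|?M. (p n x - \<eta> (u x))\<^sup>2) \<longlonglongrightarrow> 0"
  proof (rule tendsto_sandwich[of "\<lambda>_. 0"])
    show "\<forall>\<^sub>F n in sequentially. (LINT x|?M. (p n x - \<eta> (u x))\<^sup>2) \<le> L\<^sup>2 * (LINT x|?M. (\<phi> (r n) x - u x)\<^sup>2)"
    proof (intro always_eventually allI)
      fix n
      have "(LINT x|?M. (p n x - \<eta> (u x))\<^sup>2) \<le> (LINT x|?M. L\<^sup>2 * (\<phi> (r n) x - u x)\<^sup>2)"
        using lip2 d2 by (intro integral_mono') (auto simp: p_def)
      then show "(LINT x|?M. (p n x - \<eta> (u x))\<^sup>2) \<le> L\<^sup>2 * (LINT x|?M. (\<phi> (r n) x - u x)\<^sup>2)" by simp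
    qed
    show "(\<lambda>n. L\<^sup>2 * (LINT x|?M. (\<phi> (r n) x - u x)\<^sup>2)) \<longlonglongrightarrow> 0"
      using tendsto_mult_left[OF lr1, of "L\<^sup>2"] by simp
  qed auto
  let ?d = "\<lambda>n x. (\<eta>1 (\<phi> (r n) x) - \<eta>1 (u x))\<^sup>2 * (norm (G x))\<^sup>2"
  \<comment> \<open>Twice the bound \<open>L\<close> on \<eta>1, squared, gives the integrable
    majorant for dominated convergence.\<close>
  have db: "norm (?d n x) \<le> 4 * L\<^sup>2 * (norm (G x))\<^sup>2" for n x
  proof -
    have "\<bar>\<eta>1 (\<phi> (r n) x) - \<eta>1 (u x)\<bar> \<le> 2 * L" using bd[of "\<phi> (r n) x"] bd[of "u x"] by linarith
    from power_mono[OF this, of 2] have "(\<eta>1 (\<phi> (r n) x) - \<eta>1 (u x))\<^sup>2 \<le> 4 * L\<^sup>2"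
      by (simp add: power_mult_distrib)
    then show ?thesis by (simp add: mult_right_mono)
  qed
  have di: "integrable ?M (?d n)" for n
    by (rule Bochner_Integration.integrable_bound[of _ "\<lambda>x. 4 * L\<^sup>2 * (norm (G x))\<^sup>2"])
      (use G2 db in \<open>auto intro!: AE_I2\<close>)
  have dlim: "(\<lambda>n. LINT x|?M. ?d n x) \<longlonglongrightarrow> (LINT x|?M. 0)"
  proof (rule integral_dominated_convergence[of _ _ _ "\<lambda>x. 4 * L\<^sup>2 * (norm (G x))\<^sup>2"])
    show "AE x in ?M. (\<lambda>n. ?d n x) \<longlonglongrightarrow> 0"
      using ae
    proof eventually_elim
      fix x assume "(\<lambda>n. \<phi> (r n) x) \<longlonglongrightarrow> u x"
      moreover have "isCont \<eta>1 (u x)" using c1 by (simp add: continuous_on_eq_continuous_at)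
      ultimately have "(\<lambda>n. \<eta>1 (\<phi> (r n) x)) \<longlonglongrightarrow> \<eta>1 (u x)" by (rule isCont_tendsto_compose[rotated])
      then have "(\<lambda>n. ?d n x) \<longlonglongrightarrow> (\<eta>1 (u x) - \<eta>1 (u x))\<^sup>2 * (norm (G x))\<^sup>2" by (intro tendsto_intros)
      then show "(\<lambda>n. ?d n x) \<longlonglongrightarrow> 0" by simp
    qed
  qed (use G2 db in auto)
  have lim2: "(\<lambda>n. LINT x|?M. (norm (q n x - \<eta>1 (u x) *\<^sub>R G x))\<^sup>2) \<longlonglongrightarrow> 0"
  proof (rule tendsto_sandwich[of "\<lambda>_. 0"])
    show "\<forall>\<^sub>F n in sequentially. (LINT x|?M. (norm (q n x - \<eta>1 (u x) *\<^sub>R G x))\<^sup>2)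
        \<le> 2 * L\<^sup>2 * (LINT x|?M. (norm (g (r n) x - G x))\<^sup>2) + 2 * (LINT x|?M. ?d n x)"
    proof (intro always_eventually allI)
      fix n
      have b: "(norm (q n x - \<eta>1 (u x) *\<^sub>R G x))\<^sup>2 \<le> 2 * L\<^sup>2 * (norm (g (r n) x - G x))\<^sup>2 + 2 * ?d n x" for x
      proof -
        have "q n x - \<eta>1 (u x) *\<^sub>R G x = \<eta>1 (\<phi> (r n) x) *\<^sub>R (g (r n) x - G x) + (\<eta>1 (\<phi> (r n) x) - \<eta>1 (u x)) *\<^sub>R G x"
          by (simp add: q_def algebra_simps)
        then have "(norm (q n x - \<eta>1 (u x) *\<^sub>R G x))\<^sup>2 \<le> 2 * (norm (\<eta>1 (\<phi> (r n) x) *\<^sub>R (g (r n) x - G x)))\<^sup>2 + 2 * ?d n x"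
          using norm_add_square_le[of "\<eta>1 (\<phi> (r n) x) *\<^sub>R (g (r n) x - G x)" "(\<eta>1 (\<phi> (r n) x) - \<eta>1 (u x)) *\<^sub>R G x"]
          by (simp add: power_mult_distrib)
        moreover have "(norm (\<eta>1 (\<phi> (r n) x) *\<^sub>R (g (r n) x - G x)))\<^sup>2 \<le> L\<^sup>2 * (norm (g (r n) x - G x))\<^sup>2"
          using mult_right_mono[OF power_mono[OF bd[of "\<phi> (r n) x"], of 2], of "(norm (g (r n) x - G x))\<^sup>2"]
          by (simp add: power_mult_distrib)
        ultimately show ?thesis by linarith
      qed
      have "(LINT x|?M. (norm (q n x - \<eta>1 (u x) *\<^sub>R G x))\<^sup>2)
          \<le> (LINT x|?M. 2 * L\<^sup>2 * (norm (g (r n) x - G x))\<^sup>2 + 2 * ?d n x)"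
        using b dg2 di by (intro integral_mono') auto
      then show "(LINT x|?M. (norm (q n x - \<eta>1 (u x) *\<^sub>R G x))\<^sup>2)
        \<le> 2 * L\<^sup>2 * (LINT x|?M. (norm (g (r n) x - G x))\<^sup>2) + 2 * (LINT x|?M. ?d n x)"
        using dg2 di by simp
    qed
    show "(\<lambda>n. 2 * L\<^sup>2 * (LINT x|?M. (norm (g (r n) x - G x))\<^sup>2) + 2 * (LINT x|?M. ?d n x)) \<longlonglongrightarrow> 0"
      using tendsto_add[OF tendsto_mult_left[OF lr2, of "2 * L\<^sup>2"] tendsto_mult_left[OF dlim, of 2]] by simp
  qed auto
  show ?thesis unfolding H10_def L2fun_def
    using e2 h2 lim1 lim2 Cq by (intro conjI exI[of _ p] exI[of _ q]) auto
qed

text \<open>On the compact closure of \<Omega> both \<open>b\<close> and its gradient are bounded,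
  so multiplication by \<open>b\<close> is continuous on the approximating sequence. The factor
  \<open>b\<close> itself need not vanish on the boundary.\<close>

lemma H10_mult:
  fixes u b :: "'a::euclidean_space \<Rightarrow> real"
  assumes u: "H10 \<Omega> u G" and \<Omega>: "\<Omega> \<in> sets lebesgue" "bounded \<Omega>"
    and der: "\<And>x. (b has_derivative (\<lambda>h. gb x \<bullet> h)) (at x)" and cgb: "continuous_on UNIV gb"
  shows "H10 \<Omega> (\<lambda>x. u x * b x) (\<lambda>x. b x *\<^sub>R G x + u x *\<^sub>R gb x)"
proof -
  let ?M = "lebesgue_on \<Omega>"
  obtain \<phi> g where C: "\<And>k. C1c \<Omega> (\<phi> k) (g k)"
    and l1: "(\<lambda>k. LINT x|?M. (\<phi> k x - u x)\<^sup>2) \<longlonglongrightarrow> 0"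
    and l2: "(\<lambda>k. LINT x|?M. (norm (g k x - G x))\<^sup>2) \<longlonglongrightarrow> 0"
    and um[measurable]: "u \<in> borel_measurable ?M" and u2: "integrable ?M (\<lambda>x. (u x)\<^sup>2)"
    and Gm[measurable]: "G \<in> borel_measurable ?M" and G2: "integrable ?M (\<lambda>x. (norm (G x))\<^sup>2)"
    using u unfolding H10_def L2fun_def by auto
  note cp = C1c_continuous(1)[OF C] and cg = C1c_continuous(2)[OF C]
  have pm[measurable]: "\<phi> k \<in> borel_measurable ?M" and gm[measurable]: "g k \<in> borel_measurable ?M" for k
    by (rule continuous_measurable_lebesgue_on[OF cp], rule continuous_measurable_lebesgue_on[OF cg])
  have cb: "continuous_on UNIV b"
    by (intro continuous_at_imp_continuous_on ballI has_derivative_continuous[OF der])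
  have [measurable]: "b \<in> borel_measurable ?M" "gb \<in> borel_measurable ?M"
    by (rule continuous_measurable_lebesgue_on[OF cb], rule continuous_measurable_lebesgue_on[OF cgb])
  have "bounded (b ` closure \<Omega>)" "bounded (gb ` closure \<Omega>)"
    by (intro compact_imp_bounded compact_continuous_image continuous_on_subset[OF cb] continuous_on_subset[OF cgb]; use \<Omega> in auto)+
  then obtain B1 B2 where B12: "\<And>x. x \<in> closure \<Omega> \<Longrightarrow> norm (b x) \<le> B1" "\<And>x. x \<in> closure \<Omega> \<Longrightarrow> norm (gb x) \<le> B2"
    unfolding bounded_iff by blast
  define B where "B = max B1 B2"
  have B: "\<bar>b x\<bar> \<le> B" "norm (gb x) \<le> B" if "x \<in> \<Omega>" for x
    using B12[of x] closure_subset[of \<Omega>] that by (auto simp: B_def)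
  have s1: "(s * b x)\<^sup>2 \<le> B\<^sup>2 * s\<^sup>2" if "x \<in> \<Omega>" for x s
    using mult_right_mono[OF power_mono[OF B(1)[OF that], of 2], of "s\<^sup>2"] by (simp add: power_mult_distrib mult.commute)
  have s2: "(norm (b x *\<^sub>R w + s *\<^sub>R gb x))\<^sup>2 \<le> 2 * B\<^sup>2 * (norm w)\<^sup>2 + 2 * B\<^sup>2 * s\<^sup>2" if "x \<in> \<Omega>" for x s w
  proof -
    have "(norm (b x *\<^sub>R w + s *\<^sub>R gb x))\<^sup>2 \<le> 2 * ((b x)\<^sup>2 * (norm w)\<^sup>2) + 2 * (s\<^sup>2 * (norm (gb x))\<^sup>2)"
      using norm_add_square_le[of "b x *\<^sub>R w" "s *\<^sub>R gb x"] by (simp add: power_mult_distrib)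
    moreover have "(b x)\<^sup>2 * (norm w)\<^sup>2 \<le> B\<^sup>2 * (norm w)\<^sup>2"
      using mult_right_mono[OF power_mono[OF B(1)[OF that], of 2], of "(norm w)\<^sup>2"] by simp
    moreover have "s\<^sup>2 * (norm (gb x))\<^sup>2 \<le> s\<^sup>2 * B\<^sup>2"
      using mult_left_mono[OF power_mono[OF B(2)[OF that], of 2], of "s\<^sup>2"] by simp
    ultimately show ?thesis by (simp only: mult.assoc mult.commute[of "s\<^sup>2" "B\<^sup>2"])
  qed
  have d2: "integrable ?M (\<lambda>x. (\<phi> k x - u x)\<^sup>2)" for k
    using integrable_norm_square_diff[of "\<phi> k" ?M u] continuous_square_integrable[OF cp \<Omega>(2,1)] u2 by simp
  have dg2: "integrable ?M (\<lambda>x. (norm (g k x - G x))\<^sup>2)" for k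
    using integrable_norm_square_diff[of "g k" ?M G] continuous_square_integrable[OF cg \<Omega>(2,1)] G2 by simp
  define p where "p n x = \<phi> n x * b x" for n x
  define q where "q n x = b x *\<^sub>R g n x + \<phi> n x *\<^sub>R gb x" for n x
  have Cq: "C1c \<Omega> (p n) (q n)" for n
  proof -
    obtain K where K: "compact K" "K \<subseteq> \<Omega>" "\<And>x. x \<notin> K \<Longrightarrow> \<phi> n x = 0"
      and d: "\<And>x. (\<phi> n has_derivative (\<lambda>h. g n x \<bullet> h)) (at x)"
      using C[of n] by (auto simp: C1c_def)
    have "(p n has_derivative (\<lambda>h. q n x \<bullet> h)) (at x)" for x
      unfolding p_def[abs_def] q_def by (rule has_derivative_inner_mult[OF d der])
    moreover have "continuous_on UNIV (q n)"
      unfolding q_def[abs_def] by (intro continuous_intros cg cp cb cgb)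
    moreover have "p n x = 0" if "x \<notin> K" for x using K(3)[OF that] by (simp add: p_def)
    ultimately show ?thesis unfolding C1c_def using K(1,2) by blast
  qed
  have e2: "integrable ?M (\<lambda>x. (u x * b x)\<^sup>2)"
    by (rule Bochner_Integration.integrable_bound[of _ "\<lambda>x. B\<^sup>2 * (u x)\<^sup>2"])
      (use u2 s1 in \<open>auto intro!: AE_I2\<close>)
  have h2: "integrable ?M (\<lambda>x. (norm (b x *\<^sub>R G x + u x *\<^sub>R gb x))\<^sup>2)"
    by (rule Bochner_Integration.integrable_bound[of _ "\<lambda>x. 2 * B\<^sup>2 * (norm (G x))\<^sup>2 + 2 * B\<^sup>2 * (u x)\<^sup>2"])
      (use u2 G2 s2 in \<open>auto intro!: AE_I2\<close>)
  have lim1: "(\<lambda>n. LINT x|?M. (p n x - u x * b x)\<^sup>2) \<longlonglongrightarrow> 0"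
  proof (rule tendsto_sandwich[of "\<lambda>_. 0"])
    show "\<forall>\<^sub>F n in sequentially. (LINT x|?M. (p n x - u x * b x)\<^sup>2) \<le> B\<^sup>2 * (LINT x|?M. (\<phi> n x - u x)\<^sup>2)"
    proof (intro always_eventually allI)
      fix n
      have "(LINT x|?M. (p n x - u x * b x)\<^sup>2) \<le> (LINT x|?M. B\<^sup>2 * (\<phi> n x - u x)\<^sup>2)"
        using d2 s1 by (intro integral_mono') (auto simp: p_def left_diff_distrib[symmetric])
      then show "(LINT x|?M. (p n x - u x * b x)\<^sup>2) \<le> B\<^sup>2 * (LINT x|?M. (\<phi> n x - u x)\<^sup>2)" by simp
    qed
    show "(\<lambda>n. B\<^sup>2 * (LINT x|?M. (\<phi> n x - u x)\<^sup>2)) \<longlonglongrightarrow> 0"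
      using tendsto_mult_left[OF l1, of "B\<^sup>2"] by simp
  qed auto
  have lim2: "(\<lambda>n. LINT x|?M. (norm (q n x - (b x *\<^sub>R G x + u x *\<^sub>R gb x)))\<^sup>2) \<longlonglongrightarrow> 0"
  proof (rule tendsto_sandwich[of "\<lambda>_. 0"])
    show "\<forall>\<^sub>F n in sequentially. (LINT x|?M. (norm (q n x - (b x *\<^sub>R G x + u x *\<^sub>R gb x)))\<^sup>2)
       \<le> 2 * B\<^sup>2 * (LINT x|?M. (norm (g n x - G x))\<^sup>2) + 2 * B\<^sup>2 * (LINT x|?M. (\<phi> n x - u x)\<^sup>2)"
    proof (intro always_eventually allI)
      fix n
      have eq: "q n x - (b x *\<^sub>R G x + u x *\<^sub>R gb x) = b x *\<^sub>R (g n x - G x) + (\<phi> n x - u x) *\<^sub>R gb x" for x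
        by (simp add: q_def algebra_simps)
      have "(LINT x|?M. (norm (q n x - (b x *\<^sub>R G x + u x *\<^sub>R gb x)))\<^sup>2)
         \<le> (LINT x|?M. 2 * B\<^sup>2 * (norm (g n x - G x))\<^sup>2 + 2 * B\<^sup>2 * (\<phi> n x - u x)\<^sup>2)"
        unfolding eq using d2 dg2 s2 by (intro integral_mono') auto
      then show "(LINT x|?M. (norm (q n x - (b x *\<^sub>R G x + u x *\<^sub>R gb x)))\<^sup>2)
       \<le> 2 * B\<^sup>2 * (LINT x|?M. (norm (g n x - G x))\<^sup>2) + 2 * B\<^sup>2 * (LINT x|?M. (\<phi> n x - u x)\<^sup>2)"
        using d2 dg2 by simp
    qed
    show "(\<lambda>n. 2 * B\<^sup>2 * (LINT x|?M. (norm (g n x - G x))\<^sup>2) + 2 * B\<^sup>2 * (LINT x|?M. (\<phi> n x - u x)\<^sup>2)) \<longlonglongrightarrow> 0"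
      using tendsto_add[OF tendsto_mult_left[OF l2, of "2 * B\<^sup>2"] tendsto_mult_left[OF l1, of "2 * B\<^sup>2"]] by simp
  qed auto
  show ?thesis unfolding H10_def L2fun_def
    using e2 h2 lim1 lim2 Cq by (intro conjI exI[of _ p] exI[of _ q]) auto
qed

text \<open>It vanishes at 0, so composition preserves zero boundary values; it is convex, with
  second derivative (1 + t^2)^(-3/2); its slope is at most 1 in modulus; and it exceeds |t| - 1, so
  bounding it bounds |t|.\<close>

definition smooth_abs :: "real \<Rightarrow> real" where "smooth_abs t = sqrt (1 + t\<^sup>2) - 1"

lemma smooth_abs_ge: "\<bar>t\<bar> - 1 \<le> smooth_abs t" and smooth_abs_nonneg: "0 \<le> smooth_abs t"
proof -
  have "sqrt (t\<^sup>2) \<le> sqrt (1 + t\<^sup>2)" "sqrt 1 \<le> sqrt (1 + t\<^sup>2)" by (intro real_sqrt_le_mono; simp)+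
  then show "\<bar>t\<bar> - 1 \<le> smooth_abs t" "0 \<le> smooth_abs t" by (simp_all add: smooth_abs_def)
qed

lemma smooth_abs_deriv: "(smooth_abs has_real_derivative t / sqrt (1 + t\<^sup>2)) (at t)"
proof -
  have "1 + t\<^sup>2 > 0" by (simp add: add_pos_nonneg)
  then show ?thesis unfolding smooth_abs_def[abs_def]
    by (auto intro!: derivative_eq_intros simp: field_simps)
qed

lemma smooth_sgn_deriv: "((\<lambda>t. t / sqrt (1 + t\<^sup>2)) has_real_derivative 1 / (sqrt (1 + t\<^sup>2)) ^ 3) (at t)"
proof -
  have p: "1 + t\<^sup>2 > 0" by (simp add: add_pos_nonneg)
  define s where "s = sqrt (1 + t\<^sup>2)"
  have s: "s > 0" "s * s = 1 + t\<^sup>2" using p by (auto simp: s_def)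
  have "((\<lambda>t. sqrt (1 + t\<^sup>2)) has_real_derivative t / s) (at t)"
    using DERIV_add[OF smooth_abs_deriv[of t] DERIV_const[of 1]] by (simp add: smooth_abs_def s_def)
  from DERIV_divide[OF DERIV_ident this] have "((\<lambda>t. t / sqrt (1 + t\<^sup>2)) has_real_derivative (1 * s - t * (t / s)) / (s * s)) (at t)"
    using s by (simp add: s_def)
  moreover have "(1 * s - t * (t / s)) / (s * s) = 1 / s ^ 3"
  proof -
    have "(1 * s - t * (t / s)) = (s * s - t\<^sup>2) / s" using s(1) by (simp add: field_simps power2_eq_square)
    also have "\<dots> = 1 / s" using s(2) by simp
    finally show ?thesis by (simp add: power3_eq_cube)
  qed
  ultimately show ?thesis by (simp add: s_def)
qed

text \<open>This is -\<Delta> \<psi>(u) \<le> |f| tested with a nonnegative \<open>b\<close>, where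
  \<psi> is \<open>smooth_abs\<close>. The gradient of \<psi>'(u) b is \<psi>'(u) \<open>gb\<close>
  plus b \<psi>''(u) G. Paired with G, the second part equals b \<psi>''(u) |G|^2 and is dropped by
  convexity, while |\<psi>'| \<le> 1 bounds the right-hand side. Since \<psi>'(u) carries the zero
  boundary values, \<open>b\<close> can be a potential that does not vanish on the boundary.\<close>

lemma Kato_inequality:
  fixes u b :: "'a::euclidean_space \<Rightarrow> real"
  assumes w: "weak_sol \<Omega> f u" and f: "L2fun \<Omega> f" and \<Omega>: "\<Omega> \<in> sets lebesgue" "bounded \<Omega>"
    and der: "\<And>x. (b has_derivative (\<lambda>h. gb x \<bullet> h)) (at x)" and cgb: "continuous_on UNIV gb"
    and dH: "\<And>i x. i \<in> Basis \<Longrightarrow> ((\<lambda>x. gb x \<bullet> i) has_derivative (\<lambda>h. H i x \<bullet> h)) (at x)"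
    and cH: "\<And>i. i \<in> Basis \<Longrightarrow> continuous_on UNIV (H i)"
    and b0: "\<And>x. x \<in> \<Omega> \<Longrightarrow> b x \<ge> 0"
  shows "- (LINT x|lebesgue_on \<Omega>. smooth_abs (u x) * (\<Sum>i\<in>Basis. H i x \<bullet> i)) \<le> (LINT x|lebesgue_on \<Omega>. \<bar>f x * b x\<bar>)"
    and "\<And>c. continuous_on UNIV c \<Longrightarrow> integrable (lebesgue_on \<Omega>) (\<lambda>x. smooth_abs (u x) * c x)"
proof -
  let ?M = "lebesgue_on \<Omega>"
  let ?z = "\<lambda>t::real. t / sqrt (1 + t\<^sup>2)" and ?z1 = "\<lambda>t::real. 1 / (sqrt (1 + t\<^sup>2)) ^ 3"
  have p: "1 + t\<^sup>2 > 0" for t :: real by (simp add: add_pos_nonneg)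
  have p1: "sqrt (1 + t\<^sup>2) \<ge> 1" for t :: real by simp
  obtain G where G: "H10 \<Omega> u G" "\<And>v Gv. H10 \<Omega> v Gv \<Longrightarrow>
        (LINT x|?M. G x \<bullet> Gv x) = (LINT x|?M. f x * v x)"
    using w unfolding weak_sol_def by blast
  have zb: "\<bar>?z t\<bar> \<le> 1" for t
  proof -
    have "sqrt (t\<^sup>2) \<le> sqrt (1 + t\<^sup>2)" by (intro real_sqrt_le_mono) simp
    then show ?thesis using p[of t] by simp
  qed
  have z1b: "0 \<le> ?z1 t" "\<bar>?z1 t\<bar> \<le> 1" for t
  proof -
    have "1 \<le> (sqrt (1 + t\<^sup>2)) ^ 3" by (rule one_le_power[OF p1])
    moreover have "0 \<le> 1 / c \<and> \<bar>1 / c\<bar> \<le> 1" if "1 \<le> c" for c :: real using that by simp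
    ultimately show "0 \<le> ?z1 t" "\<bar>?z1 t\<bar> \<le> 1" by blast+
  qed
  have cz: "continuous_on UNIV ?z"
    by (intro continuous_at_imp_continuous_on ballI DERIV_isCont[OF smooth_sgn_deriv])
  have nz: "sqrt (1 + t\<^sup>2) ^ 3 \<noteq> 0" for t :: real using p[of t] by simp
  have cz1: "continuous_on UNIV ?z1"
    by (intro continuous_intros ballI nz)
  have H1: "H10 \<Omega> (\<lambda>x. smooth_abs (u x)) (\<lambda>x. ?z (u x) *\<^sub>R G x)"
    by (rule H10_compose[OF G(1) \<Omega> smooth_abs_deriv cz zb]) (simp add: smooth_abs_def)
  have H2: "H10 \<Omega> (\<lambda>x. ?z (u x)) (\<lambda>x. ?z1 (u x) *\<^sub>R G x)"
    by (rule H10_compose[OF G(1) \<Omega> smooth_sgn_deriv cz1 z1b(2)]) simp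
  have H3: "H10 \<Omega> (\<lambda>x. ?z (u x) * b x) (\<lambda>x. b x *\<^sub>R (?z1 (u x) *\<^sub>R G x) + ?z (u x) *\<^sub>R gb x)" (is "H10 _ ?v ?Gv")
    by (rule H10_mult[OF H2 \<Omega> der cgb])
  have Gm: "G \<in> borel_measurable ?M" "integrable ?M (\<lambda>x. (norm (G x))\<^sup>2)" using G(1) by (auto simp: H10_def)
  have Gvm: "?Gv \<in> borel_measurable ?M" "integrable ?M (\<lambda>x. (norm (?Gv x))\<^sup>2)" using H3 by (auto simp: H10_def)
  have zG: "(\<lambda>x. ?z (u x) *\<^sub>R G x) \<in> borel_measurable ?M" "integrable ?M (\<lambda>x. (norm (?z (u x) *\<^sub>R G x))\<^sup>2)"
    using H1 by (auto simp: H10_def)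
  have vm: "?v \<in> borel_measurable ?M" "integrable ?M (\<lambda>x. (?v x)\<^sup>2)" using H3 by (auto simp: H10_def L2fun_def)
  have fm: "f \<in> borel_measurable ?M" "integrable ?M (\<lambda>x. (f x)\<^sup>2)" using f by (auto simp: L2fun_def)
  have cb: "continuous_on UNIV b"
    by (intro continuous_at_imp_continuous_on ballI has_derivative_continuous[OF der])
  have i1: "integrable ?M (\<lambda>x. (?z (u x) *\<^sub>R G x) \<bullet> gb x)"
    by (rule integrable_inner_L2(1)[OF zG(1) continuous_measurable_lebesgue_on[OF cgb] zG(2) continuous_square_integrable[OF cgb \<Omega>(2,1)]])
  have i2: "integrable ?M (\<lambda>x. G x \<bullet> ?Gv x)"
    by (rule integrable_inner_L2(1)[OF Gm(1) Gvm(1) Gm(2) Gvm(2)])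
  have i3: "integrable ?M (\<lambda>x. f x * ?v x)"
    by (rule Cauchy_Schwarz_integral(1)[OF fm(1) vm(1) fm(2) vm(2)])
  have i4: "integrable ?M (\<lambda>x. f x * b x)"
    by (rule Cauchy_Schwarz_integral(1)[OF fm(1) continuous_measurable_lebesgue_on[OF cb] fm(2)])
      (use continuous_square_integrable[OF cb \<Omega>(2,1)] in simp)
  have "- (LINT x|?M. smooth_abs (u x) * (\<Sum>i\<in>Basis. H i x \<bullet> i)) = (LINT x|?M. (?z (u x) *\<^sub>R G x) \<bullet> gb x)"
    using H10_integral_divergence[OF H1 \<Omega> dH cgb cH] by simp
  also have "\<dots> \<le> (LINT x|?M. G x \<bullet> ?Gv x)"
  proof (rule integral_mono[OF i1 i2])
    fix x assume "x \<in> space ?M"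
    then have "0 \<le> b x * ?z1 (u x) * (G x \<bullet> G x)" using b0 z1b(1) by simp
    then show "(?z (u x) *\<^sub>R G x) \<bullet> gb x \<le> G x \<bullet> ?Gv x" by (simp add: inner_right_distrib)
  qed
  also have "\<dots> = (LINT x|?M. f x * ?v x)" by (rule G(2)[OF H3])
  also have "\<dots> \<le> (LINT x|?M. \<bar>f x * b x\<bar>)"
  proof (rule integral_mono[OF i3 integrable_abs[OF i4]])
    fix x
    have "f x * ?v x \<le> \<bar>f x\<bar> * (\<bar>?z (u x)\<bar> * \<bar>b x\<bar>)" unfolding abs_mult[symmetric] by (rule abs_ge_self)
    also have "\<dots> \<le> \<bar>f x\<bar> * (1 * \<bar>b x\<bar>)" by (intro mult_left_mono mult_right_mono zb) auto
    finally show "f x * ?v x \<le> \<bar>f x * b x\<bar>" by (simp add: abs_mult)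
  qed
  finally show "- (LINT x|?M. smooth_abs (u x) * (\<Sum>i\<in>Basis. H i x \<bullet> i)) \<le> (LINT x|?M. \<bar>f x * b x\<bar>)" .
  have sm: "(\<lambda>x. smooth_abs (u x)) \<in> borel_measurable ?M" "integrable ?M (\<lambda>x. (smooth_abs (u x))\<^sup>2)"
    using H1 by (auto simp: H10_def L2fun_def)
  show "integrable ?M (\<lambda>x. smooth_abs (u x) * c x)" if c: "continuous_on UNIV c" for c
    by (rule Cauchy_Schwarz_integral(1)[OF sm(1) continuous_measurable_lebesgue_on[OF c] sm(2)])
      (use continuous_square_integrable[OF c \<Omega>(2,1)] in simp)
qed


section \<open>Boundedness of weak solutions\<close>

lemma has_derivative_radial:
  fixes x0 :: "'a::euclidean_space"
  assumes \<epsilon>: "\<epsilon> > 0" and P: "\<And>s. s > 0 \<Longrightarrow> (P has_real_derivative P1 s) (at s)"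
  shows "((\<lambda>x. P ((norm (x - x0))\<^sup>2 + \<epsilon>\<^sup>2)) has_derivative
     (\<lambda>h. ((2 * P1 ((norm (x - x0))\<^sup>2 + \<epsilon>\<^sup>2)) *\<^sub>R (x - x0)) \<bullet> h)) (at x)"
proof -
  have a1: "((\<lambda>x. (norm (x - x0))\<^sup>2 + \<epsilon>\<^sup>2) has_derivative (\<lambda>h. (2 *\<^sub>R (x - x0)) \<bullet> h)) (at x)"
    using has_derivative_add[OF has_derivative_norm_square[of x0 x] has_derivative_const[of "\<epsilon>\<^sup>2"]] by simp
  have a2: "(norm (x - x0))\<^sup>2 + \<epsilon>\<^sup>2 > 0" using \<epsilon> by (simp add: add_nonneg_pos)
  from has_derivative_comp_real[OF a1 P[OF a2]] show ?thesis by (simp add: mult.commute)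
qed

lemma continuous_on_radial:
  fixes x0 :: "'a::euclidean_space"
  assumes \<epsilon>: "\<epsilon> > 0" and P: "continuous_on {0<..} P"
  shows "continuous_on A (\<lambda>x. P ((norm (x - x0))\<^sup>2 + \<epsilon>\<^sup>2))"
proof (rule continuous_on_compose2[OF P])
  show "continuous_on A (\<lambda>x. (norm (x - x0))\<^sup>2 + \<epsilon>\<^sup>2)" by (intro continuous_intros)
  show "(\<lambda>x. (norm (x - x0))\<^sup>2 + \<epsilon>\<^sup>2) ` A \<subseteq> {0<..}" using \<epsilon> by (auto simp: add_nonneg_pos)
qed

text \<open>Row \<open>i\<close> of the Jacobian of the field Q(s) (x - x0); \<open>Q1\<close> is
  meant to be the derivative of \<open>Q\<close>.\<close>

definition radial_jac where
  "radial_jac Q Q1 \<epsilon> x0 i x = ((x - x0) \<bullet> i) *\<^sub>R ((2 * Q1 ((norm (x - x0))\<^sup>2 + \<epsilon>\<^sup>2)) *\<^sub>R (x - x0))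
      + Q ((norm (x - x0))\<^sup>2 + \<epsilon>\<^sup>2) *\<^sub>R (i :: 'a::euclidean_space)"

lemma has_derivative_radial_field:
  fixes x0 :: "'a::euclidean_space"
  assumes \<epsilon>: "\<epsilon> > 0" and Q: "\<And>s. s > 0 \<Longrightarrow> (Q has_real_derivative Q1 s) (at s)"
  shows "((\<lambda>x. (Q ((norm (x - x0))\<^sup>2 + \<epsilon>\<^sup>2) *\<^sub>R (x - x0)) \<bullet> i) has_derivative
     (\<lambda>h. radial_jac Q Q1 \<epsilon> x0 i x \<bullet> h)) (at x)"
  using has_derivative_inner_mult[OF has_derivative_radial[OF \<epsilon> Q] has_derivative_inner_const[of x0 i x]]
  by (simp add: radial_jac_def)

lemma continuous_on_radial_field:
  fixes x0 :: "'a::euclidean_space"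
  assumes \<epsilon>: "\<epsilon> > 0" and "continuous_on {0<..} Q"
  shows "continuous_on A (\<lambda>x. Q ((norm (x - x0))\<^sup>2 + \<epsilon>\<^sup>2) *\<^sub>R (x - x0))"
  by (intro continuous_intros continuous_on_radial assms)

lemma continuous_on_radial_jac:
  assumes \<epsilon>: "\<epsilon> > 0" and "continuous_on {0<..} Q" and "continuous_on {0<..} Q1"
  shows "continuous_on A (radial_jac Q Q1 \<epsilon> x0 i)"
  unfolding radial_jac_def[abs_def] by (intro continuous_intros continuous_on_radial assms)

lemma divergence_radial_field:
  fixes x x0 :: "'a::euclidean_space"
  shows "(\<Sum>i\<in>Basis. radial_jac Q Q1 \<epsilon> x0 i x \<bullet> i) =
    2 * Q1 ((norm (x - x0))\<^sup>2 + \<epsilon>\<^sup>2) * (norm (x - x0))\<^sup>2 + real DIM('a) * Q ((norm (x - x0))\<^sup>2 + \<epsilon>\<^sup>2)"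
proof -
  define a where "a = 2 * Q1 ((norm (x - x0))\<^sup>2 + \<epsilon>\<^sup>2)"
  define b where "b = Q ((norm (x - x0))\<^sup>2 + \<epsilon>\<^sup>2)"
  have n: "(norm (x - x0))\<^sup>2 = (\<Sum>i\<in>Basis. ((x - x0) \<bullet> i) * ((x - x0) \<bullet> i))"
    unfolding power2_norm_eq_inner by (rule euclidean_inner)
  have "(\<Sum>i\<in>Basis. radial_jac Q Q1 \<epsilon> x0 i x \<bullet> i) = (\<Sum>i\<in>(Basis::'a set). a * (((x - x0) \<bullet> i) * ((x - x0) \<bullet> i)) + b)"
  proof (rule sum.cong[OF refl])
    fix i :: 'a assume "i \<in> Basis"
    then show "radial_jac Q Q1 \<epsilon> x0 i x \<bullet> i = a * (((x - x0) \<bullet> i) * ((x - x0) \<bullet> i)) + b"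
      unfolding radial_jac_def a_def[symmetric] b_def[symmetric] inner_left_distrib inner_scaleR_left
      by simp
  qed
  also have "\<dots> = a * (norm (x - x0))\<^sup>2 + real DIM('a) * b"
    unfolding n by (simp add: sum.distrib sum_distrib_left)
  finally show ?thesis by (simp add: a_def b_def)
qed

text \<open>A bound uniform in \<epsilon> without polar coordinates. The divergence of the squared
  bump times Q(s) (x - x0) integrates to 0; \<open>div\<close> says that the divergence of the field
  alone dominates Q(s), so this part is controlled by the cutoff term, which \<open>Qb\<close>
  bounds. The factor 64/9 is 4, from the gradient of the squared bump, times 16/9, from that square
  being at least 9/16 on \<open>S\<close>.\<close>

lemma integral_radial_bound:
  fixes x0 :: "'a::euclidean_space"
  assumes \<epsilon>: "\<epsilon> > 0" and R: "R > 0"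
    and Q: "\<And>s. s > 0 \<Longrightarrow> (Q has_real_derivative Q1 s) (at s)"
    and Q1c: "continuous_on {0<..} Q1"
    and div: "\<And>s t. 0 < s \<Longrightarrow> 0 \<le> t \<Longrightarrow> t \<le> s \<Longrightarrow> Q s \<le> 2 * Q1 s * t + real DIM('a) * Q s"
    and Qb: "\<And>s t. 0 < s \<Longrightarrow> 0 \<le> t \<Longrightarrow> t \<le> s \<Longrightarrow> t * Q s \<le> t + 1"
    and Qp: "\<And>s. 0 < s \<Longrightarrow> 0 \<le> Q s"
    and S: "S \<subseteq> cball x0 (R / 2)" "S \<in> sets lebesgue"
  shows "(LINT x|lebesgue_on S. Q ((norm (x - x0))\<^sup>2 + \<epsilon>\<^sup>2)) \<le> 64 / 9 * (R\<^sup>2 + 1) / R\<^sup>2 * (unit_ball_vol DIM('a) * R ^ DIM('a))"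
proof -
  have Qc: "continuous_on {0<..} Q"
    by (intro continuous_at_imp_continuous_on ballI DERIV_isCont[OF Q]) simp
  define q where "q x = (norm (x - x0))\<^sup>2 + \<epsilon>\<^sup>2" for x
  have q: "q x > 0" "(norm (x - x0))\<^sup>2 \<le> q x" for x using \<epsilon> by (auto simp: q_def add_nonneg_pos)
  define V where "V x = Q (q x) *\<^sub>R (x - x0)" for x
  define g where "g x = (- 2 * real 2 / R\<^sup>2 * bump x0 R x ^ (2 - 1)) *\<^sub>R (x - x0)" for x
  define D where "D x = (\<Sum>i\<in>Basis. radial_jac Q Q1 \<epsilon> x0 i x \<bullet> i)" for x
  have cV: "continuous_on UNIV V" unfolding V_def[abs_def] q_def
    by (rule continuous_on_radial_field[OF \<epsilon> Qc])
  have cJ: "continuous_on UNIV (radial_jac Q Q1 \<epsilon> x0 i)" for i by (rule continuous_on_radial_jac[OF \<epsilon> Qc Q1c])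
  have cg: "continuous_on UNIV g" unfolding g_def[abs_def] by (intro continuous_intros)
  have cD: "continuous_on UNIV D" unfolding D_def[abs_def] by (intro continuous_intros cJ)
  have cQ: "continuous_on UNIV (\<lambda>x. Q (q x))" unfolding q_def by (rule continuous_on_radial[OF \<epsilon> Qc])
  have s: "bump x0 R x ^ 2 = 0 \<or> V x = 0" if "norm x > norm x0 + R" for x
    using outside_cball[OF that] R by (simp add: bump_eq_0)
  have dd: "((\<lambda>x. bump x0 R x ^ 2) has_derivative (\<lambda>h. g x \<bullet> h)) (at x)" for x
    unfolding g_def by (rule has_derivative_bump_power) simp
  have dV: "((\<lambda>x. V x \<bullet> i) has_derivative (\<lambda>h. radial_jac Q Q1 \<epsilon> x0 i x \<bullet> h)) (at x)" for i x
    unfolding V_def q_def by (rule has_derivative_radial_field[OF \<epsilon> Q])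
  have I: "integrable lebesgue (\<lambda>x. g x \<bullet> V x + bump x0 R x ^ 2 * D x)"
      "(LINT x|lebesgue. g x \<bullet> V x + bump x0 R x ^ 2 * D x) = 0"
    unfolding D_def using integral_divergence_eq_0[OF dd cg dV cV cJ s] by auto
  let ?c = "4 * (R\<^sup>2 + 1) / R\<^sup>2"
  \<comment> \<open>The factor |x - x0|^2 produced by the cutoff gradient and the field compensates
    the singularity of \<open>Q\<close>: their product is at most R^2 + 1 on the ball.\<close>
  have ge: "g x \<bullet> V x \<ge> - ?c * indicator (cball x0 R) x" for x
  proof (cases "x \<in> cball x0 R")
    case True
    then have "norm (x - x0) \<le> R" by (simp add: dist_norm norm_minus_commute)
    then have n: "(norm (x - x0))\<^sup>2 \<le> R\<^sup>2" by (intro power_mono) auto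
    have "bump x0 R x * ((norm (x - x0))\<^sup>2 * Q (q x)) \<le> 1 * (R\<^sup>2 + 1)"
      using bump_le_1[of x0 R x] Qb[OF q(1) _ q(2), of x] n Qp[OF q(1), of x] by (intro mult_mono) auto
    then have "4 / R\<^sup>2 * (bump x0 R x * ((norm (x - x0))\<^sup>2 * Q (q x))) \<le> 4 / R\<^sup>2 * (R\<^sup>2 + 1)"
      by (intro mult_left_mono) auto
    moreover have "g x \<bullet> V x = - (4 / R\<^sup>2 * (bump x0 R x * ((norm (x - x0))\<^sup>2 * Q (q x))))"
      by (simp add: g_def V_def power2_norm_eq_inner)
    ultimately show ?thesis using True by simp
  next
    case False
    then have "bump x0 R x = 0" using R by (intro bump_eq_0) (auto simp: dist_norm norm_minus_commute)
    then show ?thesis using False by (simp add: g_def)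
  qed
  have Dge: "D x \<ge> Q (q x)" for x
    unfolding D_def divergence_radial_field q_def[symmetric]
    using div[OF q(1) _ q(2), of x] by simp
  have Qi: "integrable lebesgue (\<lambda>x. bump x0 R x ^ 2 * Q (q x))"
    by (rule integrable_lebesgue_continuous_compact_support[of _ "norm x0 + R"])
      (use outside_cball[of x0 R] R in \<open>auto intro!: continuous_intros cQ simp: bump_eq_0\<close>)
  have ii: "integrable lebesgue (\<lambda>x. ?c * indicator (cball x0 R) x :: real)"
    by (intro integrable_mult_right integrable_real_indicator) (use emeasure_bounded_finite[OF bounded_cball] in auto)
  have "(LINT x|lebesgue. bump x0 R x ^ 2 * Q (q x) - ?c * indicator (cball x0 R) x) \<le> (LINT x|lebesgue. g x \<bullet> V x + bump x0 R x ^ 2 * D x)"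
  proof (rule integral_mono)
    fix x
    have "bump x0 R x ^ 2 * Q (q x) \<le> bump x0 R x ^ 2 * D x" using Dge by (intro mult_left_mono) auto
    then show "bump x0 R x ^ 2 * Q (q x) - ?c * indicator (cball x0 R) x \<le> g x \<bullet> V x + bump x0 R x ^ 2 * D x"
      using ge[of x] by linarith
  qed (use I Qi ii in auto)
  then have A: "(LINT x|lebesgue. bump x0 R x ^ 2 * Q (q x)) \<le> ?c * (unit_ball_vol DIM('a) * R ^ DIM('a))"
    using I(2) Qi ii R by (simp add: content_cball)
  have "(LINT x|lebesgue_on S. Q (q x)) = (LINT x|lebesgue. indicator S x *\<^sub>R Q (q x))"
    using S(2) by (intro integral_restrict_space) simp
  also have "\<dots> \<le> (LINT x|lebesgue. 16 / 9 * (bump x0 R x ^ 2 * Q (q x)))"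
  proof (rule integral_mono)
    have "bounded S" using S(1) bounded_subset[OF bounded_cball] by blast
    then have "integrable (lebesgue_on S) (\<lambda>x. Q (q x))" by (intro integrable_continuous_lebesgue_on cQ S(2))
    then show "integrable lebesgue (\<lambda>x. indicator S x *\<^sub>R Q (q x))"
      by (subst (asm) integrable_restrict_space) (use S(2) in auto)
    fix x
    show "indicator S x *\<^sub>R Q (q x) \<le> 16 / 9 * (bump x0 R x ^ 2 * Q (q x))"
    proof (cases "x \<in> S")
      case True
      then have "bump x0 R x \<ge> 3 / 4" using R S(1) by (intro bump_ge) (auto simp: dist_norm norm_minus_commute)
      then have "bump x0 R x ^ 2 \<ge> (3 / 4)\<^sup>2" by (intro power_mono) auto
      then have "9 / 16 \<le> bump x0 R x ^ 2" by (simp add: power2_eq_square)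
      from mult_right_mono[OF this Qp[OF q(1)[of x]]] True show ?thesis by simp
    qed (use Qp[OF q(1)] in simp)
  qed (use Qi in simp)
  also have "\<dots> = 16 / 9 * (LINT x|lebesgue. bump x0 R x ^ 2 * Q (q x))" by simp
  also have "\<dots> \<le> 16 / 9 * (?c * (unit_ball_vol DIM('a) * R ^ DIM('a)))" by (intro mult_left_mono A) simp
  also have "\<dots> = 64 / 9 * (R\<^sup>2 + 1) / R\<^sup>2 * (unit_ball_vol DIM('a) * R ^ DIM('a))" using R by (simp add: field_simps)
  finally show ?thesis unfolding q_def .
qed

text \<open>The potential b = P(s) is superharmonic by \<open>lap\<close>, and \<open>lap2\<close>
  makes minus its Laplacian at least 1 / (2 \<epsilon>^d) on the \<epsilon>-ball. So the Kato
  inequality bounds the integral over that ball by the pairing of |f| with b, which Cauchy-Schwarz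
  estimates through \<open>M\<close>.\<close>

lemma ball_mean_bound:
  fixes u :: "'a::euclidean_space \<Rightarrow> real" and x0 :: 'a
  assumes w: "weak_sol \<Omega> f u" and f: "L2fun \<Omega> f" and \<Omega>: "\<Omega> \<in> sets lebesgue" "bounded \<Omega>"
    and \<epsilon>: "0 < \<epsilon>"
    and P: "\<And>s. s > 0 \<Longrightarrow> (P has_real_derivative P1 s) (at s)"
    and P1: "\<And>s. s > 0 \<Longrightarrow> (P1 has_real_derivative P2 s) (at s)"
    and P2: "continuous_on {0<..} P2"
    and lap: "\<And>t. 0 \<le> t \<Longrightarrow> 4 * P2 (t + \<epsilon>\<^sup>2) * t + real DIM('a) * (2 * P1 (t + \<epsilon>\<^sup>2)) \<le> 0"
    and lap2: "\<And>t. 0 \<le> t \<Longrightarrow> t < \<epsilon>\<^sup>2 \<Longrightarrow> 4 * P2 (t + \<epsilon>\<^sup>2) * t + real DIM('a) * (2 * P1 (t + \<epsilon>\<^sup>2)) \<le> - 1 / (2 * \<epsilon> ^ DIM('a))"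
    and pos: "\<And>x. x \<in> \<Omega> \<Longrightarrow> 0 \<le> P ((norm (x - x0))\<^sup>2 + \<epsilon>\<^sup>2)"
    and bd: "(LINT x|lebesgue_on \<Omega>. (P ((norm (x - x0))\<^sup>2 + \<epsilon>\<^sup>2))\<^sup>2) \<le> M"
  shows "(LINT x|lebesgue_on \<Omega>. indicator (ball x0 \<epsilon>) x * smooth_abs (u x))
      \<le> 2 * sqrt ((LINT x|lebesgue_on \<Omega>. (f x)\<^sup>2) * M) * \<epsilon> ^ DIM('a)"
proof -
  let ?M = "lebesgue_on \<Omega>"
  define b where "b x = P ((norm (x - x0))\<^sup>2 + \<epsilon>\<^sup>2)" for x
  define gb where "gb x = (2 * P1 ((norm (x - x0))\<^sup>2 + \<epsilon>\<^sup>2)) *\<^sub>R (x - x0)" for x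
  \<comment> \<open>The gradient of P(s) is itself a radial field, with Q = 2 P'. Its divergence is
    therefore 4 P''(s) t + 2 d P'(s) with t = |x - x0|^2.\<close>
  define H where "H = radial_jac (\<lambda>s. 2 * P1 s) (\<lambda>s. 2 * P2 s) \<epsilon> x0"
  have c1: "continuous_on {0<..} P1" 
    by (intro continuous_at_imp_continuous_on ballI DERIV_isCont[OF P1]) simp
  have c2: "continuous_on {0<..} (\<lambda>s. 2 * P1 s)" "continuous_on {0<..} (\<lambda>s. 2 * P2 s)"
    by (intro continuous_intros c1 P2)+
  have d1: "(b has_derivative (\<lambda>h. gb x \<bullet> h)) (at x)" for x
    unfolding b_def[abs_def] gb_def by (rule has_derivative_radial[OF \<epsilon> P])
  have cgb: "continuous_on UNIV gb"
    unfolding gb_def[abs_def] by (rule continuous_on_radial_field[OF \<epsilon> c2(1)])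
  have P1': "((\<lambda>s. 2 * P1 s) has_real_derivative 2 * P2 s) (at s)" if "s > 0" for s
    by (rule DERIV_cmult[OF P1[OF that]])
  have dH: "((\<lambda>x. gb x \<bullet> i) has_derivative (\<lambda>h. H i x \<bullet> h)) (at x)" for i x
    unfolding gb_def H_def by (rule has_derivative_radial_field[OF \<epsilon> P1'])
  have cH: "continuous_on UNIV (H i)" for i
    unfolding H_def by (rule continuous_on_radial_jac[OF \<epsilon> c2])
  define D where "D x = (\<Sum>i\<in>Basis. H i x \<bullet> i)" for x
  have cD: "continuous_on UNIV D" unfolding D_def[abs_def] by (intro continuous_intros cH)
  have D: "D x = 4 * P2 ((norm (x - x0))\<^sup>2 + \<epsilon>\<^sup>2) * (norm (x - x0))\<^sup>2 + real DIM('a) * (2 * P1 ((norm (x - x0))\<^sup>2 + \<epsilon>\<^sup>2))" for x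
    unfolding D_def H_def divergence_radial_field by simp
  have b0: "0 \<le> b x" if "x \<in> \<Omega>" for x using pos[OF that] by (simp add: b_def)
  have cb: "continuous_on UNIV b"
    by (intro continuous_at_imp_continuous_on ballI has_derivative_continuous[OF d1])
  have K1: "- (LINT x|?M. smooth_abs (u x) * D x) \<le> (LINT x|?M. \<bar>f x * b x\<bar>)"
    unfolding D_def by (rule Kato_inequality(1)[OF w f \<Omega> d1 cgb dH cH b0])
  have K2: "integrable ?M (\<lambda>x. smooth_abs (u x) * c x)" if "continuous_on UNIV c" for c
    by (rule Kato_inequality(2)[OF w f \<Omega> d1 cgb dH cH b0 that])
  have fm: "f \<in> borel_measurable ?M" "integrable ?M (\<lambda>x. (f x)\<^sup>2)" using f by (auto simp: L2fun_def)
  have i0: "integrable ?M (\<lambda>x. smooth_abs (u x))" using K2[of "\<lambda>_. 1"] by simp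
  have i1: "integrable ?M (\<lambda>x. indicator (ball x0 \<epsilon>) x * smooth_abs (u x))"
  proof (rule Bochner_Integration.integrable_bound[OF i0])
    have "indicator (ball x0 \<epsilon>) \<in> borel_measurable lebesgue" by (intro borel_measurable_indicator) simp
    then have "(indicator (ball x0 \<epsilon>) :: 'a \<Rightarrow> real) \<in> borel_measurable ?M"
      by (rule measurable_restrict_space1)
    then show "(\<lambda>x. indicator (ball x0 \<epsilon>) x * smooth_abs (u x)) \<in> borel_measurable ?M"
      using i0 by (intro borel_measurable_times) auto
    show "AE x in ?M. norm (indicator (ball x0 \<epsilon>) x * smooth_abs (u x)) \<le> norm (smooth_abs (u x))"
      by (intro AE_I2) (auto simp: indicator_def smooth_abs_nonneg)
  qed
  have "(LINT x|?M. 1 / (2 * \<epsilon> ^ DIM('a)) * (indicator (ball x0 \<epsilon>) x * smooth_abs (u x))) \<le> (LINT x|?M. - (smooth_abs (u x) * D x))"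
  proof (rule integral_mono)
    show "integrable ?M (\<lambda>x. - (smooth_abs (u x) * D x))" using K2[OF cD] by simp
    show "integrable ?M (\<lambda>x. 1 / (2 * \<epsilon> ^ DIM('a)) * (indicator (ball x0 \<epsilon>) x * smooth_abs (u x)))"
      by (rule integrable_mult_right[OF i1])
    fix x
    show "1 / (2 * \<epsilon> ^ DIM('a)) * (indicator (ball x0 \<epsilon>) x * smooth_abs (u x)) \<le> - (smooth_abs (u x) * D x)"
    proof (cases "x \<in> ball x0 \<epsilon>")
      case True
      then have "norm (x - x0) < \<epsilon>" by (simp add: dist_norm norm_minus_commute)
      then have "(norm (x - x0))\<^sup>2 < \<epsilon>\<^sup>2" by (intro power_strict_mono) auto
      from lap2[OF _ this] have "1 / (2 * \<epsilon> ^ DIM('a)) \<le> - D x" unfolding D by simp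
      from mult_left_mono[OF this smooth_abs_nonneg[of "u x"]] show ?thesis using True by (simp add: mult.commute)
    next
      case False
      have "D x \<le> 0" unfolding D by (rule lap) simp
      then have "0 \<le> - D x" by simp
      from mult_left_mono[OF this smooth_abs_nonneg[of "u x"]] show ?thesis using False by simp
    qed
  qed
  also have "\<dots> = - (LINT x|?M. smooth_abs (u x) * D x)" by simp
  also have "\<dots> \<le> (LINT x|?M. \<bar>f x * b x\<bar>)" by (rule K1)
  also have "\<dots> \<le> sqrt ((LINT x|?M. (f x)\<^sup>2) * (LINT x|?M. (b x)\<^sup>2))"
  proof (rule real_le_rsqrt, rule Cauchy_Schwarz_integral(2))
    show "integrable ?M (\<lambda>x. (b x)\<^sup>2)" using continuous_square_integrable[OF cb \<Omega>(2,1)] by simp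
  qed (use fm continuous_measurable_lebesgue_on[OF cb] in auto)
  also have "\<dots> \<le> sqrt ((LINT x|?M. (f x)\<^sup>2) * M)"
    using bd unfolding b_def by (intro real_sqrt_le_mono mult_left_mono) auto
  finally have "1 / (2 * \<epsilon> ^ DIM('a)) * (LINT x|?M. indicator (ball x0 \<epsilon>) x * smooth_abs (u x)) \<le> sqrt ((LINT x|?M. (f x)\<^sup>2) * M)"
    by simp
  then show ?thesis using \<epsilon> by (simp add: field_simps)
qed

text \<open>One-sided Lebesgue differentiation. Let A be the set where v > M. Disjoint balls centred
  in A cover it up to a null set and stay in an open set of measure at most |A| + e, so the integral
  of v over A is at most M (|A| + e). As e tends to 0, the integral of v - M over A is not positive,
  and A is null.\<close>

lemma AE_le_of_ball_mean_le:
  fixes v :: "'a::euclidean_space \<Rightarrow> real"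
  assumes \<Omega>: "open \<Omega>" "bounded \<Omega>" and v: "integrable (lebesgue_on \<Omega>) v" and v0: "\<And>x. x \<in> \<Omega> \<Longrightarrow> 0 \<le> v x"
    and M: "M \<ge> 0"
    and mean: "\<And>x \<epsilon>. x \<in> \<Omega> \<Longrightarrow> 0 < \<epsilon> \<Longrightarrow> \<epsilon> \<le> 1 \<Longrightarrow>
       (LINT y|lebesgue_on \<Omega>. indicator (ball x \<epsilon>) y * v y) \<le> M * measure lebesgue (ball x \<epsilon>)"
  shows "AE x in lebesgue_on \<Omega>. v x \<le> M"
proof -
  have \<Omega>s: "\<Omega> \<in> sets lebesgue" using \<Omega>(1) by simp
  define w where "w x = indicator \<Omega> x * v x" for x
  have wi: "integrable lebesgue w"
    using v \<Omega>s unfolding w_def by (subst (asm) integrable_restrict_space) auto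
  have w0: "0 \<le> w x" for x using v0 by (auto simp: w_def indicator_def)
  have wm[measurable]: "w \<in> borel_measurable lebesgue" using wi by auto
  define A where "A = {x \<in> \<Omega>. M < w x}"
  have "A = \<Omega> \<inter> {x \<in> space lebesgue. M < w x}" by (auto simp: A_def)
  also have "\<dots> \<in> sets lebesgue" using \<Omega>s wm unfolding borel_measurable_iff_greater by (intro sets.Int) auto
  finally have As: "A \<in> sets lebesgue" .
  have Ab: "bounded A" using \<Omega>(2) by (rule bounded_subset) (auto simp: A_def)
  have Am: "A \<in> lmeasurable" by (rule bounded_set_imp_lmeasurable[OF Ab As])
  \<comment> \<open>The integral of \<open>w\<close> is treated as a measure so that additivity over
    the countable ball family is immediate.\<close>
  define \<nu> where "\<nu> = density lebesgue (\<lambda>x. ennreal (w x))"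
  have s\<nu>: "sets \<nu> = sets lebesgue" by (simp add: \<nu>_def)
  have e\<nu>: "emeasure \<nu> X = ennreal (LINT x|lebesgue. indicator X x * w x)" if "X \<in> sets lebesgue" for X
  proof -
    have iX: "integrable lebesgue (\<lambda>x. indicator X x * w x)"
      using integrable_real_mult_indicator[OF that wi] by (simp add: mult.commute)
    have "emeasure \<nu> X = (\<integral>\<^sup>+x. ennreal (w x) * indicator X x \<partial>lebesgue)"
      unfolding \<nu>_def using that by (intro emeasure_density) auto
    also have "\<dots> = (\<integral>\<^sup>+x. ennreal (indicator X x * w x) \<partial>lebesgue)"
      by (intro nn_integral_cong) (auto simp: indicator_def)
    also have "\<dots> = ennreal (LINT x|lebesgue. indicator X x * w x)"
      using w0 by (intro nn_integral_eq_integral iX) auto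
    finally show ?thesis .
  qed
  have ball: "emeasure \<nu> (ball x r) \<le> ennreal M * emeasure lebesgue (ball x r)" if "x \<in> \<Omega>" "0 < r" "r \<le> 1" for x r
  proof -
    have "(LINT y|lebesgue. indicator (ball x r) y * w y) = (LINT y|lebesgue_on \<Omega>. indicator (ball x r) y * v y)"
      unfolding w_def using \<Omega>s by (subst integral_restrict_space) (auto intro!: Bochner_Integration.integral_cong)
    also have "\<dots> \<le> M * measure lebesgue (ball x r)" by (rule mean[OF that])
    finally have "emeasure \<nu> (ball x r) \<le> ennreal (M * measure lebesgue (ball x r))"
      by (subst e\<nu>) (auto intro: ennreal_leI)
    also have "\<dots> = ennreal M * emeasure lebesgue (ball x r)"
      unfolding emeasure_eq_measure2[OF lmeasurable_ball] using M by (simp add: ennreal_mult)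
    finally show ?thesis .
  qed
  have main: "emeasure \<nu> A \<le> ennreal (M * (measure lebesgue A + e))" if e: "e > 0" for e
  proof -
    obtain U0 where U0: "open U0" "A \<subseteq> U0" "U0 - A \<in> lmeasurable" "emeasure lebesgue (U0 - A) < ennreal e"
      using sets_lebesgue_outer_open[OF As e] by metis
    define U where "U = U0 \<inter> \<Omega>"
    have U: "open U" "A \<subseteq> U" "U \<subseteq> \<Omega>" using U0 \<Omega>(1) by (auto simp: U_def A_def)
    have Um: "U \<in> lmeasurable" using U \<Omega>(2) bounded_subset by (intro lmeasurable_open) blast+
    \<comment> \<open>Radii are capped at 1, the range in which \<open>mean\<close> is available;
      arbitrarily small radii remain, as a Vitali cover requires.\<close>
    define K where "K = {(x, r). x \<in> A \<and> 0 < r \<and> r \<le> 1 \<and> ball x r \<subseteq> U}"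
    have Kc: "\<exists>i. i \<in> K \<and> x \<in> ball (fst i) (snd i) \<and> snd i < d" if "x \<in> A" "0 < d" for x d
    proof -
      obtain r where r: "r > 0" "ball x r \<subseteq> U" using U(1,2) \<open>x \<in> A\<close> unfolding open_contains_ball by blast
      define r' where "r' = min (min r 1) (d / 2)"
      have r': "0 < r'" "r' < d" "r' \<le> 1" "r' \<le> r" using r(1) that(2) by (auto simp: r'_def)
      have "ball x r' \<subseteq> U" using subset_ball[OF r'(4)] r(2) by (rule subset_trans)
      then have "(x, r') \<in> K" using r' that(1) by (simp add: K_def)
      then show ?thesis using r' by (intro exI[of _ "(x, r')"]) simp
    qed
    obtain C where C: "countable C" "C \<subseteq> K"
      "pairwise (\<lambda>i j. disjnt (ball (fst i) (snd i)) (ball (fst j) (snd j))) C"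
      "negligible (A - (\<Union>i\<in>C. ball (fst i) (snd i)))"
      using Vitali_covering_theorem_balls[of A K fst snd, OF Kc] by blast
    let ?B = "\<lambda>i. ball (fst i) (snd i)"
    have dis: "disjoint_family_on ?B C" using C(3) by (auto simp: disjoint_family_on_def pairwise_def disjnt_def)
    have "?B i \<subseteq> U" if "i \<in> C" for i using subsetD[OF C(2) that] by (simp add: K_def split_beta)
    then have UB: "(\<Union>i\<in>C. ?B i) \<subseteq> U" by (rule UN_least)
    have Us: "(\<Union>i\<in>C. ?B i) \<in> sets lebesgue" by (rule sets.countable_UN''[OF C(1)]) simp
    have N: "A - (\<Union>i\<in>C. ?B i) \<in> null_sets lebesgue" using C(4) by (simp add: negligible_iff_null_sets)
    have N\<nu>: "emeasure \<nu> (A - (\<Union>i\<in>C. ?B i)) = 0"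
    proof -
      have "(LINT x|lebesgue. indicator (A - (\<Union>i\<in>C. ?B i)) x * w x) = 0"
      proof (rule integral_eq_zero_AE)
        show "AE x in lebesgue. indicator (A - (\<Union>i\<in>C. ?B i)) x * w x = 0"
          using AE_not_in[OF N] by eventually_elim (simp only: indicator_simps not_False_eq_True mult_zero_left)
      qed
      then show ?thesis using e\<nu>[of "A - (\<Union>i\<in>C. ?B i)"] N by auto
    qed
    have "emeasure \<nu> A \<le> emeasure \<nu> ((A - (\<Union>i\<in>C. ?B i)) \<union> (\<Union>i\<in>C. ?B i))"
      by (rule emeasure_mono) (use As Us in \<open>auto simp: s\<nu>\<close>)
    also have "\<dots> \<le> emeasure \<nu> (A - (\<Union>i\<in>C. ?B i)) + emeasure \<nu> (\<Union>i\<in>C. ?B i)"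
      by (rule emeasure_subadditive) (use As Us in \<open>auto simp: s\<nu>\<close>)
    also have "\<dots> = emeasure \<nu> (\<Union>i\<in>C. ?B i)" by (simp add: N\<nu>)
    also have "\<dots> = (\<integral>\<^sup>+i. emeasure \<nu> (?B i) \<partial>count_space C)"
      by (rule emeasure_UN_countable[OF _ C(1) dis]) (auto simp: s\<nu>)
    also have "\<dots> \<le> (\<integral>\<^sup>+i. ennreal M * emeasure lebesgue (?B i) \<partial>count_space C)"
    proof (rule nn_integral_mono)
      fix i assume "i \<in> space (count_space C)"
      then have "i \<in> K" using C(2) by auto
      then show "emeasure \<nu> (?B i) \<le> ennreal M * emeasure lebesgue (?B i)"
        by (intro ball) (simp_all add: K_def A_def split_beta)
    qed
    also have "\<dots> = ennreal M * (\<integral>\<^sup>+i. emeasure lebesgue (?B i) \<partial>count_space C)"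
      by (rule nn_integral_cmult) simp
    also have "(\<integral>\<^sup>+i. emeasure lebesgue (?B i) \<partial>count_space C) = emeasure lebesgue (\<Union>i\<in>C. ?B i)"
      by (rule emeasure_UN_countable[OF _ C(1) dis, symmetric]) auto
    also have "ennreal M * emeasure lebesgue (\<Union>i\<in>C. ?B i) \<le> ennreal M * emeasure lebesgue U"
      by (intro mult_left_mono emeasure_mono UB) (use Um in auto)
    also have "emeasure lebesgue U = ennreal (measure lebesgue U)"
      by (rule emeasure_eq_measure2) (rule Um)
    also have "measure lebesgue U \<le> measure lebesgue A + e"
    proof -
      have UA: "U - A \<in> lmeasurable" using Um Am by (rule fmeasurable.Diff)
      have "measure lebesgue U = measure lebesgue (A \<union> (U - A))" using U(2) by (simp add: Un_absorb1)
      also have "\<dots> \<le> measure lebesgue A + measure lebesgue (U - A)" by (rule measure_Un_le) (use As UA in auto)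
      also have "measure lebesgue (U - A) \<le> measure lebesgue (U0 - A)"
        by (rule measure_mono_fmeasurable) (use UA U0 in \<open>auto simp: U_def\<close>)
      also have "measure lebesgue (U0 - A) \<le> e"
        using U0(3,4) e by (simp add: emeasure_eq_measure2 ennreal_less_iff)
      finally show ?thesis by simp
    qed
    finally show ?thesis using M by (simp add: ennreal_mult'[symmetric] mult_left_mono ennreal_leI)
  qed
  let ?I = "LINT x|lebesgue. indicator A x * w x"
  have iA: "integrable lebesgue (\<lambda>x. indicator A x * w x)"
    using integrable_real_mult_indicator[OF As wi] by (simp add: mult.commute)
  have iA2: "integrable lebesgue (\<lambda>x. indicator A x * M)"
  proof -
    have "emeasure lebesgue A < \<infinity>" using Am unfolding fmeasurable_def by blast
    then show ?thesis by (intro integrable_mult_left integrable_real_indicator As)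
  qed
  have "?I \<le> M * measure lebesgue A"
  proof (rule field_le_epsilon)
    fix e :: real assume e: "e > 0"
    \<comment> \<open>Dividing by M + 1 instead of M also covers M = 0.\<close>
    define e' where "e' = e / (M + 1)"
    have e': "e' > 0" "M * e' \<le> e" using e M by (auto simp: e'_def field_simps)
    have nn: "0 \<le> M * (measure lebesgue A + e')" using M e' by (intro mult_nonneg_nonneg) auto
    have "?I \<le> M * (measure lebesgue A + e')"
      using main[OF e'(1)] unfolding e\<nu>[OF As] by (simp add: ennreal_le_iff[OF nn])
    then show "?I \<le> M * measure lebesgue A + e" using e'(2) by (simp add: algebra_simps)
  qed
  moreover have "(LINT x|lebesgue. indicator A x * (w x - M)) = ?I - M * measure lebesgue A"
    using iA iA2 by (simp add: right_diff_distrib)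
  ultimately have "(LINT x|lebesgue. indicator A x * (w x - M)) \<le> 0" by simp
  moreover have "0 \<le> indicator A x * (w x - M)" for x by (auto simp: indicator_def A_def)
  moreover have iA3: "integrable lebesgue (\<lambda>x. indicator A x * (w x - M))"
    using Bochner_Integration.integrable_diff[OF iA iA2] by (simp add: right_diff_distrib)
  ultimately have "AE x in lebesgue. indicator A x * (w x - M) = 0"
    by (subst integral_nonneg_eq_0_iff_AE[symmetric]) (auto intro!: antisym integral_nonneg_AE)
  then have "AE x in lebesgue. x \<in> \<Omega> \<longrightarrow> v x \<le> M"
  proof eventually_elim
    fix x assume "indicator A x * (w x - M) = 0"
    then show "x \<in> \<Omega> \<longrightarrow> v x \<le> M" by (auto simp: A_def w_def indicator_def split: if_splits)
  qed
  then show ?thesis using \<Omega>s by (simp add: AE_restrict_space_iff)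
qed


section \<open>Regularised fundamental solutions in dimensions three and two\<close>

lemma has_real_derivative_inverse_sqrt:
  assumes "s > 0"
  shows "((\<lambda>s. 1 / sqrt s) has_real_derivative - 1 / (2 * s * sqrt s)) (at s)"
proof -
  have D: "((\<lambda>s. inverse (sqrt s)) has_real_derivative - (inverse (sqrt s) * (inverse (sqrt s) / 2) * inverse (sqrt s))) (at s)"
    by (rule DERIV_inverse'[OF DERIV_real_sqrt]) (use assms in auto)
  have E: "- (inverse (sqrt s) * (inverse (sqrt s) / 2) * inverse (sqrt s)) = - 1 / (2 * s * sqrt s)"
  proof -
    define r where "r = sqrt s"
    have "r > 0" "s = r * r" using assms by (auto simp: r_def)
    then show ?thesis unfolding r_def[symmetric] by (simp add: field_simps)
  qed
  from D[unfolded E] show ?thesis by (simp only: inverse_eq_divide)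
qed

lemma has_real_derivative_inverse_id:
  assumes "s > (0::real)"
  shows "((\<lambda>s. 1 / s) has_real_derivative - 1 / (s * s)) (at s)"
  using DERIV_inverse[of s UNIV] assms by (simp add: inverse_eq_divide power2_eq_square)

lemma continuous_on_inverse_powers:
  "continuous_on {0<..} (\<lambda>s::real. c / (s * s))"
  "continuous_on {0<..} (\<lambda>s::real. c / (2 * s * sqrt s))"
  "continuous_on {0<..} (\<lambda>s::real. c / (s * s * sqrt s))"
  by (auto intro!: continuous_intros)

text \<open>The potential is s^(-1/2), the Newton kernel with |x - x0|^2 shifted by \<epsilon>^2;
  its Laplacian is -3 \<epsilon>^2 s^(-5/2). Its square 1/s is integrable uniformly in
  \<epsilon>.\<close>

lemma newton_potential_mean_bound:
  fixes u :: "'a::euclidean_space \<Rightarrow> real" and x0 :: 'a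
  assumes d: "DIM('a) = 3" and w: "weak_sol \<Omega> f u" and f: "L2fun \<Omega> f"
    and \<Omega>: "\<Omega> \<in> sets lebesgue" "bounded \<Omega>" and \<epsilon>: "0 < \<epsilon>" and R: "R > 0" "\<Omega> \<subseteq> cball x0 (R / 2)"
  shows "(LINT x|lebesgue_on \<Omega>. indicator (ball x0 \<epsilon>) x * smooth_abs (u x))
      \<le> 2 * sqrt ((LINT x|lebesgue_on \<Omega>. (f x)\<^sup>2) * (64 / 9 * (R\<^sup>2 + 1) / R\<^sup>2 * (unit_ball_vol DIM('a) * R ^ DIM('a)))) * \<epsilon> ^ DIM('a)"
proof (rule ball_mean_bound[OF w f \<Omega> \<epsilon>, where ?P = "\<lambda>s. 1 / sqrt s"
      and ?P1.0 = "\<lambda>s. - 1 / (2 * s * sqrt s)" and ?P2.0 = "\<lambda>s. (3 / 4) / (s * s * sqrt s)"])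
  show "((\<lambda>s. 1 / sqrt s) has_real_derivative - 1 / (2 * s * sqrt s)) (at s)" if "s > 0" for s
    by (rule has_real_derivative_inverse_sqrt[OF that])
  show "((\<lambda>s. - 1 / (2 * s * sqrt s)) has_real_derivative (3 / 4) / (s * s * sqrt s)) (at s)" if "s > 0" for s
  proof -
    have "((\<lambda>s. (- 1 / 2) * (1 / s * (1 / sqrt s))) has_real_derivative
        (- 1 / 2) * (1 / s * (- 1 / (2 * s * sqrt s)) + - 1 / (s * s) * (1 / sqrt s))) (at s)"
      by (intro DERIV_cmult DERIV_mult' has_real_derivative_inverse_sqrt has_real_derivative_inverse_id that)
    moreover have "(- 1 / 2) * (1 / s * (- 1 / (2 * s * sqrt s)) + - 1 / (s * s) * (1 / sqrt s)) = (3 / 4) / (s * s * sqrt s)"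
      using that by (simp add: field_simps)
    moreover have "(\<lambda>s. (- 1 / 2) * (1 / s * (1 / sqrt s))) = (\<lambda>s. - 1 / (2 * s * sqrt s))"
      by (auto simp: fun_eq_iff)
    ultimately show ?thesis by (simp only:)
  qed
  show "continuous_on {0<..} (\<lambda>s::real. (3 / 4) / (s * s * sqrt s))" by (rule continuous_on_inverse_powers)
  have lap: "4 * ((3 / 4) / ((t + \<epsilon>\<^sup>2) * (t + \<epsilon>\<^sup>2) * sqrt (t + \<epsilon>\<^sup>2))) * t + real DIM('a) * (2 * (- 1 / (2 * (t + \<epsilon>\<^sup>2) * sqrt (t + \<epsilon>\<^sup>2))))
      = - (3 * \<epsilon>\<^sup>2) / ((t + \<epsilon>\<^sup>2) * (t + \<epsilon>\<^sup>2) * sqrt (t + \<epsilon>\<^sup>2))" if "0 \<le> t" for t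
  proof -
    define s where "s = t + \<epsilon>\<^sup>2"
    define r where "r = sqrt s"
    have s: "s > 0" using that \<epsilon> by (simp add: s_def add_nonneg_pos)
    then have r: "r > 0" by (simp add: r_def)
    have t: "t = s - \<epsilon>\<^sup>2" by (simp add: s_def)
    have "4 * ((3 / 4) / (s * s * r)) * t + 3 * (2 * (- 1 / (2 * s * r))) = - (3 * \<epsilon>\<^sup>2) / (s * s * r)"
      using s r unfolding t by (simp add: field_simps)
    then show ?thesis unfolding d s_def[symmetric] r_def[symmetric] by simp
  qed
  show "4 * ((3 / 4) / ((t + \<epsilon>\<^sup>2) * (t + \<epsilon>\<^sup>2) * sqrt (t + \<epsilon>\<^sup>2))) * t + real DIM('a) * (2 * (- 1 / (2 * (t + \<epsilon>\<^sup>2) * sqrt (t + \<epsilon>\<^sup>2)))) \<le> 0"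
    if "0 \<le> t" for t
  proof -
    have "0 \<le> (3 * \<epsilon>\<^sup>2) / ((t + \<epsilon>\<^sup>2) * (t + \<epsilon>\<^sup>2) * sqrt (t + \<epsilon>\<^sup>2))" using that by (intro divide_nonneg_nonneg mult_nonneg_nonneg) auto
    then show ?thesis unfolding lap[OF that] by simp
  qed
  show "4 * ((3 / 4) / ((t + \<epsilon>\<^sup>2) * (t + \<epsilon>\<^sup>2) * sqrt (t + \<epsilon>\<^sup>2))) * t + real DIM('a) * (2 * (- 1 / (2 * (t + \<epsilon>\<^sup>2) * sqrt (t + \<epsilon>\<^sup>2))))
      \<le> - 1 / (2 * \<epsilon> ^ DIM('a))" if "0 \<le> t" "t < \<epsilon>\<^sup>2" for t
  proof -
    define s where "s = t + \<epsilon>\<^sup>2"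
    have s: "s > 0" "s \<le> 2 * \<epsilon>\<^sup>2" using that \<epsilon> by (auto simp: s_def add_nonneg_pos)
    \<comment> \<open>On the \<epsilon>-ball s \<le> 2 \<epsilon>^2. The rational bound 3/2 for the
      square root of 2 makes 3 \<epsilon>^2 / s^(5/2) at least 1 / (2 \<epsilon>^3) exactly.\<close>
    have "(3 / 2 * \<epsilon>)\<^sup>2 = 9 / 4 * \<epsilon>\<^sup>2" by (simp add: power_mult_distrib power2_eq_square)
    then have "s \<le> (3 / 2 * \<epsilon>)\<^sup>2" using s(2) zero_le_power2[of \<epsilon>] by linarith
    then have "sqrt s \<le> 3 / 2 * \<epsilon>" using \<epsilon> by (intro real_le_lsqrt) auto
    then have "s * s * sqrt s \<le> (2 * \<epsilon>\<^sup>2) * (2 * \<epsilon>\<^sup>2) * (3 / 2 * \<epsilon>)"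
      using s by (intro mult_mono) auto
    moreover have "s * s * sqrt s > 0" using s by simp
    ultimately have "(3 * \<epsilon>\<^sup>2) / ((2 * \<epsilon>\<^sup>2) * (2 * \<epsilon>\<^sup>2) * (3 / 2 * \<epsilon>)) \<le> (3 * \<epsilon>\<^sup>2) / (s * s * sqrt s)"
      using \<epsilon> by (intro divide_left_mono) auto
    moreover have "(3 * \<epsilon>\<^sup>2) / ((2 * \<epsilon>\<^sup>2) * (2 * \<epsilon>\<^sup>2) * (3 / 2 * \<epsilon>)) = 1 / (2 * \<epsilon> ^ 3)"
      using \<epsilon> by (simp add: field_simps power2_eq_square power3_eq_cube)
    ultimately show ?thesis unfolding lap[OF that(1)] unfolding s_def[symmetric] d by simp
  qed
  show "0 \<le> 1 / sqrt ((norm (x - x0))\<^sup>2 + \<epsilon>\<^sup>2)" for x by simp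
  \<comment> \<open>Here Q(s) = 1/s, and 3/s - 2 t / s^2 \<ge> 1/s for t \<le> s uses the dimension
    three.\<close>
  have "(LINT x|lebesgue_on \<Omega>. 1 / ((norm (x - x0))\<^sup>2 + \<epsilon>\<^sup>2)) \<le> 64 / 9 * (R\<^sup>2 + 1) / R\<^sup>2 * (unit_ball_vol DIM('a) * R ^ DIM('a))"
  proof (rule integral_radial_bound[OF \<epsilon> R(1) has_real_derivative_inverse_id])
    show "continuous_on {0<..} (\<lambda>s::real. - 1 / (s * s))" by (rule continuous_on_inverse_powers)
    show "1 / s \<le> 2 * (- 1 / (s * s)) * t + real DIM('a) * (1 / s)" if "0 < s" "0 \<le> t" "t \<le> s" for s t :: real
      unfolding d using that by (simp add: field_simps)
    show "t * (1 / s) \<le> t + 1" if "0 < s" "0 \<le> t" "t \<le> s" for s t :: real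
    proof -
      have "t * (1 / s) \<le> 1" using that by simp
      then show ?thesis using that(2) by linarith
    qed
  qed (use R \<Omega> in auto)
  then show "(LINT x|lebesgue_on \<Omega>. (1 / sqrt ((norm (x - x0))\<^sup>2 + \<epsilon>\<^sup>2))\<^sup>2) \<le> 64 / 9 * (R\<^sup>2 + 1) / R\<^sup>2 * (unit_ball_vol DIM('a) * R ^ DIM('a))"
    by (simp add: power_divide)
qed

text \<open>The potential is minus the logarithm of the regularised distance, shifted by a constant
  so that it is nonnegative on \<Omega>; this uses s \<le> R^2 + 1 and hence \<epsilon> \<le> 1. Its
  Laplacian is -2 \<epsilon>^2 / s^2.\<close>

lemma log_potential_mean_bound:
  fixes u :: "'a::euclidean_space \<Rightarrow> real" and x0 :: 'a
  assumes d: "DIM('a) = 2" and w: "weak_sol \<Omega> f u" and f: "L2fun \<Omega> f"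
    and \<Omega>: "\<Omega> \<in> sets lebesgue" "bounded \<Omega>" and \<epsilon>: "0 < \<epsilon>" "\<epsilon> \<le> 1" and R: "R > 0" "\<Omega> \<subseteq> cball x0 (R / 2)"
  shows "(LINT x|lebesgue_on \<Omega>. indicator (ball x0 \<epsilon>) x * smooth_abs (u x))
      \<le> 2 * sqrt ((LINT x|lebesgue_on \<Omega>. (f x)\<^sup>2) * (4 * sqrt (R\<^sup>2 + 1) * (64 / 9 * (R\<^sup>2 + 1) / R\<^sup>2 * (unit_ball_vol DIM('a) * R ^ DIM('a))))) * \<epsilon> ^ DIM('a)"
proof (rule ball_mean_bound[OF w f \<Omega> \<epsilon>(1), where ?P = "\<lambda>s. (ln (R\<^sup>2 + 1) - ln s) / 2"
      and ?P1.0 = "\<lambda>s. - 1 / (2 * s)" and ?P2.0 = "\<lambda>s. (1 / 2) / (s * s)"])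
  show "((\<lambda>s. (ln (R\<^sup>2 + 1) - ln s) / 2) has_real_derivative - 1 / (2 * s)) (at s)" if "s > 0" for s
    using that by (auto intro!: derivative_eq_intros simp: field_simps)
  show "((\<lambda>s. - 1 / (2 * s)) has_real_derivative (1 / 2) / (s * s)) (at s)" if "s > 0" for s :: real
    using that by (auto intro!: derivative_eq_intros simp: field_simps)
  show "continuous_on {0<..} (\<lambda>s::real. (1 / 2) / (s * s))" by (rule continuous_on_inverse_powers)
  have lap: "4 * ((1 / 2) / ((t + \<epsilon>\<^sup>2) * (t + \<epsilon>\<^sup>2))) * t + real DIM('a) * (2 * (- 1 / (2 * (t + \<epsilon>\<^sup>2))))
      = - (2 * \<epsilon>\<^sup>2) / ((t + \<epsilon>\<^sup>2) * (t + \<epsilon>\<^sup>2))" if "0 \<le> t" for t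
  proof -
    define s where "s = t + \<epsilon>\<^sup>2"
    have s: "s > 0" using that \<epsilon> by (simp add: s_def add_nonneg_pos)
    have t: "t = s - \<epsilon>\<^sup>2" by (simp add: s_def)
    have "4 * ((1 / 2) / (s * s)) * t + 2 * (2 * (- 1 / (2 * s))) = - (2 * \<epsilon>\<^sup>2) / (s * s)"
      using s unfolding t by (simp add: field_simps)
    then show ?thesis unfolding d s_def[symmetric] by simp
  qed
  show "4 * ((1 / 2) / ((t + \<epsilon>\<^sup>2) * (t + \<epsilon>\<^sup>2))) * t + real DIM('a) * (2 * (- 1 / (2 * (t + \<epsilon>\<^sup>2)))) \<le> 0"
    if "0 \<le> t" for t
  proof -
    have "0 \<le> (2 * \<epsilon>\<^sup>2) / ((t + \<epsilon>\<^sup>2) * (t + \<epsilon>\<^sup>2))" using that by (intro divide_nonneg_nonneg mult_nonneg_nonneg) auto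
    then show ?thesis unfolding lap[OF that] by simp
  qed
  show "4 * ((1 / 2) / ((t + \<epsilon>\<^sup>2) * (t + \<epsilon>\<^sup>2))) * t + real DIM('a) * (2 * (- 1 / (2 * (t + \<epsilon>\<^sup>2)))) \<le> - 1 / (2 * \<epsilon> ^ DIM('a))"
    if "0 \<le> t" "t < \<epsilon>\<^sup>2" for t
  proof -
    define s where "s = t + \<epsilon>\<^sup>2"
    have s: "s > 0" "s \<le> 2 * \<epsilon>\<^sup>2" using that \<epsilon> by (auto simp: s_def add_nonneg_pos)
    then have "s * s \<le> (2 * \<epsilon>\<^sup>2) * (2 * \<epsilon>\<^sup>2)" by (intro mult_mono) auto
    then have "(2 * \<epsilon>\<^sup>2) / ((2 * \<epsilon>\<^sup>2) * (2 * \<epsilon>\<^sup>2)) \<le> (2 * \<epsilon>\<^sup>2) / (s * s)"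
      using \<epsilon> s by (intro divide_left_mono) auto
    moreover have "(2 * \<epsilon>\<^sup>2) / ((2 * \<epsilon>\<^sup>2) * (2 * \<epsilon>\<^sup>2)) = 1 / (2 * \<epsilon> ^ 2)"
      using \<epsilon> by (simp add: field_simps)
    ultimately show ?thesis unfolding lap[OF that(1)] unfolding s_def[symmetric] d by simp
  qed
  define q where "q x = (norm (x - x0))\<^sup>2 + \<epsilon>\<^sup>2" for x
  have q0: "q x > 0" for x using \<epsilon> by (simp add: q_def add_nonneg_pos)
  have qR: "q x \<le> R\<^sup>2 + 1" if "x \<in> \<Omega>" for x
  proof -
    have "norm (x - x0) \<le> R" using that R by (force simp: dist_norm norm_minus_commute)
    then have "(norm (x - x0))\<^sup>2 \<le> R\<^sup>2" by (intro power_mono) auto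
    moreover have "\<epsilon>\<^sup>2 \<le> 1" using \<epsilon> by (intro power_le_one) auto
    ultimately show ?thesis by (simp add: q_def)
  qed
  show "0 \<le> (ln (R\<^sup>2 + 1) - ln ((norm (x - x0))\<^sup>2 + \<epsilon>\<^sup>2)) / 2" if "x \<in> \<Omega>" for x
    using qR[OF that] q0[of x] unfolding q_def by simp
  have b: "((ln (R\<^sup>2 + 1) - ln (q x)) / 2)\<^sup>2 \<le> 4 * sqrt (R\<^sup>2 + 1) * (1 / sqrt (q x))" if "x \<in> \<Omega>" for x
  proof -
    \<comment> \<open>The logarithm is traded for a power: (ln y) / 2 = 2 ln (y^(1/4)) \<le> 2
      y^(1/4), whose square 4 sqrt y is a multiple of 1 / sqrt (q x) and falls under
      \<open>integral_radial_bound\<close>.\<close>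
    define y where "y = (R\<^sup>2 + 1) / q x"
    have y: "y \<ge> 1" using qR[OF that] q0[of x] by (simp add: y_def)
    have Rp: "R\<^sup>2 + 1 > 0" by (simp add: add_nonneg_pos)
    have "ln (R\<^sup>2 + 1) - ln (q x) = ln y" unfolding y_def by (subst ln_div) (use q0[of x] Rp in auto)
    moreover have "ln y / 2 = 2 * ln (sqrt (sqrt y))" using y by (simp add: ln_sqrt)
    moreover have "ln (sqrt (sqrt y)) \<le> sqrt (sqrt y)" using y by (intro order_trans[OF ln_le_minus_one]) auto
    ultimately have "(ln (R\<^sup>2 + 1) - ln (q x)) / 2 \<le> 2 * sqrt (sqrt y)" by simp
    moreover have "0 \<le> (ln (R\<^sup>2 + 1) - ln (q x)) / 2" using qR[OF that] q0[of x] by simp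
    ultimately have "((ln (R\<^sup>2 + 1) - ln (q x)) / 2)\<^sup>2 \<le> (2 * sqrt (sqrt y))\<^sup>2" by (intro power_mono)
    also have "\<dots> = 4 * sqrt y" using y by (simp add: power_mult_distrib)
    also have "\<dots> = 4 * sqrt (R\<^sup>2 + 1) * (1 / sqrt (q x))" unfolding y_def by (simp add: real_sqrt_divide)
    finally show ?thesis .
  qed
  have B: "(LINT x|lebesgue_on \<Omega>. 1 / sqrt (q x)) \<le> 64 / 9 * (R\<^sup>2 + 1) / R\<^sup>2 * (unit_ball_vol DIM('a) * R ^ DIM('a))"
    unfolding q_def
  proof (rule integral_radial_bound[OF \<epsilon>(1) R(1) has_real_derivative_inverse_sqrt])
    show "continuous_on {0<..} (\<lambda>s::real. - 1 / (2 * s * sqrt s))" by (rule continuous_on_inverse_powers)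
    show "1 / sqrt s \<le> 2 * (- 1 / (2 * s * sqrt s)) * t + real DIM('a) * (1 / sqrt s)" if "0 < s" "0 \<le> t" "t \<le> s" for s t :: real
    proof -
      have "t / s * (1 / sqrt s) \<le> 1 * (1 / sqrt s)" using that by (intro mult_right_mono) auto
      moreover have "2 * (- 1 / (2 * s * sqrt s)) * t = - (t / s * (1 / sqrt s))" using that by (simp add: field_simps)
      ultimately show ?thesis unfolding d by simp
    qed
    show "t * (1 / sqrt s) \<le> t + 1" if "0 < s" "0 \<le> t" "t \<le> s" for s t :: real
    proof -
      have "sqrt t * sqrt t \<le> sqrt t * sqrt s" using that by (intro mult_left_mono) auto
      then have "t / sqrt s \<le> sqrt t" using that by (simp add: divide_le_eq)
      also have "\<dots> \<le> t + 1" using that by (intro real_le_lsqrt) (auto simp: power2_eq_square algebra_simps)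
      finally show ?thesis by simp
    qed
  qed (use R \<Omega> in auto)
  have i: "integrable (lebesgue_on \<Omega>) (\<lambda>x. 4 * sqrt (R\<^sup>2 + 1) * (1 / sqrt (q x)))"
    unfolding q_def by (intro integrable_mult_right integrable_continuous_lebesgue_on \<Omega>
      continuous_on_radial[where P = "\<lambda>s. 1 / sqrt s"] \<epsilon>) (auto intro!: continuous_intros)
  have "(LINT x|lebesgue_on \<Omega>. ((ln (R\<^sup>2 + 1) - ln (q x)) / 2)\<^sup>2) \<le> (LINT x|lebesgue_on \<Omega>. 4 * sqrt (R\<^sup>2 + 1) * (1 / sqrt (q x)))"
    using b less_imp_le[OF q0] by (intro integral_mono'[OF i]) auto
  also have "\<dots> = 4 * sqrt (R\<^sup>2 + 1) * (LINT x|lebesgue_on \<Omega>. (1 / sqrt (q x)))" by (rule integral_mult_right_zero)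
  also have "\<dots> \<le> 4 * sqrt (R\<^sup>2 + 1) * (64 / 9 * (R\<^sup>2 + 1) / R\<^sup>2 * (unit_ball_vol DIM('a) * R ^ DIM('a)))"
    by (intro mult_left_mono B) auto
  finally show "(LINT x|lebesgue_on \<Omega>. ((ln (R\<^sup>2 + 1) - ln ((norm (x - x0))\<^sup>2 + \<epsilon>\<^sup>2)) / 2)\<^sup>2)
      \<le> 4 * sqrt (R\<^sup>2 + 1) * (64 / 9 * (R\<^sup>2 + 1) / R\<^sup>2 * (unit_ball_vol DIM('a) * R ^ DIM('a)))"
    unfolding q_def .
qed

lemma weak_sol_bounded:
  fixes u :: "'a::euclidean_space \<Rightarrow> real"
  assumes d: "DIM('a) = 2 \<or> DIM('a) = 3" and w: "weak_sol \<Omega> f u" and f: "L2fun \<Omega> f"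
    and \<Omega>: "open \<Omega>" "bounded \<Omega>"
  shows "\<exists>B. AE x in lebesgue_on \<Omega>. \<bar>u x\<bar> \<le> B"
proof -
  have \<Omega>s: "\<Omega> \<in> sets lebesgue" using \<Omega>(1) by simp
  \<comment> \<open>With this radius \<Omega> lies in the ball of radius R/2 around each of its
    points, so the mean bound is uniform in the centre; adding 2 keeps R positive.\<close>
  define R where "R = 2 * diameter \<Omega> + 2"
  have R: "R > 0" using diameter_ge_0[OF \<Omega>(2)] by (simp add: R_def)
  have RS: "\<Omega> \<subseteq> cball x0 (R / 2)" if "x0 \<in> \<Omega>" for x0
    using diameter_bounded_bound[OF \<Omega>(2) that] by (force simp: R_def)
  define k where "k = 64 / 9 * (R\<^sup>2 + 1) / R\<^sup>2 * (unit_ball_vol DIM('a) * R ^ DIM('a))"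
  define F where "F = (LINT x|lebesgue_on \<Omega>. (f x)\<^sup>2)"
  define M where "M = max (2 * sqrt (F * k)) (2 * sqrt (F * (4 * sqrt (R\<^sup>2 + 1) * k)))"
  have F0: "F \<ge> 0" by (simp add: F_def)
  have k0: "k \<ge> 0" using R by (simp add: k_def)
  have M0: "M \<ge> 0" unfolding M_def using F0 k0 by (intro max.coboundedI1) auto
  let ?v = "unit_ball_vol DIM('a)"
  have v: "?v > 0" by simp
  have mean: "(LINT x|lebesgue_on \<Omega>. indicator (ball x0 \<epsilon>) x * smooth_abs (u x)) \<le> M / ?v * measure lebesgue (ball x0 \<epsilon>)"
    if x0: "x0 \<in> \<Omega>" and \<epsilon>: "0 < \<epsilon>" "\<epsilon> \<le> 1" for x0 \<epsilon>
  proof -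
    have "(LINT x|lebesgue_on \<Omega>. indicator (ball x0 \<epsilon>) x * smooth_abs (u x)) \<le> M * \<epsilon> ^ DIM('a)"
      using d
    proof
      assume d: "DIM('a) = 2"
      have "(LINT x|lebesgue_on \<Omega>. indicator (ball x0 \<epsilon>) x * smooth_abs (u x)) \<le> 2 * sqrt (F * (4 * sqrt (R\<^sup>2 + 1) * k)) * \<epsilon> ^ DIM('a)"
        unfolding F_def k_def by (rule log_potential_mean_bound[OF d w f \<Omega>s \<Omega>(2) \<epsilon> R RS[OF x0]])
      also have "\<dots> \<le> M * \<epsilon> ^ DIM('a)" using \<epsilon> by (intro mult_right_mono) (auto simp: M_def)
      finally show ?thesis .
    next
      assume d: "DIM('a) = 3"
      have "(LINT x|lebesgue_on \<Omega>. indicator (ball x0 \<epsilon>) x * smooth_abs (u x)) \<le> 2 * sqrt (F * k) * \<epsilon> ^ DIM('a)"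
        unfolding F_def k_def by (rule newton_potential_mean_bound[OF d w f \<Omega>s \<Omega>(2) \<epsilon>(1) R RS[OF x0]])
      also have "\<dots> \<le> M * \<epsilon> ^ DIM('a)" using \<epsilon> by (intro mult_right_mono) (auto simp: M_def)
      finally show ?thesis .
    qed
    also have "\<dots> = M / ?v * measure lebesgue (ball x0 \<epsilon>)"
    proof -
      have "measure lebesgue (ball x0 \<epsilon>) = ?v * \<epsilon> ^ DIM('a)" using \<epsilon> by (simp add: content_ball)
      moreover have "M * e = M / c * (c * e)" if "c > 0" for c e :: real using that by simp
      ultimately show ?thesis using v by (simp only:)
    qed
    finally show ?thesis .
  qed
  \<comment> \<open>The weight b = 0 is enough here, since only the integrability statement is
    extracted.\<close>
  have "integrable (lebesgue_on \<Omega>) (\<lambda>x. smooth_abs (u x) * 1)"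
    by (rule Kato_inequality(2)[OF w f \<Omega>s \<Omega>(2), where b = "\<lambda>_. 0" and gb = "\<lambda>_. 0" and H = "\<lambda>_ _. 0"]) auto
  then have "AE x in lebesgue_on \<Omega>. smooth_abs (u x) \<le> M / ?v"
    by (intro AE_le_of_ball_mean_le[OF \<Omega>] mean) (use M0 v smooth_abs_nonneg in auto)
  then have "AE x in lebesgue_on \<Omega>. \<bar>u x\<bar> \<le> M / ?v + 1"
  proof eventually_elim
    fix x assume "smooth_abs (u x) \<le> M / ?v"
    then show "\<bar>u x\<bar> \<le> M / ?v + 1" using smooth_abs_ge[of "u x"] by linarith
  qed
  then show ?thesis by blast
qed


section \<open>Geometry of simplicial meshes\<close>

text \<open>Half of the guaranteed inradius lies strictly below the supremum, so some ball inside
  \<open>T\<close> is at least that large, whether or not the supremum is attained.\<close>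

lemma inradius_ball:
  fixes T :: "'a::euclidean_space set"
  assumes T: "bounded T" and h: "diameter T > 0" and s: "diameter T \<le> \<sigma> * inradius T" and \<sigma>: "\<sigma> \<ge> 1"
  obtains z where "ball z (diameter T / (2 * \<sigma>)) \<subseteq> T"
proof -
  let ?S = "{r. \<exists>x. ball x r \<subseteq> T}"
  have b: "r \<le> diameter T" if "r \<in> ?S" for r
  proof (cases "r > 0")
    case True
    obtain x where x: "ball x r \<subseteq> T" using \<open>r \<in> ?S\<close> by auto
    then have "diameter (ball x r) \<le> diameter T" by (rule diameter_subset[OF _ T])
    then show ?thesis using True by simp
  qed (use h in auto)
  have bdd: "bdd_above ?S" using b by (rule bdd_aboveI)
  have ne: "?S \<noteq> {}" by (auto intro: exI[of _ 0])
  have "inradius T > 0"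
  proof (rule ccontr)
    assume "\<not> ?thesis"
    then have "\<sigma> * inradius T \<le> 0" using \<sigma> by (simp add: mult_nonneg_nonpos)
    then show False using s h by simp
  qed
  moreover have "diameter T / (2 * \<sigma>) \<le> inradius T / 2" using s \<sigma> by (simp add: field_simps)
  ultimately have "diameter T / (2 * \<sigma>) < Sup ?S" unfolding inradius_def by linarith
  then obtain r where r: "r \<in> ?S" "diameter T / (2 * \<sigma>) < r" using less_cSupE[OF _ ne] by blast
  then obtain x where "ball x r \<subseteq> T" by auto
  then have "ball x (diameter T / (2 * \<sigma>)) \<subseteq> T" using r(2) subset_ball[of "diameter T / (2 * \<sigma>)" r x] by auto
  then show ?thesis by (rule that)
qed

text \<open>\<open>T\<close> is the cone over the facet with apex the opposite vertex
  \<open>a\<close>. The ray from \<open>a\<close> through the ball centre \<open>z\<close> meets the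
  facet at \<open>x0\<close>. The homothety with centre \<open>a\<close> and ratio t \<le> 1 taking
  \<open>x0\<close> to \<open>z\<close> maps the disc of radius \<open>r\<close> around
  \<open>x0\<close> into the ball; a point of \<open>T\<close> at that height is the homothetic
  image of a point of the facet.\<close>

lemma simplex_facet_contains_disc:
  fixes T :: "'a::euclidean_space set"
  assumes T: "(int DIM('a)) simplex T" and e: "e facet_of T" and z: "ball z r \<subseteq> T" and r: "r > 0"
    and n: "norm n = 1" "\<And>x y. x \<in> e \<Longrightarrow> y \<in> e \<Longrightarrow> n \<bullet> (x - y) = 0"
  obtains x0 where "x0 \<in> e" "\<And>x. n \<bullet> (x - x0) = 0 \<Longrightarrow> norm (x - x0) < r \<Longrightarrow> x \<in> e"
proof -
  obtain C where C: "finite C" "\<not> affine_dependent C" "T = convex hull C" using T by (auto simp: simplex)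
  obtain a where a: "a \<in> C" "e = convex hull (C - {a})" and ne: "e \<noteq> {}"
  proof -
    have "e facet_of convex hull C" using e C(3) by simp
    then show ?thesis using iffD1[OF facet_of_convex_hull_affine_independent[OF C(2)]] that by blast
  qed
  then have ne': "C - {a} \<noteq> {}" by auto
  have Ti: "T = convex hull (insert a (C - {a}))" unfolding C(3) using a(1) by (simp add: insert_absorb)
  obtain s0 where s0: "s0 \<in> e" using ne by auto
  define m where "m = n \<bullet> (s0 - a)"
  have em: "n \<bullet> (s - a) = m" if "s \<in> e" for s
    using n(2)[OF that s0] by (simp add: m_def inner_diff_right)
  have rep: "\<exists>t s. 0 \<le> t \<and> s \<in> e \<and> w - a = t *\<^sub>R (s - a) \<and> n \<bullet> (w - a) = t * m" if w: "w \<in> T" for w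
  proof -
    obtain u v s where uv: "0 \<le> u" "0 \<le> v" "u + v = 1" "s \<in> convex hull (C - {a})" "w = u *\<^sub>R a + v *\<^sub>R s"
      using w unfolding Ti convex_hull_insert[OF ne'] by auto
    have u: "u = 1 - v" using uv(3) by simp
    have "w - a = v *\<^sub>R (s - a)" unfolding uv(5) u by (simp add: algebra_simps)
    then show ?thesis using uv a(2) em[of s] by (intro exI[of _ v] exI[of _ s]) simp
  qed
  \<comment> \<open>Heights over the facet are multiples of \<open>m\<close>. Points on both sides
    of \<open>z\<close> along the normal have different heights, which rules out m = 0 as well as t
    = 0.\<close>
  have zin: "z \<in> T" "z + (r / 2) *\<^sub>R n \<in> T" "z - (r / 2) *\<^sub>R n \<in> T"
    using z r n(1) by (auto simp: subset_iff dist_norm)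
  obtain t s where ts: "0 \<le> t" "s \<in> e" "z - a = t *\<^sub>R (s - a)" "n \<bullet> (z - a) = t * m" using rep[OF zin(1)] by blast
  obtain t1 where t1: "0 \<le> t1" "n \<bullet> (z + (r / 2) *\<^sub>R n - a) = t1 * m" using rep[OF zin(2)] by blast
  obtain t2 where t2: "0 \<le> t2" "n \<bullet> (z - (r / 2) *\<^sub>R n - a) = t2 * m" using rep[OF zin(3)] by blast
  have nn: "n \<bullet> n = 1" using n(1) by (simp add: norm_eq_1)
  have e1: "t1 * m = t * m + r / 2" using t1(2) ts(4) nn by (simp add: inner_diff_right inner_add_right)
  have e2: "t2 * m = t * m - r / 2" using t2(2) ts(4) nn by (simp add: inner_diff_right)
  have m0: "m \<noteq> 0" using e1 e2 r by auto
  have "t \<noteq> 0"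
  proof
    assume "t = 0"
    then have "t1 * m = - (t2 * m)" using e1 e2 by simp
    then have "(t1 + t2) * m = 0" by (simp add: algebra_simps)
    then have "t1 = 0" using m0 t1(1) t2(1) by simp
    then show False using e1 \<open>t = 0\<close> r by simp
  qed
  then have tp: "t > 0" using ts(1) by simp
  have t1': "t \<le> 1"
  proof -
    obtain u v s where uv: "0 \<le> u" "0 \<le> v" "u + v = 1" "s \<in> convex hull (C - {a})" "z = u *\<^sub>R a + v *\<^sub>R s"
      using zin(1) unfolding Ti convex_hull_insert[OF ne'] by auto
    have u: "u = 1 - v" using uv(3) by simp
    have "z - a = v *\<^sub>R (s - a)" unfolding uv(5) u by (simp add: algebra_simps)
    then have "n \<bullet> (z - a) = v * m" using em[of s] uv(4) a(2) by simp
    then show ?thesis using ts(4) m0 uv by simp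
  qed
  show ?thesis
  proof (rule that[OF ts(2)])
    fix x assume x: "n \<bullet> (x - s) = 0" "norm (x - s) < r"
    define w where "w = z + t *\<^sub>R (x - s)"
    have "norm (w - z) < r"
    proof -
      have "norm (w - z) = t * norm (x - s)" using tp by (simp add: w_def)
      also have "\<dots> \<le> 1 * norm (x - s)" using t1' by (intro mult_right_mono) auto
      finally show ?thesis using x(2) by simp
    qed
    then have "w \<in> T" using z by (auto simp: subset_iff dist_norm norm_minus_commute)
    then obtain t' s' where t': "s' \<in> e" "w - a = t' *\<^sub>R (s' - a)" "n \<bullet> (w - a) = t' * m" using rep by blast
    have wa: "w - a = t *\<^sub>R (x - a)" using ts(3) by (simp add: w_def algebra_simps)
    have "n \<bullet> (x - a) = m" using x(1) em[OF ts(2)] by (simp add: inner_diff_right)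
    then have "t' * m = t * m" using t'(3) unfolding wa by auto
    then have "t' = t" using m0 by simp
    then have "x - a = s' - a" using t'(2) wa tp by simp
    then show "x \<in> e" using t'(1) by simp
  qed
qed

text \<open>A point \<open>x\<close> of the half ball lies on a segment from \<open>w\<close>, at
  height at least \<open>s\<close>, to a point \<open>y\<close> of the hyperplane. For small
  \<kappa> the weight t of \<open>w\<close> is at most \<kappa> / s \<le> 1/2, and \<open>y\<close>
  stays in the disc.\<close>

lemma half_ball_in_convex:
  fixes T :: "'a::euclidean_space set"
  assumes T: "convex T" and n: "norm n = 1" and s: "s > 0" "s \<le> n \<bullet> (w - x0)" and w: "w \<in> T" "norm (w - x0) \<le> D"
    and disc: "\<And>x. n \<bullet> (x - x0) = 0 \<Longrightarrow> norm (x - x0) < \<rho> \<Longrightarrow> x \<in> T"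
    and \<kappa>: "0 < \<kappa>" "\<kappa> \<le> s / 2" "2 * \<kappa> * (1 + D / s) < \<rho>"
    and x: "0 \<le> n \<bullet> (x - x0)" "norm (x - x0) \<le> \<kappa>"
  shows "x \<in> T"
proof -
  define S where "S = n \<bullet> (w - x0)"
  have S: "S > 0" "s \<le> S" using s by (auto simp: S_def)
  define t where "t = n \<bullet> (x - x0) / S"
  have nx: "n \<bullet> (x - x0) \<le> \<kappa>" using Cauchy_Schwarz_ineq2[of n "x - x0"] n x(2) by simp
  have t0: "0 \<le> t" using x(1) S by (simp add: t_def)
  have ts: "t \<le> \<kappa> / s"
  proof -
    have "t \<le> \<kappa> / S" unfolding t_def using nx S by (intro divide_right_mono) auto
    also have "\<dots> \<le> \<kappa> / s" using S s \<kappa> by (intro divide_left_mono) auto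
    finally show ?thesis .
  qed
  have "\<kappa> / s \<le> 1 / 2" using \<kappa>(2) s(1) by (simp add: field_simps)
  then have t1: "t \<le> 1 / 2" using ts by linarith
  \<comment> \<open>The solution of x = (1 - t) y + t w; the choice of t makes its height
    zero.\<close>
  define y where "y = x0 + (1 / (1 - t)) *\<^sub>R ((x - x0) - t *\<^sub>R (w - x0))"
  have "n \<bullet> (y - x0) = (1 / (1 - t)) * (n \<bullet> (x - x0) - t * S)"
    by (simp add: y_def S_def inner_diff_right)
  also have "\<dots> = 0" using S by (simp add: t_def)
  finally have y0: "n \<bullet> (y - x0) = 0" .
  have D0: "0 \<le> D" using w(2) norm_ge_zero order_trans by blast
  have "norm (y - x0) = 1 / (1 - t) * norm ((x - x0) - t *\<^sub>R (w - x0))" using t1 by (simp add: y_def)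
  also have "\<dots> \<le> 2 * norm ((x - x0) - t *\<^sub>R (w - x0))" using t1 by (intro mult_right_mono) (auto simp: field_simps)
  also have "norm ((x - x0) - t *\<^sub>R (w - x0)) \<le> norm (x - x0) + norm (t *\<^sub>R (w - x0))" by (rule norm_triangle_ineq4)
  also have "\<dots> \<le> \<kappa> + \<kappa> / s * D"
  proof -
    have "t * norm (w - x0) \<le> \<kappa> / s * D" using t0 ts w(2) \<kappa>(1) s(1) by (intro mult_mono) auto
    then show ?thesis using x(2) t0 by simp
  qed
  finally have "norm (y - x0) \<le> 2 * (\<kappa> + \<kappa> / s * D)" by simp
  also have "\<dots> = 2 * \<kappa> * (1 + D / s)" by (simp add: algebra_simps)
  finally have "norm (y - x0) < \<rho>" using \<kappa>(3) by simp
  then have yT: "y \<in> T" by (rule disc[OF y0])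
  have "(1 - t) *\<^sub>R (y - x0) = (x - x0) - t *\<^sub>R (w - x0)" using t1 by (simp add: y_def)
  then have "x = (1 - t) *\<^sub>R y + t *\<^sub>R w" by (simp add: algebra_simps)
  then show ?thesis using convexD_alt[OF T yT w(1), of t] t0 t1 by simp
qed

section \<open>Normals, measure and number of sides\<close>

lemma side_normal:
  fixes e :: "'a::euclidean_space set"
  assumes "aff_dim e = int DIM('a) - 1"
  shows "norm (side_normal e) = 1" "\<And>x y. x \<in> e \<Longrightarrow> y \<in> e \<Longrightarrow> side_normal e \<bullet> (x - y) = 0"
proof -
  obtain a b where a: "a \<noteq> 0" "e \<subseteq> {x. a \<bullet> x = b}" using aff_lowdim_subset_hyperplane[of e] assms by auto
  have "norm ((1 / norm a) *\<^sub>R a) = 1 \<and> (\<forall>x\<in>e. \<forall>y\<in>e. ((1 / norm a) *\<^sub>R a) \<bullet> (x - y) = 0)"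
    using a by (auto simp: inner_diff_right subset_iff)
  then have "norm (side_normal e) = 1 \<and> (\<forall>x\<in>e. \<forall>y\<in>e. side_normal e \<bullet> (x - y) = 0)"
    unfolding side_normal_def by (rule someI)
  then show "norm (side_normal e) = 1" "\<And>x y. x \<in> e \<Longrightarrow> y \<in> e \<Longrightarrow> side_normal e \<bullet> (x - y) = 0" by auto
qed

text \<open>The prism over \<open>e\<close> has height 1 but width of order \<open>h\<close>, so
  about 1/h balls of radius 2h, stacked along the normal, cover it. Together they have volume of
  order h^(d-1); \<open>D\<close> only absorbs the rounding of 1/h.\<close>

lemma side_measure_le:
  fixes e :: "'a::euclidean_space set"
  assumes e: "aff_dim e = int DIM('a) - 1" "e \<subseteq> cball x0 h" and h: "0 < h" "h \<le> D"
  shows "side_measure e \<le> (1 + 2 * D) * (unit_ball_vol DIM('a) * 2 ^ DIM('a)) * h ^ DIM('a) / h"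
proof -
  let ?n = "side_normal e"
  let ?P = "{x + t *\<^sub>R ?n | x t. x \<in> e \<and> t \<in> {0..1}}"
  have n: "norm ?n = 1" by (rule side_normal[OF e(1)])
  define K where "K = nat \<lceil>1 / h\<rceil>"
  have K: "1 / h \<le> real K" "real K \<le> 1 / h + 1" using h by (auto simp: K_def)
  let ?U = "\<Union>k\<in>{..K}. cball (x0 + (real k * h) *\<^sub>R ?n) (2 * h)"
  have sub: "?P \<subseteq> ?U"
  proof
    fix p assume "p \<in> ?P"
    then obtain x t where xt: "p = x + t *\<^sub>R ?n" "x \<in> e" "0 \<le> t" "t \<le> 1" by auto
    define k where "k = nat \<lfloor>t / h\<rfloor>"
    have k: "real k \<le> t / h" "t / h \<le> real k + 1" using xt(3) h by (auto simp: k_def) 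
    have "t / h \<le> 1 / h" using xt(4) h by (intro divide_right_mono) auto
    then have "real k \<le> real K" using k(1) K(1) by linarith
    then have kK: "k \<in> {..K}" by simp
    have kt: "real k * h \<le> t" "t \<le> real k * h + h" using k h by (auto simp: field_simps)
    have "norm (p - (x0 + (real k * h) *\<^sub>R ?n)) = norm ((x - x0) + (t - real k * h) *\<^sub>R ?n)"
      by (simp add: xt(1) algebra_simps)
    also have "\<dots> \<le> norm (x - x0) + \<bar>t - real k * h\<bar>" using norm_triangle_ineq[of "x - x0" "(t - real k * h) *\<^sub>R ?n"] n by simp
    also have "\<dots> \<le> 2 * h" using e(2) xt(2) kt by (force simp: dist_norm norm_minus_commute)
    finally have "p \<in> cball (x0 + (real k * h) *\<^sub>R ?n) (2 * h)" by (simp add: dist_norm norm_minus_commute)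
    then show "p \<in> ?U" using kK by blast
  qed
  have Um: "?U \<in> lmeasurable" by (intro lmeasurable_compact compact_UN) auto
  have "side_measure e \<le> measure lebesgue ?U"
  \<comment> \<open>If the prism were not measurable, its \<open>measure\<close> would be 0 by
    convention and the bound would still hold.\<close>
  proof (cases "?P \<in> sets lebesgue")
    case True
    show ?thesis unfolding side_measure_def by (rule measure_mono_fmeasurable[OF sub True Um])
  next
    case False
    then show ?thesis unfolding side_measure_def measure_notin_sets[OF False] by simp
  qed
  also have "\<dots> \<le> (\<Sum>k\<in>{..K}. measure lebesgue (cball (x0 + (real k * h) *\<^sub>R ?n) (2 * h)))"
    by (rule measure_UNION_le) auto
  also have "\<dots> = (real K + 1) * (unit_ball_vol DIM('a) * (2 * h) ^ DIM('a))"
    using h by (simp add: content_cball algebra_simps)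
  also have "\<dots> \<le> ((1 + 2 * D) / h) * (unit_ball_vol DIM('a) * (2 * h) ^ DIM('a))"
  proof (intro mult_right_mono)
    have "real K + 1 \<le> 1 / h + 2" using K(2) by simp
    also have "\<dots> = (1 + 2 * h) / h" using h by (simp add: field_simps)
    also have "\<dots> \<le> (1 + 2 * D) / h" using h by (intro divide_right_mono) auto
    finally show "real K + 1 \<le> (1 + 2 * D) / h" .
  qed (use h in auto)
  also have "\<dots> = (1 + 2 * D) * (unit_ball_vol DIM('a) * 2 ^ DIM('a)) * h ^ DIM('a) / h"
    by (simp add: power_mult_distrib)
  finally show ?thesis .
qed

lemma card_sides_le:
  fixes T :: "'a::euclidean_space set"
  assumes tr: "triangulation \<Omega> \<T>" and T: "T \<in> \<T>"
  shows "finite (sides \<T> T)" "card (sides \<T> T) \<le> DIM('a) + 1"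
    and sides_facet: "\<And>e. e \<in> sides \<T> T \<Longrightarrow> e facet_of T"
proof -
  have Ts: "(int DIM('a)) simplex T" using tr T by (auto simp: triangulation_def)
  obtain C where C: "finite C" "\<not> affine_dependent C" "T = convex hull C" "int (card C) = int DIM('a) + 1"
    using Ts by (auto simp: simplex)
  show f: "e facet_of T" if "e \<in> sides \<T> T" for e
  proof -
    obtain T' where T': "T' \<in> \<T>" "e = T \<inter> T'" "aff_dim e = int DIM('a) - 1" using \<open>e \<in> sides \<T> T\<close> by (auto simp: sides_def)
    have "e face_of T" using tr T T' by (auto simp: triangulation_def)
    moreover have "e \<noteq> {}" using T'(3) by auto
    ultimately show ?thesis using T'(3) aff_dim_simplex[OF Ts] by (simp add: facet_of_def)
  qed
  have sub: "sides \<T> T \<subseteq> (\<lambda>u. convex hull (C - {u})) ` C"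
  proof
    fix e assume "e \<in> sides \<T> T"
    then show "e \<in> (\<lambda>u. convex hull (C - {u})) ` C"
      using f[of e] facet_of_convex_hull_affine_independent[OF C(2), of e] unfolding C(3) by auto
  qed
  show "finite (sides \<T> T)" using sub C(1) by (rule finite_subset[OF _ finite_imageI])
  have "card (sides \<T> T) \<le> card ((\<lambda>u. convex hull (C - {u})) ` C)" using sub C(1) by (intro card_mono) auto
  also have "\<dots> \<le> card C" by (rule card_image_le[OF C(1)])
  finally show "card (sides \<T> T) \<le> DIM('a) + 1" using C(4) by simp
qed

lemma diameter_simplex_pos:
  fixes T :: "'a::euclidean_space set"
  assumes T: "(int DIM('a)) simplex T"
  shows "diameter T > 0"
proof -
  have b: "bounded T" using compact_simplex[OF T] by (rule compact_imp_bounded)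
  have "T \<noteq> {}" using T by auto
  then obtain x where x: "x \<in> T" by auto
  have "T \<noteq> {x}" using T by auto
  then obtain y where "y \<in> T" "x \<noteq> y" using x by blast
  then have xy: "x \<in> T" "y \<in> T" "x \<noteq> y" using x by auto
  then have "0 < dist x y" by simp
  also have "\<dots> \<le> diameter T" by (rule diameter_bounded_bound[OF b xy(1,2)])
  finally show ?thesis .
qed

text \<open>The bound \<sigma> \<ge> 1 makes powers of \<sigma> monotone in the exponent, so
  geometric constants can be merged into single powers.\<close>

locale regular_mesh =
  fixes \<Omega> :: "'a::euclidean_space set" and \<T> :: "'a set set" and \<sigma> :: real
  assumes dim: "DIM('a) \<ge> 2" and \<Omega>: "open \<Omega>" "bounded \<Omega>" "convex \<Omega>" and tr: "triangulation \<Omega> \<T>"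
    and \<sigma>: "\<sigma> \<ge> 1" and reg: "\<And>T. T \<in> \<T> \<Longrightarrow> diameter T \<le> \<sigma> * inradius T"
begin

lemma elem:
  assumes "T \<in> \<T>"
  shows "(int DIM('a)) simplex T" "bounded T" "diameter T > 0" "T \<subseteq> closure \<Omega>" "convex T" "compact T"
    "T \<in> sets lebesgue"
proof -
  show s: "(int DIM('a)) simplex T" using tr assms by (auto simp: triangulation_def)
  show c: "compact T" by (rule compact_simplex[OF s])
  show "bounded T" by (rule compact_imp_bounded[OF c])
  show "diameter T > 0" by (rule diameter_simplex_pos[OF s])
  show "T \<subseteq> closure \<Omega>" using tr assms by (auto simp: triangulation_def)
  show "convex T" by (rule convex_simplex[OF s])
  show "T \<in> sets lebesgue" using lmeasurable_compact[OF c] by (rule fmeasurableD)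
qed

text \<open>An open convex set is the interior of its closure. Elements lie only in the closure of
  \<Omega>; this puts open balls inside them into \<Omega>.\<close>

lemma open_subset_domain: "open U \<Longrightarrow> U \<subseteq> closure \<Omega> \<Longrightarrow> U \<subseteq> \<Omega>"
  using interior_maximal[of U "closure \<Omega>"] convex_interior_closure[OF \<Omega>(3)] interior_open[OF \<Omega>(1)] by simp

lemma inball:
  assumes "T \<in> \<T>"
  obtains z where "ball z (diameter T / (2 * \<sigma>)) \<subseteq> T"
  using inradius_ball[OF elem(2,3)[OF assms] reg[OF assms] \<sigma>] by blast

text \<open>The side contains a disc of radius diam T / (2 \<sigma>), hence two points at half that
  distance, and both belong to \<open>T'\<close>. Dimension at least 2 supplies a direction within
  the side.\<close>

lemma diameter_le_of_common_side:
  assumes T: "T \<in> \<T>" and T': "T' \<in> \<T>" and e: "e \<in> sides \<T> T" "e \<subseteq> T'"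
  shows "diameter T \<le> 4 * \<sigma> * diameter T'"
proof -
  have ef: "e facet_of T" by (rule sides_facet[OF tr T e(1)])
  have ad: "aff_dim e = int DIM('a) - 1" using e(1) by (auto simp: sides_def)
  define r where "r = diameter T / (2 * \<sigma>)"
  have r: "r > 0" using elem(3)[OF T] \<sigma> by (simp add: r_def)
  obtain z where z: "ball z r \<subseteq> T" using inball[OF T] unfolding r_def by blast
  obtain x0 where x0: "x0 \<in> e" "\<And>x. side_normal e \<bullet> (x - x0) = 0 \<Longrightarrow> norm (x - x0) < r \<Longrightarrow> x \<in> e"
    using simplex_facet_contains_disc[OF elem(1)[OF T] ef z r side_normal[OF ad]] by blast
  obtain v where v: "v \<noteq> 0" "side_normal e \<bullet> v = 0"
    by (rule orthogonal_to_vector_exists[OF dim, of "side_normal e"]) (use that in \<open>simp add: orthogonal_def\<close>)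
  define x where "x = x0 + (r / 2 / norm v) *\<^sub>R v"
  have nx: "norm (x - x0) = r / 2" using v r by (simp add: x_def)
  have "x \<in> e" by (rule x0(2)) (use v nx r in \<open>auto simp: x_def\<close>)
  then have "x \<in> T'" "x0 \<in> T'" using e(2) x0(1) by auto
  then have "dist x x0 \<le> diameter T'" by (rule diameter_bounded_bound[OF elem(2)[OF T']])
  then show ?thesis using nx \<sigma> by (simp add: dist_norm r_def field_simps)
qed

end


section \<open>Local residual estimates\<close>

lemma integrable_lebesgue_on_subset:
  fixes f :: "'a::euclidean_space \<Rightarrow> real"
  assumes f: "integrable (lebesgue_on S) f" and B: "B \<subseteq> S" "B \<in> sets lebesgue" "S \<in> sets lebesgue"
  shows "integrable (lebesgue_on B) f"
proof -
  have "integrable lebesgue (\<lambda>x. indicator S x *\<^sub>R f x)"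
    using f B(3) by (subst (asm) integrable_restrict_space) auto
  from integrable_mult_indicator[OF B(2) this]
  have "integrable lebesgue (\<lambda>x. indicator B x *\<^sub>R (indicator S x *\<^sub>R f x))" .
  moreover have "(\<lambda>x. indicator B x *\<^sub>R (indicator S x *\<^sub>R f x)) = (\<lambda>x. indicator B x *\<^sub>R f x)"
    by (intro ext) (use B(1) in \<open>auto simp: indicator_def\<close>)
  ultimately have "integrable lebesgue (\<lambda>x. indicator B x *\<^sub>R f x)" by (simp only:)
  then show ?thesis using iffD2[OF integrable_restrict_space, of B lebesgue f] B(2) by simp
qed

lemma integral_lebesgue_on_support:
  fixes F :: "'a::euclidean_space \<Rightarrow> real"
  assumes "B \<subseteq> S" "B \<in> sets lebesgue" "S \<in> sets lebesgue" "\<And>x. x \<notin> B \<Longrightarrow> F x = 0"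
  shows "(LINT x|lebesgue_on S. F x) = (LINT x|lebesgue_on B. F x)"
proof -
  have eq: "(\<lambda>x. indicator S x *\<^sub>R F x) = (\<lambda>x. indicator B x *\<^sub>R F x)"
    by (intro ext) (use assms(1,4) in \<open>auto simp: indicator_def\<close>)
  have "(LINT x|lebesgue_on S. F x) = (LINT x|lebesgue. indicator S x *\<^sub>R F x)"
    by (rule integral_restrict_space) (use assms(3) in simp)
  also have "\<dots> = (LINT x|lebesgue. indicator B x *\<^sub>R F x)" by (simp only: eq)
  also have "\<dots> = (LINT x|lebesgue_on B. F x)"
    by (rule integral_restrict_space[symmetric]) (use assms(2) in simp)
  finally show ?thesis .
qed

lemma integral_lebesgue_on_support_UNIV:
  fixes F :: "'a::euclidean_space \<Rightarrow> real"
  assumes "B \<in> sets lebesgue" "\<And>x. x \<notin> B \<Longrightarrow> F x = 0"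
  shows "(LINT x|lebesgue_on B. F x) = (LINT x|lebesgue. F x)"
  using integral_lebesgue_on_support[of B UNIV F] assms by (simp add: lebesgue_on_UNIV_eq)

lemma integral_lebesgue_on_mono_set:
  fixes F :: "'a::euclidean_space \<Rightarrow> real"
  assumes "B \<subseteq> S" "B \<in> sets lebesgue" "S \<in> sets lebesgue" "integrable (lebesgue_on S) F" "\<And>x. x \<in> S \<Longrightarrow> 0 \<le> F x"
  shows "(LINT x|lebesgue_on B. F x) \<le> (LINT x|lebesgue_on S. F x)"
proof -
  have "(LINT x|lebesgue_on B. F x) = (LINT x|lebesgue. indicator B x *\<^sub>R F x)"
    "(LINT x|lebesgue_on S. F x) = (LINT x|lebesgue. indicator S x *\<^sub>R F x)"
    by (rule integral_restrict_space, use assms in simp)+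
  moreover have "(LINT x|lebesgue. indicator B x *\<^sub>R F x) \<le> (LINT x|lebesgue. indicator S x *\<^sub>R F x)"
  proof (rule integral_mono)
    show "integrable lebesgue (\<lambda>x. indicator B x *\<^sub>R F x)" "integrable lebesgue (\<lambda>x. indicator S x *\<^sub>R F x)"
      using integrable_lebesgue_on_subset[OF assms(4,1,2,3)] assms(2,3,4) by (simp_all add: integrable_restrict_space)
  qed (use assms(1,5) in \<open>auto simp: indicator_def\<close>)
  ultimately show ?thesis by simp
qed

lemma L2fun_integrable:
  assumes "L2fun \<Omega> f" "bounded \<Omega>" "\<Omega> \<in> sets lebesgue"
  shows "integrable (lebesgue_on \<Omega>) f"
proof -
  interpret finite_measure "lebesgue_on \<Omega>"
    by (rule finite_measure_lebesgue_on) (use assms in \<open>simp add: bounded_set_imp_lmeasurable\<close>)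
  have "integrable (lebesgue_on \<Omega>) (\<lambda>x. f x * 1)"
    by (rule Cauchy_Schwarz_integral) (use assms in \<open>auto simp: L2fun_def\<close>)
  then show ?thesis by simp
qed

lemma integral_bounded_mult:
  fixes F b :: "'a::euclidean_space \<Rightarrow> real"
  assumes F: "integrable (lebesgue_on B) F" and b: "continuous_on UNIV b" "\<And>x. \<bar>b x\<bar> \<le> c"
  shows "integrable (lebesgue_on B) (\<lambda>x. F x * b x)"
    and "\<bar>LINT x|lebesgue_on B. F x * b x\<bar> \<le> c * (LINT x|lebesgue_on B. \<bar>F x\<bar>)"
proof -
  have le: "\<bar>F x * b x\<bar> \<le> c * \<bar>F x\<bar>" for x
    using mult_right_mono[OF b(2)[of x], of "\<bar>F x\<bar>"] by (simp add: abs_mult mult.commute)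
  have c0: "0 \<le> c" using b(2)[of 0] by simp
  show i: "integrable (lebesgue_on B) (\<lambda>x. F x * b x)"
  proof (rule Bochner_Integration.integrable_bound)
    show "integrable (lebesgue_on B) (\<lambda>x. c * \<bar>F x\<bar>)" using F by simp
    show "(\<lambda>x. F x * b x) \<in> borel_measurable (lebesgue_on B)"
      using F continuous_measurable_lebesgue_on[OF b(1)] by (intro borel_measurable_times) auto
    show "AE x in lebesgue_on B. norm (F x * b x) \<le> norm (c * \<bar>F x\<bar>)"
      using le c0 by (intro AE_I2) simp
  qed
  have "\<bar>LINT x|lebesgue_on B. F x * b x\<bar> \<le> (LINT x|lebesgue_on B. \<bar>F x * b x\<bar>)"
    using integral_norm_bound[of "lebesgue_on B" "\<lambda>x. F x * b x"] by simp
  also have "\<dots> \<le> (LINT x|lebesgue_on B. c * \<bar>F x\<bar>)"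
    using i F le by (intro integral_mono) auto
  finally show "\<bar>LINT x|lebesgue_on B. F x * b x\<bar> \<le> c * (LINT x|lebesgue_on B. \<bar>F x\<bar>)" by simp
qed

text \<open>Subtracting the very weak identity for \<open>y\<close> leaves only the differences Y -
  y and q - f, tested with functions bounded by (6 d + 24) / r^2 and by 1.\<close>

lemma bump_residual:
  fixes x0 :: "'a::euclidean_space"
  assumes w: "weak_sol \<Omega> f y" and f: "L2fun \<Omega> f" and \<Omega>: "\<Omega> \<in> sets lebesgue" "bounded \<Omega>"
    and r: "r > 0" "cball x0 r \<subseteq> \<Omega>"
    and Y: "integrable (lebesgue_on (cball x0 r)) Y" and q: "integrable (lebesgue_on (cball x0 r)) q"
  shows "\<bar>(LINT x|lebesgue_on (cball x0 r). Y x * bump_lap x0 r x) + (LINT x|lebesgue_on (cball x0 r). q x * bump x0 r x ^ 3)\<bar>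
    \<le> (LINT x|lebesgue_on (cball x0 r). \<bar>f x - q x\<bar>) + (6 * real DIM('a) + 24) / r\<^sup>2 * (LINT x|lebesgue_on (cball x0 r). \<bar>y x - Y x\<bar>)"
proof -
  let ?B = "cball x0 r"
  let ?M = "lebesgue_on ?B" and ?L = "bump_lap x0 r" and ?v = "\<lambda>x. bump x0 r x ^ 3"
  have Bs: "?B \<in> sets lebesgue" by simp
  have y: "L2fun \<Omega> y" using w by (auto simp: weak_sol_def H10_def)
  have yi: "integrable ?M y" and fi: "integrable ?M f"
    using integrable_lebesgue_on_subset[OF L2fun_integrable[OF y \<Omega>(2,1)] r(2) Bs \<Omega>(1)]
      integrable_lebesgue_on_subset[OF L2fun_integrable[OF f \<Omega>(2,1)] r(2) Bs \<Omega>(1)] by auto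
  have out: "bump x0 r x = 0" "?L x = 0" if "x \<notin> ?B" for x
    using that r(1) by (auto simp: dist_norm norm_minus_commute intro!: bump_eq_0 bump_lap_eq_0)
  have "(LINT x|lebesgue_on \<Omega>. y x * ?L x) = (LINT x|?M. y x * ?L x)"
    by (rule integral_lebesgue_on_support[OF r(2) Bs \<Omega>(1)]) (use out in simp)
  moreover have "(LINT x|lebesgue_on \<Omega>. f x * ?v x) = (LINT x|?M. f x * ?v x)"
    by (rule integral_lebesgue_on_support[OF r(2) Bs \<Omega>(1)]) (use out in simp)
  ultimately have id: "(LINT x|?M. y x * ?L x) = - (LINT x|?M. f x * ?v x)"
    using weak_sol_bump[OF w \<Omega> r] by simp
  have v1: "\<bar>?v x\<bar> \<le> 1" for x using bump_le_1[of x0 r x] by (simp add: power_le_one)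
  have cv: "continuous_on UNIV ?v" by (intro continuous_intros)
  note Lm = integral_bounded_mult[OF _ continuous_on_bump_lap bump_lap_bound[OF r(1)]]
  note vm = integral_bounded_mult[OF _ cv v1]
  have a1: "(LINT x|?M. (Y x - y x) * ?L x) = (LINT x|?M. Y x * ?L x) - (LINT x|?M. y x * ?L x)"
    unfolding left_diff_distrib by (rule Bochner_Integration.integral_diff[OF Lm(1)[OF Y] Lm(1)[OF yi]])
  have a2: "(LINT x|?M. (q x - f x) * ?v x) = (LINT x|?M. q x * ?v x) - (LINT x|?M. f x * ?v x)"
    unfolding left_diff_distrib by (rule Bochner_Integration.integral_diff[OF vm(1)[OF q] vm(1)[OF fi]])
  have "\<bar>(LINT x|?M. Y x * ?L x) + (LINT x|?M. q x * ?v x)\<bar> = \<bar>(LINT x|?M. (Y x - y x) * ?L x) + (LINT x|?M. (q x - f x) * ?v x)\<bar>"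
    unfolding a1 a2 id by simp
  also have "\<dots> \<le> \<bar>LINT x|?M. (Y x - y x) * ?L x\<bar> + \<bar>LINT x|?M. (q x - f x) * ?v x\<bar>" by (rule abs_triangle_ineq)
  also have "\<dots> \<le> (6 * real DIM('a) + 24) / r\<^sup>2 * (LINT x|?M. \<bar>Y x - y x\<bar>) + 1 * (LINT x|?M. \<bar>q x - f x\<bar>)"
    by (intro add_mono Lm(2) vm(2) Bochner_Integration.integrable_diff Y yi q fi)
  finally show ?thesis by (simp add: abs_minus_commute)
qed

text \<open>An affine \<open>Y\<close> is annihilated by \<open>bump_lap\<close>, and the affine
  data test to their value at the centre times the integral of the cubed bump, which is bounded
  below.\<close>

lemma element_residual:
  fixes x0 :: "'a::euclidean_space"
  assumes w: "weak_sol \<Omega> f y" and f: "L2fun \<Omega> f" and \<Omega>: "\<Omega> \<in> sets lebesgue" "bounded \<Omega>"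
    and r: "r > 0" "cball x0 r \<subseteq> \<Omega>"
    and Y: "\<And>x. x \<in> cball x0 r \<Longrightarrow> Y x = g \<bullet> x + c"
  shows "\<bar>gq \<bullet> x0 + cq\<bar> * (27 / 64 * unit_ball_vol DIM('a) / 2 ^ DIM('a) * r ^ DIM('a))
    \<le> (LINT x|lebesgue_on (cball x0 r). \<bar>f x - (gq \<bullet> x + cq)\<bar>) + (6 * real DIM('a) + 24) / r\<^sup>2 * (LINT x|lebesgue_on (cball x0 r). \<bar>y x - Y x\<bar>)"
proof -
  let ?B = "cball x0 r"
  let ?M = "lebesgue_on ?B"
  have Bs: "?B \<in> sets lebesgue" by simp
  have aff: "integrable ?M (\<lambda>x. a \<bullet> x + b)" for a b
    by (rule integrable_continuous_lebesgue_on) (auto intro!: continuous_intros)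
  have Yi: "integrable ?M Y" using aff[of g c] Y by (subst Bochner_Integration.integrable_cong[OF refl, of _ _ "\<lambda>x. g \<bullet> x + c"]) auto
  have out: "bump x0 r x = 0" "bump_lap x0 r x = 0" if "x \<notin> ?B" for x
    using that r(1) by (auto simp: dist_norm norm_minus_commute intro!: bump_eq_0 bump_lap_eq_0)
  have "(LINT x|?M. Y x * bump_lap x0 r x) = (LINT x|?M. (g \<bullet> x + c) * bump_lap x0 r x)"
    by (rule Bochner_Integration.integral_cong) (use Y in auto)
  also have "\<dots> = (LINT x|lebesgue. (g \<bullet> x + c) * bump_lap x0 r x)"
    by (rule integral_lebesgue_on_support_UNIV[OF Bs]) (use out in simp)
  also have "\<dots> = 0" by (rule integral_affine_bump_lap_eq_0[OF r(1)])
  finally have e1: "(LINT x|?M. Y x * bump_lap x0 r x) = 0" .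
  have ib: "integrable lebesgue (\<lambda>x. (gq \<bullet> (x - x0)) * bump x0 r x ^ 3)"
    by (rule integrable_lebesgue_continuous_compact_support[of _ "norm x0 + r"])
      (use outside_cball[of x0 r] r(1) in \<open>auto intro!: continuous_intros simp: bump_eq_0\<close>)
  have "(LINT x|?M. (gq \<bullet> x + cq) * bump x0 r x ^ 3) = (LINT x|lebesgue. (gq \<bullet> x + cq) * bump x0 r x ^ 3)"
    by (rule integral_lebesgue_on_support_UNIV[OF Bs]) (use out in simp)
  also have "\<dots> = (LINT x|lebesgue. (gq \<bullet> (x - x0)) * bump x0 r x ^ 3 + (gq \<bullet> x0 + cq) * bump x0 r x ^ 3)"
    by (rule Bochner_Integration.integral_cong) (auto simp: algebra_simps inner_diff_right)
  also have "\<dots> = (gq \<bullet> x0 + cq) * (LINT x|lebesgue. bump x0 r x ^ 3)"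
    using integral_inner_bump3_eq_0[OF r(1), of gq x0] ib integral_bump3_ge(2)[OF r(1), of x0]
    by (subst Bochner_Integration.integral_add) auto
  finally have e2: "(LINT x|?M. (gq \<bullet> x + cq) * bump x0 r x ^ 3) = (gq \<bullet> x0 + cq) * (LINT x|lebesgue. bump x0 r x ^ 3)" .
  have "\<bar>gq \<bullet> x0 + cq\<bar> * (27 / 64 * unit_ball_vol DIM('a) / 2 ^ DIM('a) * r ^ DIM('a)) \<le> \<bar>gq \<bullet> x0 + cq\<bar> * (LINT x|lebesgue. bump x0 r x ^ 3)"
    by (intro mult_left_mono integral_bump3_ge r) simp
  also have "\<dots> = \<bar>(LINT x|?M. Y x * bump_lap x0 r x) + (LINT x|?M. (gq \<bullet> x + cq) * bump x0 r x ^ 3)\<bar>"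
    unfolding e1 e2 by (simp add: abs_mult)
  also have "\<dots> \<le> (LINT x|?M. \<bar>f x - (gq \<bullet> x + cq)\<bar>) + (6 * real DIM('a) + 24) / r\<^sup>2 * (LINT x|?M. \<bar>y x - Y x\<bar>)"
    by (rule bump_residual[OF w f \<Omega> r Yi aff])
  finally show ?thesis .
qed

text \<open>The residual is taken with q = 0: the affine part of \<open>Y\<close> is annihilated,
  and the kink contributes \<open>J\<close> times a positive integral of order r^(d-1).\<close>

lemma jump_residual:
  fixes x0 :: "'a::euclidean_space"
  assumes w: "weak_sol \<Omega> f y" and f: "L2fun \<Omega> f" and \<Omega>: "\<Omega> \<in> sets lebesgue" "bounded \<Omega>"
    and r: "r > 0" "cball x0 r \<subseteq> \<Omega>" and n: "norm n = 1"
    and Y: "\<And>x. x \<in> cball x0 r \<Longrightarrow> Y x = g \<bullet> x + c + J * \<bar>n \<bullet> (x - x0)\<bar>"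
  shows "\<bar>J\<bar> * (27 / 64 * unit_ball_vol DIM('a) / 8 ^ DIM('a) * r ^ DIM('a) / r)
    \<le> (LINT x|lebesgue_on (cball x0 r). \<bar>f x\<bar>) + (6 * real DIM('a) + 24) / r\<^sup>2 * (LINT x|lebesgue_on (cball x0 r). \<bar>y x - Y x\<bar>)"
proof -
  let ?B = "cball x0 r"
  let ?M = "lebesgue_on ?B" and ?L = "bump_lap x0 r"
  have Bs: "?B \<in> sets lebesgue" by simp
  have "integrable ?M (\<lambda>x. g \<bullet> x + c + J * \<bar>n \<bullet> (x - x0)\<bar>)"
    by (rule integrable_continuous_lebesgue_on) (auto intro!: continuous_intros)
  then have Yi: "integrable ?M Y" using Y by (subst Bochner_Integration.integrable_cong[OF refl, of _ _ "\<lambda>x. g \<bullet> x + c + J * \<bar>n \<bullet> (x - x0)\<bar>"]) auto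
  have out: "bump_lap x0 r x = 0" if "x \<notin> ?B" for x
    using that r(1) by (auto simp: dist_norm norm_minus_commute intro!: bump_lap_eq_0)
  have i1: "integrable lebesgue (\<lambda>x. (g \<bullet> x + c) * ?L x)"
    by (rule integrable_lebesgue_continuous_compact_support[of _ "norm x0 + r"])
      (use outside_cball[of x0 r] r(1) in \<open>auto intro!: continuous_intros simp: bump_lap_eq_0\<close>)
  have i2: "integrable lebesgue (\<lambda>x. \<bar>n \<bullet> (x - x0)\<bar> * ?L x)"
    by (rule integrable_lebesgue_continuous_compact_support[of _ "norm x0 + r"])
      (use outside_cball[of x0 r] r(1) in \<open>auto intro!: continuous_intros simp: bump_lap_eq_0\<close>)
  have "(LINT x|?M. Y x * ?L x) = (LINT x|?M. (g \<bullet> x + c) * ?L x + J * (\<bar>n \<bullet> (x - x0)\<bar> * ?L x))"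
    by (rule Bochner_Integration.integral_cong) (use Y in \<open>auto simp: algebra_simps\<close>)
  also have "\<dots> = (LINT x|lebesgue. (g \<bullet> x + c) * ?L x + J * (\<bar>n \<bullet> (x - x0)\<bar> * ?L x))"
    by (rule integral_lebesgue_on_support_UNIV[OF Bs]) (use out in simp)
  also have "\<dots> = J * (LINT x|lebesgue. \<bar>n \<bullet> (x - x0)\<bar> * ?L x)"
    using integral_affine_bump_lap_eq_0[OF r(1), of g c x0] i1 i2
    by (subst Bochner_Integration.integral_add) auto
  finally have e1: "(LINT x|?M. Y x * ?L x) = J * (LINT x|lebesgue. \<bar>n \<bullet> (x - x0)\<bar> * ?L x)" .
  have pos: "0 \<le> (LINT x|lebesgue. \<bar>n \<bullet> (x - x0)\<bar> * ?L x)"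
    by (rule order_trans[OF _ integral_abs_bump_lap_ge[OF r(1) n]]) (use r(1) in simp)
  have "\<bar>J\<bar> * (27 / 64 * unit_ball_vol DIM('a) / 8 ^ DIM('a) * r ^ DIM('a) / r) \<le> \<bar>J\<bar> * (LINT x|lebesgue. \<bar>n \<bullet> (x - x0)\<bar> * ?L x)"
    by (intro mult_left_mono integral_abs_bump_lap_ge r n) simp
  also have "\<dots> = \<bar>(LINT x|?M. Y x * ?L x) + (LINT x|?M. 0 * bump x0 r x ^ 3)\<bar>"
    unfolding e1 using pos by (simp add: abs_mult)
  also have "\<dots> \<le> (LINT x|?M. \<bar>f x - 0\<bar>) + (6 * real DIM('a) + 24) / r\<^sup>2 * (LINT x|?M. \<bar>y x - Y x\<bar>)"
    by (rule bump_residual[OF w f \<Omega> r Yi]) simp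
  finally show ?thesis by simp
qed

context regular_mesh
begin

lemma sets_domain: "\<Omega> \<in> sets lebesgue"
  using \<Omega>(1) by simp

lemma null_boundary: "closure \<Omega> - \<Omega> \<in> null_sets lebesgue"
proof -
  have "closure \<Omega> - \<Omega> = frontier \<Omega>" using \<Omega>(1) by (simp add: frontier_def interior_open)
  then show ?thesis using negligible_convex_frontier[OF \<Omega>(3)] by (simp add: negligible_iff_null_sets)
qed

text \<open>Elements may touch the boundary, where functions on \<Omega> are uncontrolled; the
  boundary of a convex set is negligible.\<close>

lemma integrable_on_closure_subset:
  fixes f :: "'a \<Rightarrow> real"
  assumes f: "integrable (lebesgue_on \<Omega>) f" and S: "S \<subseteq> closure \<Omega>" "S \<in> sets lebesgue"
  shows "integrable (lebesgue_on S) f"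
proof -
  have "integrable (lebesgue_on (S \<inter> \<Omega>)) f"
    by (rule integrable_lebesgue_on_subset[OF f]) (use S sets_domain in auto)
  then have "f absolutely_integrable_on (S \<inter> \<Omega>)"
    unfolding set_integrable_def using S sets_domain by (subst (asm) integrable_restrict_space) auto
  then have "f absolutely_integrable_on S"
  proof (rule absolutely_integrable_spike_set)
    have "negligible (closure \<Omega> - \<Omega>)" using null_boundary by (simp add: negligible_iff_null_sets)
    then show "negligible {x \<in> S - S \<inter> \<Omega>. f x \<noteq> 0}" by (rule negligible_subset) (use S in auto)
    have "{x \<in> S \<inter> \<Omega> - S. f x \<noteq> 0} = {}" by auto
    then show "negligible {x \<in> S \<inter> \<Omega> - S. f x \<noteq> 0}" by (simp only: negligible_empty)
  qed
  then show ?thesis unfolding set_integrable_def using S by (subst integrable_restrict_space) auto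
qed

lemma patch_elem:
  assumes T: "T \<in> \<T>" and T': "T' \<in> patch \<T> T"
  shows "T' \<in> \<T>" "diameter T' \<le> 4 * \<sigma> * diameter T" "diameter T \<le> 4 * \<sigma> * diameter T'"
proof -
  have "T' \<in> \<T> \<and> diameter T' \<le> 4 * \<sigma> * diameter T \<and> diameter T \<le> 4 * \<sigma> * diameter T'"
  proof (cases "T' = T")
    case True
    have "1 * diameter T \<le> 4 * \<sigma> * diameter T" using \<sigma> elem(3)[OF T] by (intro mult_right_mono) auto
    then show ?thesis using True T by simp
  next
    case False
    then obtain e where e: "T' \<in> \<T>" "e \<in> sides \<T> T" "e \<in> sides \<T> T'" using T' by (auto simp: patch_def)
    then have "e \<subseteq> T" "e \<subseteq> T'" by (auto simp: sides_def)
    then show ?thesis using e T diameter_le_of_common_side by blast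
  qed
  then show "T' \<in> \<T>" "diameter T' \<le> 4 * \<sigma> * diameter T" "diameter T \<le> 4 * \<sigma> * diameter T'" by auto
qed

text \<open>The sign \<open>s\<close> selects the side of the hyperplane on which the inscribed ball
  has its centre, and the disc serves as the base of the cones in
  \<open>half_ball_in_convex\<close>.\<close>

lemma half_ball_in_element:
  assumes T': "T' \<in> \<T>" and h: "h > 0" "h \<le> 4 * \<sigma> * diameter T'" "diameter T' \<le> 4 * \<sigma> * h"
    and n: "norm n = 1" and x0: "x0 \<in> T'"
    and disc: "\<And>x. n \<bullet> (x - x0) = 0 \<Longrightarrow> norm (x - x0) < h / (2 * \<sigma>) \<Longrightarrow> x \<in> T'"
  obtains s where "s = 1 \<or> s = - 1"
    "\<And>x. 0 \<le> s * (n \<bullet> (x - x0)) \<Longrightarrow> norm (x - x0) \<le> h / (512 * \<sigma> ^ 4) \<Longrightarrow> x \<in> T'"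
proof -
  define r where "r = diameter T' / (2 * \<sigma>)"
  have rh: "h / (8 * \<sigma>\<^sup>2) \<le> r" using h(2) \<sigma> by (simp add: r_def field_simps power2_eq_square)
  have hp: "h / (8 * \<sigma>\<^sup>2) > 0" using h(1) \<sigma> by simp
  then have r0: "r > 0" using rh by linarith
  obtain z where z: "ball z r \<subseteq> T'" using inball[OF T'] unfolding r_def by blast
  define s :: real where "s = (if n \<bullet> (z - x0) \<ge> 0 then 1 else - 1)"
  have s: "s = 1 \<or> s = - 1" by (simp add: s_def)
  define m where "m = s *\<^sub>R n"
  have m: "norm m = 1" using n s by (auto simp: m_def)
  \<comment> \<open>Pushing the centre further along the normal guarantees height at least r/2, even
    if the centre itself lies close to the hyperplane.\<close>
  define w where "w = z + (r / 2) *\<^sub>R m"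
  have wT: "w \<in> T'" using z r0 m by (auto simp: w_def subset_iff dist_norm)
  have mz: "0 \<le> m \<bullet> (z - x0)" by (auto simp: m_def s_def)
  have mm: "m \<bullet> m = 1" using m by (simp add: norm_eq_1)
  have "m \<bullet> (w - x0) = m \<bullet> (z - x0) + r / 2"
    using mm by (simp add: w_def inner_diff_right inner_add_right)
  then have wh: "h / (16 * \<sigma>\<^sup>2) \<le> m \<bullet> (w - x0)" using mz rh by simp
  have wD: "norm (w - x0) \<le> 4 * \<sigma> * h"
    using diameter_bounded_bound[OF elem(2)[OF T'] wT x0] h(3) by (simp add: dist_norm)
  have disc': "x \<in> T'" if "m \<bullet> (x - x0) = 0" "norm (x - x0) < h / (2 * \<sigma>)" for x
    using that s by (intro disc) (auto simp: m_def)
  have s2: "1 \<le> \<sigma>\<^sup>2" "1 \<le> \<sigma> ^ 3" using \<sigma> by (auto intro: one_le_power)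
  have k0: "0 < h / (512 * \<sigma> ^ 4)" using h(1) \<sigma> by simp
  have k1: "h / (512 * \<sigma> ^ 4) \<le> h / (16 * \<sigma>\<^sup>2) / 2"
  proof -
    have "1 * (32 * \<sigma>\<^sup>2) \<le> (16 * \<sigma>\<^sup>2) * (32 * \<sigma>\<^sup>2)" using s2 by (intro mult_right_mono) auto
    also have "\<dots> = 512 * \<sigma> ^ 4" by (simp add: power4_eq_xxxx power2_eq_square)
    finally have "h / (512 * \<sigma> ^ 4) \<le> h / (32 * \<sigma>\<^sup>2)" using h(1) \<sigma> by (intro divide_left_mono) auto
    then show ?thesis by simp
  qed
  \<comment> \<open>Origin of 512 \<sigma>^4: with height h / (16 \<sigma>^2) and distance 4
    \<sigma> h the quotient is 64 \<sigma>^3, and 2 * 65 / 512 < 1/2.\<close>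
  have k2: "2 * (h / (512 * \<sigma> ^ 4)) * (1 + 4 * \<sigma> * h / (h / (16 * \<sigma>\<^sup>2))) < h / (2 * \<sigma>)"
  proof -
    have "4 * \<sigma> * h / (h / (16 * \<sigma>\<^sup>2)) = 64 * \<sigma> ^ 3"
      using h(1) \<sigma> by (simp add: power3_eq_cube power2_eq_square)
    then have "1 + 4 * \<sigma> * h / (h / (16 * \<sigma>\<^sup>2)) \<le> 65 * \<sigma> ^ 3" using s2 by simp
    then have "2 * (h / (512 * \<sigma> ^ 4)) * (1 + 4 * \<sigma> * h / (h / (16 * \<sigma>\<^sup>2))) \<le> 2 * (h / (512 * \<sigma> ^ 4)) * (65 * \<sigma> ^ 3)"
      using k0 by (intro mult_left_mono) auto
    also have "\<dots> = 130 / 512 * (h / \<sigma>)" using \<sigma> by (simp add: power4_eq_xxxx power3_eq_cube)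
    also have "\<dots> < 1 / 2 * (h / \<sigma>)" using h(1) \<sigma> by (intro mult_strict_right_mono) auto
    finally show ?thesis by simp
  qed
  show ?thesis
  proof (rule that[OF s])
    fix x assume "0 \<le> s * (n \<bullet> (x - x0))" "norm (x - x0) \<le> h / (512 * \<sigma> ^ 4)"
    then show "x \<in> T'"
      by (intro half_ball_in_convex[OF elem(5)[OF T'] m _ wh wT wD disc' k0 k1 k2]) (use h(1) \<sigma> in \<open>auto simp: m_def\<close>)
  qed
qed

text \<open>The pair picked by \<open>side_elems\<close> is a choice among elements meeting in
  \<open>e\<close>; both contain \<open>e\<close> as a side and hence belong to the patch of
  \<open>T\<close>. The constant is stated in terms of diam T, to which both diameters are
  comparable.\<close>

lemma side_ball:
  assumes T: "T \<in> \<T>" and e: "e \<in> sides \<T> T"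
  obtains Tp Tm x0 s where "side_elems \<T> e = (Tp, Tm)" "Tp \<in> patch \<T> T" "Tm \<in> patch \<T> T" "s = 1 \<or> s = - 1"
    "\<And>x. 0 \<le> s * (side_normal e \<bullet> (x - x0)) \<Longrightarrow> norm (x - x0) \<le> diameter T / (512 * \<sigma> ^ 4) \<Longrightarrow> x \<in> Tp"
    "\<And>x. s * (side_normal e \<bullet> (x - x0)) \<le> 0 \<Longrightarrow> norm (x - x0) \<le> diameter T / (512 * \<sigma> ^ 4) \<Longrightarrow> x \<in> Tm"
proof -
  let ?n = "side_normal e" and ?h = "diameter T"
  have ad: "aff_dim e = int DIM('a) - 1" using e by (auto simp: sides_def)
  obtain T' where T': "T' \<in> \<T>" "T' \<noteq> T" "e = T \<inter> T'" using e by (auto simp: sides_def)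
  obtain Tp Tm where se: "side_elems \<T> e = (Tp, Tm)" by fastforce
  have "\<exists>p. case p of (Tp, Tm) \<Rightarrow> Tp \<in> \<T> \<and> Tm \<in> \<T> \<and> Tp \<noteq> Tm \<and> e = Tp \<inter> Tm"
    using T T' by (intro exI[of _ "(T, T')"]) auto
  from someI_ex[OF this] have pm: "Tp \<in> \<T>" "Tm \<in> \<T>" "Tp \<noteq> Tm" "e = Tp \<inter> Tm"
    using se unfolding side_elems_def by auto
  have ep: "e \<in> sides \<T> Tp" unfolding sides_def using pm ad by (intro CollectI exI[of _ Tm]) auto
  have "e = Tm \<inter> Tp" "aff_dim (Tm \<inter> Tp) = int DIM('a) - 1" using ad pm(4) by (auto simp: Int_commute)
  then have em: "e \<in> sides \<T> Tm" unfolding sides_def using pm(1-3) by (intro CollectI exI[of _ Tp]) auto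
  have pp: "Tp \<in> patch \<T> T" "Tm \<in> patch \<T> T" using pm ep em e by (auto simp: patch_def)
  have n: "norm ?n = 1" "\<And>x y. x \<in> e \<Longrightarrow> y \<in> e \<Longrightarrow> ?n \<bullet> (x - y) = 0" using side_normal[OF ad] by auto
  have h: "?h > 0" by (rule elem(3)[OF T])
  have r: "?h / (2 * \<sigma>) > 0" using h \<sigma> by simp
  obtain z where z: "ball z (?h / (2 * \<sigma>)) \<subseteq> T" using inball[OF T] by blast
  obtain x0 where x0: "x0 \<in> e" "\<And>x. ?n \<bullet> (x - x0) = 0 \<Longrightarrow> norm (x - x0) < ?h / (2 * \<sigma>) \<Longrightarrow> x \<in> e"
    using simplex_facet_contains_disc[OF elem(1)[OF T] sides_facet[OF tr T e] z r n] by blast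
  have sub: "e \<subseteq> Tp" "e \<subseteq> Tm" using pm by auto
  obtain s1 where s1: "s1 = 1 \<or> s1 = - 1"
    "\<And>x. 0 \<le> s1 * (?n \<bullet> (x - x0)) \<Longrightarrow> norm (x - x0) \<le> ?h / (512 * \<sigma> ^ 4) \<Longrightarrow> x \<in> Tp"
    by (rule half_ball_in_element[OF pm(1) h patch_elem(3,2)[OF T pp(1)] n(1), of x0]) (use x0 sub in auto)
  obtain s2 where s2: "s2 = 1 \<or> s2 = - 1"
    "\<And>x. 0 \<le> s2 * (?n \<bullet> (x - x0)) \<Longrightarrow> norm (x - x0) \<le> ?h / (512 * \<sigma> ^ 4) \<Longrightarrow> x \<in> Tm"
    by (rule half_ball_in_element[OF pm(2) h patch_elem(3,2)[OF T pp(2)] n(1), of x0]) (use x0 sub in auto)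
  \<comment> \<open>If both half balls lay on the same side, a point off the hyperplane would belong
    to both elements and thus to \<open>e\<close>.\<close>
  have "s1 \<noteq> s2"
  proof
    assume eq: "s1 = s2"
    define k where "k = ?h / (512 * \<sigma> ^ 4)"
    have k: "k > 0" using h \<sigma> by (simp add: k_def)
    define x where "x = x0 + (k * s1) *\<^sub>R ?n"
    have nn: "?n \<bullet> ?n = 1" using n(1) by (simp add: norm_eq_1)
    have nx: "?n \<bullet> (x - x0) = k * s1" using nn by (simp add: x_def)
    have "0 \<le> s1 * (?n \<bullet> (x - x0))" unfolding nx using s1(1) k by auto
    moreover have "norm (x - x0) \<le> k" using n(1) k s1(1) by (auto simp: x_def)
    ultimately have "x \<in> e" using s1(2)[of x] s2(2)[of x] eq pm(4) unfolding k_def by auto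
    then have "?n \<bullet> (x - x0) = 0" using n(2) x0(1) by blast
    then show False using nx k s1(1) by auto
  qed
  then have "s2 = - s1" using s1(1) s2(1) by auto
  then show ?thesis using s2(2) by (intro that[OF se pp s1]) auto
qed

text \<open>Write \<open>v\<close> as the mean of its two affine pieces plus or minus half their
  difference. Continuity makes the difference vanish on a disc of the hyperplane, so it equals the
  jump times n . (x - x0), and the two signs combine into the absolute value. The sign
  \<open>s\<close> records on which side \<open>Tp\<close> lies.\<close>

lemma Vh_near_side:
  assumes T: "T \<in> \<T>" and e: "e \<in> sides \<T> T" and v: "v \<in> Vh \<Omega> \<T>"
  obtains Tp Tm x0 g c s where "Tp \<in> patch \<T> T" "Tm \<in> patch \<T> T" "s = 1 \<or> s = - 1"
    "cball x0 (diameter T / (512 * \<sigma> ^ 4)) \<subseteq> Tp \<union> Tm"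
    "\<And>x. x \<in> cball x0 (diameter T / (512 * \<sigma> ^ 4)) \<Longrightarrow>
       v x = g \<bullet> x + c + s / 2 * jump \<T> v e * \<bar>side_normal e \<bullet> (x - x0)\<bar>"
proof -
  let ?n = "side_normal e" and ?k = "diameter T / (512 * \<sigma> ^ 4)"
  obtain Tp Tm x0 s where se: "side_elems \<T> e = (Tp, Tm)" and p: "Tp \<in> patch \<T> T" "Tm \<in> patch \<T> T"
    and s: "s = 1 \<or> s = - 1"
    and Tp: "\<And>x. 0 \<le> s * (?n \<bullet> (x - x0)) \<Longrightarrow> norm (x - x0) \<le> ?k \<Longrightarrow> x \<in> Tp"
    and Tm: "\<And>x. s * (?n \<bullet> (x - x0)) \<le> 0 \<Longrightarrow> norm (x - x0) \<le> ?k \<Longrightarrow> x \<in> Tm"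
    by (rule side_ball[OF T e]) blast
  have ad: "aff_dim e = int DIM('a) - 1" using e by (auto simp: sides_def)
  have n: "norm ?n = 1" using side_normal[OF ad] by auto
  have nn: "?n \<bullet> ?n = 1" using n by (simp add: norm_eq_1)
  have k: "?k > 0" using elem(3)[OF T] \<sigma> by simp
  have grad: "\<exists>c. \<forall>x\<in>T'. v x = grad_on T' v \<bullet> x + c" if "T' \<in> \<T>" for T'
  proof -
    have "\<exists>g c. \<forall>x\<in>T'. v x = g \<bullet> x + c" using v that by (auto simp: Vh_def)
    from someI_ex[OF this] show ?thesis unfolding grad_on_def .
  qed
  define gp gm where "gp = grad_on Tp v" and "gm = grad_on Tm v"
  obtain cp cm where cp: "\<And>x. x \<in> Tp \<Longrightarrow> v x = gp \<bullet> x + cp" and cm: "\<And>x. x \<in> Tm \<Longrightarrow> v x = gm \<bullet> x + cm"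
    using grad[OF patch_elem(1)[OF T p(1)]] grad[OF patch_elem(1)[OF T p(2)]] unfolding gp_def gm_def by blast
  define J where "J = ?n \<bullet> (gp - gm)"
  have J: "jump \<T> v e = J" unfolding jump_def se J_def gp_def gm_def by (simp add: inner_diff_right)
  have zero: "(gp - gm) \<bullet> x + (cp - cm) = 0" if "?n \<bullet> (x - x0) = 0" "norm (x - x0) \<le> ?k" for x
  proof -
    have "x \<in> Tp" "x \<in> Tm" using Tp[of x] Tm[of x] that by auto
    from cp[OF this(1)] cm[OF this(2)] show ?thesis by (simp add: inner_diff_left)
  qed
  have z0: "(gp - gm) \<bullet> x0 + (cp - cm) = 0" by (rule zero) (use k in auto)
  \<comment> \<open>Scaling a tangential vector to length at most the half ball radius keeps the
    point in the disc where both affine pieces agree.\<close>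
  have orth: "(gp - gm) \<bullet> \<tau> = 0" if "?n \<bullet> \<tau> = 0" for \<tau>
  proof (cases "\<tau> = 0")
    case False
    define a where "a = ?k / norm \<tau>"
    have a: "a > 0" unfolding a_def by (rule divide_pos_pos[OF k]) (use False in simp)
    have "(gp - gm) \<bullet> (x0 + a *\<^sub>R \<tau>) + (cp - cm) = 0"
      by (rule zero) (use that False k in \<open>auto simp: a_def\<close>)
    then have "a * ((gp - gm) \<bullet> \<tau>) = 0" using z0 unfolding inner_add_right inner_scaleR_right by linarith
    then show ?thesis using a by simp
  qed simp
  have diff: "(gp \<bullet> x + cp) - (gm \<bullet> x + cm) = J * (?n \<bullet> (x - x0))" for x
  proof -
    define t where "t = ?n \<bullet> (x - x0)"
    define \<tau> where "\<tau> = x - x0 - t *\<^sub>R ?n"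
    have "?n \<bullet> \<tau> = 0" using nn by (simp add: \<tau>_def t_def inner_diff_right)
    from orth[OF this] have "(gp - gm) \<bullet> (x - x0) = t * ((gp - gm) \<bullet> ?n)"
      by (simp add: \<tau>_def inner_diff_right)
    then show ?thesis using z0 by (simp add: t_def J_def inner_diff_right inner_diff_left inner_commute algebra_simps)
  qed
  have main: "v x = ((1 / 2) *\<^sub>R (gp + gm)) \<bullet> x + (cp + cm) / 2 + s / 2 * jump \<T> v e * \<bar>?n \<bullet> (x - x0)\<bar>"
    if "x \<in> cball x0 ?k" for x
  proof -
    define t where "t = ?n \<bullet> (x - x0)"
    have nx: "norm (x - x0) \<le> ?k" using that by (simp add: dist_norm norm_minus_commute)
    have d: "(gp \<bullet> x + cp) - (gm \<bullet> x + cm) = J * t" using diff[of x] by (simp add: t_def)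
    have av: "((1 / 2) *\<^sub>R (gp + gm)) \<bullet> x + (cp + cm) / 2 = ((gp \<bullet> x + cp) + (gm \<bullet> x + cm)) / 2"
      by (simp add: inner_add_left field_simps)
    show ?thesis
    proof (cases "0 \<le> s * t")
      case True
      then have "v x = gp \<bullet> x + cp" using Tp[OF _ nx] cp by (simp add: t_def)
      moreover have "s * \<bar>t\<bar> = t" using True s by (auto simp: zero_le_mult_iff)
      ultimately show ?thesis unfolding av J t_def[symmetric] using d by (auto simp: field_simps)
    next
      case False
      then have "v x = gm \<bullet> x + cm" using Tm[OF _ nx] cm by (simp add: t_def)
      moreover have "s * \<bar>t\<bar> = - t" using False s by (auto simp: zero_le_mult_iff)
      ultimately show ?thesis unfolding av J t_def[symmetric] using d by (auto simp: field_simps)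
    qed
  qed
  have "cball x0 ?k \<subseteq> Tp \<union> Tm"
  proof
    fix x assume "x \<in> cball x0 ?k"
    then have "norm (x - x0) \<le> ?k" by (simp add: dist_norm norm_minus_commute)
    then show "x \<in> Tp \<union> Tm" using Tp[of x] Tm[of x] by (cases "0 \<le> s * (?n \<bullet> (x - x0))") auto
  qed
  from that[OF p s this main] show ?thesis by blast
qed

end


section \<open>From L2 norms to L1 norms on small sets\<close>

lemma L2fun_diff: "L2fun S f \<Longrightarrow> L2fun S g \<Longrightarrow> L2fun S (\<lambda>x. f x - g x)"
  using integrable_norm_square_diff[of f "lebesgue_on S" g] by (auto simp: L2fun_def)

lemma L2fun_continuous:
  "continuous_on UNIV f \<Longrightarrow> bounded S \<Longrightarrow> S \<in> sets lebesgue \<Longrightarrow> L2fun S f"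
  using continuous_square_integrable[of f S] continuous_measurable_lebesgue_on[of f S] by (simp add: L2fun_def)

lemma L2norm_square: "(L2norm S f)\<^sup>2 = (LINT x|lebesgue_on S. (f x)\<^sup>2)"
  by (simp add: L2norm_def)

lemma L2norm_nonneg: "0 \<le> L2norm S f"
  by (simp add: L2norm_def)

lemma L1_le_L2norm:
  fixes g :: "'a::euclidean_space \<Rightarrow> real"
  assumes g: "L2fun S g" and B: "B \<subseteq> S" "B \<in> lmeasurable" "S \<in> sets lebesgue" and m: "measure lebesgue B \<le> m"
  shows "integrable (lebesgue_on B) g" "(LINT x|lebesgue_on B. \<bar>g x\<bar>) \<le> sqrt m * L2norm S g"
proof -
  have Bs: "B \<in> sets lebesgue" using B(2) by (rule fmeasurableD)
  have gm: "g \<in> borel_measurable (lebesgue_on S)" and g2S: "integrable (lebesgue_on S) (\<lambda>x. (g x)\<^sup>2)"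
    using g by (auto simp: L2fun_def)
  have gB: "g \<in> borel_measurable (lebesgue_on B)" using gm B(1) by (rule measurable_restrict_mono)
  have g2: "integrable (lebesgue_on B) (\<lambda>x. (g x)\<^sup>2)" by (rule integrable_lebesgue_on_subset[OF g2S B(1) Bs B(3)])
  interpret finite_measure "lebesgue_on B" by (rule finite_measure_lebesgue_on[OF B(2)])
  have one: "(\<lambda>x. 1::real) \<in> borel_measurable (lebesgue_on B)" "integrable (lebesgue_on B) (\<lambda>x. 1\<^sup>2 :: real)" by auto
  show "integrable (lebesgue_on B) g" using Cauchy_Schwarz_integral(1)[OF gB one(1) g2 one(2)] by simp
  have "(LINT x|lebesgue_on B. (1::real)\<^sup>2) = measure lebesgue B"
    using Bs by (simp add: measure_restrict_space)
  then have "(LINT x|lebesgue_on B. \<bar>g x\<bar>)\<^sup>2 \<le> (LINT x|lebesgue_on B. (g x)\<^sup>2) * measure lebesgue B"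
    using Cauchy_Schwarz_integral(2)[OF gB one(1) g2 one(2)] by simp
  also have "\<dots> \<le> (LINT x|lebesgue_on S. (g x)\<^sup>2) * m"
    by (intro mult_mono m integral_lebesgue_on_mono_set[OF B(1) Bs B(3) g2S]) auto
  also have "\<dots> = (sqrt m * L2norm S g)\<^sup>2"
    using order_trans[OF measure_nonneg m] by (simp add: power_mult_distrib L2norm_square)
  finally show "(LINT x|lebesgue_on B. \<bar>g x\<bar>) \<le> sqrt m * L2norm S g"
    by (rule power2_le_imp_le) (use order_trans[OF measure_nonneg m] L2norm_nonneg[of S g] in simp)
qed

lemma integral_le_cover:
  fixes F :: "'a::euclidean_space \<Rightarrow> real"
  assumes F: "integrable (lebesgue_on B) F" "\<And>x. x \<in> B \<Longrightarrow> 0 \<le> F x"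
    and B: "B \<in> sets lebesgue" "X \<in> sets lebesgue" "Z \<in> sets lebesgue" "B \<subseteq> X \<union> Z"
  shows "(LINT x|lebesgue_on B. F x) \<le> (LINT x|lebesgue_on (B \<inter> X). F x) + (LINT x|lebesgue_on (B \<inter> Z). F x)"
proof -
  have i: "integrable lebesgue (\<lambda>x. indicator S x *\<^sub>R F x)" if "S \<subseteq> B" "S \<in> sets lebesgue" for S
    using integrable_lebesgue_on_subset[OF F(1) that(1,2) B(1)] that(2)
    by (subst (asm) integrable_restrict_space) auto
  have e: "(LINT x|lebesgue_on S. F x) = (LINT x|lebesgue. indicator S x *\<^sub>R F x)" if "S \<in> sets lebesgue" for S
    by (rule integral_restrict_space) (use that in simp)
  have "(LINT x|lebesgue. indicator B x *\<^sub>R F x) \<le> (LINT x|lebesgue. indicator (B \<inter> X) x *\<^sub>R F x + indicator (B \<inter> Z) x *\<^sub>R F x)"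
    by (intro integral_mono Bochner_Integration.integrable_add i) (use B F(2) in \<open>auto simp: indicator_def\<close>)
  also have "\<dots> = (LINT x|lebesgue. indicator (B \<inter> X) x *\<^sub>R F x) + (LINT x|lebesgue. indicator (B \<inter> Z) x *\<^sub>R F x)"
    by (intro Bochner_Integration.integral_add i) (use B in auto)
  finally show ?thesis using B by (simp only: e sets.Int)
qed

lemma inradius_nonneg:
  assumes "bounded T"
  shows "0 \<le> inradius (T :: 'a::euclidean_space set)"
  unfolding inradius_def
proof (rule cSup_upper)
  show "0 \<in> {r. \<exists>x. ball x r \<subseteq> T}" by simp
  show "bdd_above {r. \<exists>x. ball x r \<subseteq> T}"
  proof (rule bdd_aboveI)
    fix r assume "r \<in> {r. \<exists>x. ball x r \<subseteq> T}"
    then obtain x where "ball x r \<subseteq> T" by auto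
    then have "diameter (ball x r) \<le> diameter T" by (rule diameter_subset[OF _ assms])
    then show "r \<le> diameter T" using diameter_ge_0[OF assms] by (cases "r > 0") auto
  qed
qed

text \<open>The ratio of \<open>h\<close> to the radius of the test balls is at most 32 \<sigma>^2;
  the divisor is the lower bound for the integral of the cubed bump; 1 + 16 \<sigma> extends the
  bound from two points to the whole element.\<close>

definition elem_const :: "nat \<Rightarrow> real \<Rightarrow> real" where
  "elem_const d \<sigma> = (1 + 16 * \<sigma>) * ((1 + (6 * real d + 24) * (32 * \<sigma>\<^sup>2)\<^sup>2) * (32 * \<sigma>\<^sup>2) ^ d
     / (27 / 64 * unit_ball_vol d / 2 ^ d))"

text \<open>The test radius is h / (1024 \<sigma>^4). The leading 2 undoes the half in front of the
  jump, the summands 2 + 2 C v account for the data on two elements, and the divisor stems from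
  \<open>integral_abs_bump_lap_ge\<close>.\<close>

definition jump_const :: "nat \<Rightarrow> real \<Rightarrow> real" where
  "jump_const d \<sigma> = 2 * (2 + 2 * elem_const d \<sigma> * unit_ball_vol d + (6 * real d + 24) * (1024 * \<sigma> ^ 4)\<^sup>2)
     * (1024 * \<sigma> ^ 4) ^ d / (27 / 64 * unit_ball_vol d / 8 ^ d)"

lemma elem_const_nonneg: "\<sigma> \<ge> 1 \<Longrightarrow> 0 \<le> elem_const d \<sigma>"
  by (simp add: elem_const_def)

lemma jump_const_nonneg: "\<sigma> \<ge> 1 \<Longrightarrow> 0 \<le> jump_const d \<sigma>"
  using elem_const_nonneg[of \<sigma> d] by (simp add: jump_const_def)

text \<open>The radius \<open>r\<close> is at least h / m, so h^d and 1 / r^2 are exchanged for m^d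
  r^d and m^2 / h^2. The factor r^d then cancels against the lower bounds of the bump
  integrals.\<close>

lemma residual_scaling:
  fixes h r m A \<Phi> P c :: real
  assumes h: "h > 0" "r > 0" "h / m \<le> r" "m > 0" and n: "0 \<le> A" "0 \<le> \<Phi>" "0 \<le> c" "0 \<le> k" "c \<le> k * (\<Phi> + A / h\<^sup>2)" "0 \<le> e"
  shows "c * h ^ d + e / r\<^sup>2 * (A * h ^ d) \<le> (k + e * m\<^sup>2) * (\<Phi> + A / h\<^sup>2) * m ^ d * r ^ d"
proof -
  have hm: "h \<le> m * r" using h by (simp add: field_simps)
  have hd: "h ^ d \<le> m ^ d * r ^ d" using power_mono[OF hm, of d] h by (simp add: power_mult_distrib)
  have "h\<^sup>2 \<le> m\<^sup>2 * r\<^sup>2" using power_mono[OF hm, of 2] h by (simp add: power_mult_distrib)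
  then have "1 / r\<^sup>2 \<le> m\<^sup>2 / h\<^sup>2" using h by (simp add: field_simps)
  then have "e * A * (1 / r\<^sup>2) \<le> e * A * (m\<^sup>2 / h\<^sup>2)" using n by (intro mult_left_mono) auto
  also have "\<dots> = e * m\<^sup>2 * (A / h\<^sup>2)" by simp
  also have "\<dots> \<le> e * m\<^sup>2 * (\<Phi> + A / h\<^sup>2)" using n by (intro mult_left_mono) auto
  finally have "e / r\<^sup>2 * A \<le> e * m\<^sup>2 * (\<Phi> + A / h\<^sup>2)" by (simp add: mult.commute)
  then have s: "c + e / r\<^sup>2 * A \<le> (k + e * m\<^sup>2) * (\<Phi> + A / h\<^sup>2)" using n by (simp add: distrib_right)
  have "c * h ^ d + e / r\<^sup>2 * (A * h ^ d) = (c + e / r\<^sup>2 * A) * h ^ d" by (simp add: algebra_simps)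
  also have "\<dots> \<le> ((k + e * m\<^sup>2) * (\<Phi> + A / h\<^sup>2)) * (m ^ d * r ^ d)"
    using n h by (intro mult_mono s hd) auto
  finally show ?thesis by (simp add: mult.assoc)
qed

context regular_mesh
begin

text \<open>State and adjoint differ only in the affine data \<open>gq\<close>, \<open>cq\<close>
  and in the numbers \<open>A\<close> and \<Phi>. The affine data are bounded first; the jump bound
  depends on this, because the L1 norm of \<open>f\<close> near a side is estimated by the distance
  to the affine data plus the data themselves. \<open>hF\<close> is stated on intersections with one
  element because a ball around a side meets two different affine pieces.\<close>

lemma local_bounds:
  fixes f y Y :: "'a \<Rightarrow> real" and gq :: "'a set \<Rightarrow> 'a" and cq :: "'a set \<Rightarrow> real"
  assumes T: "T \<in> \<T>" and w: "weak_sol \<Omega> f y" and f: "L2fun \<Omega> f" and Y: "Y \<in> Vh \<Omega> \<T>"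
    and A0: "0 \<le> A" and \<Phi>0: "0 \<le> \<Phi>"
    and hA: "\<And>x r. 0 < r \<Longrightarrow> r \<le> diameter T \<Longrightarrow> cball x r \<subseteq> \<Omega> \<Longrightarrow> cball x r \<subseteq> \<Union>(patch \<T> T) \<Longrightarrow>
        (LINT x|lebesgue_on (cball x r). \<bar>y x - Y x\<bar>) \<le> A * diameter T ^ DIM('a)"
    and hF: "\<And>T' x r. T' \<in> patch \<T> T \<Longrightarrow> 0 < r \<Longrightarrow> r \<le> diameter T \<Longrightarrow> cball x r \<subseteq> \<Omega> \<Longrightarrow>
        (LINT x|lebesgue_on (cball x r \<inter> T'). \<bar>f x - (gq T' \<bullet> x + cq T')\<bar>) \<le> \<Phi> * diameter T ^ DIM('a)"
  shows "\<And>T' x. T' \<in> patch \<T> T \<Longrightarrow> x \<in> T' \<Longrightarrow> \<bar>gq T' \<bullet> x + cq T'\<bar> \<le> elem_const DIM('a) \<sigma> * (\<Phi> + A / (diameter T)\<^sup>2)"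
    and "\<And>e. e \<in> sides \<T> T \<Longrightarrow> \<bar>jump \<T> Y e\<bar> \<le> jump_const DIM('a) \<sigma> * diameter T * (\<Phi> + A / (diameter T)\<^sup>2)"
proof -
  define h where "h = diameter T"
  define W where "W = \<Phi> + A / h\<^sup>2"
  let ?d = "DIM('a)"
  let ?v = "unit_ball_vol ?d"
  have h: "h > 0" unfolding h_def by (rule elem(3)[OF T])
  have W0: "0 \<le> W" using A0 \<Phi>0 by (simp add: W_def)
  have v: "?v > 0" by simp
  have vh: "measure lebesgue (cball x r) \<le> ?v * h ^ ?d" if "0 < r" "r \<le> h" for x :: 'a and r
    using that by (simp add: content_cball power_mono)
  show E: "\<bar>gq T' \<bullet> x + cq T'\<bar> \<le> elem_const ?d \<sigma> * (\<Phi> + A / (diameter T)\<^sup>2)" if T': "T' \<in> patch \<T> T" and xT: "x \<in> T'" for T' x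
  proof -
    note pe = patch_elem[OF T T', folded h_def]
    let ?h = "diameter T'"
    have h': "?h > 0" by (rule elem(3)[OF pe(1)])
    \<comment> \<open>A quarter of the inscribed radius: balls of radius \<rho> around any point
      within \<rho> of the centre stay in the inscribed ball.\<close>
    define \<rho> where "\<rho> = ?h / (8 * \<sigma>)"
    have \<rho>: "\<rho> > 0" using h' \<sigma> by (simp add: \<rho>_def)
    have "0 \<le> \<sigma> * h" using \<sigma> h by simp
    then have "?h \<le> h * (8 * \<sigma>)" using pe(2) by (simp add: mult_ac)
    then have \<rho>h: "\<rho> \<le> h" unfolding \<rho>_def using \<sigma> by (subst pos_divide_le_eq) auto
    have \<rho>m: "h / (32 * \<sigma>\<^sup>2) \<le> \<rho>" using pe(3) \<sigma> by (simp add: \<rho>_def field_simps power2_eq_square)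
    obtain z where z: "ball z (?h / (2 * \<sigma>)) \<subseteq> T'" using inball[OF pe(1)] by blast
    have z4: "?h / (2 * \<sigma>) = 4 * \<rho>" by (simp add: \<rho>_def)
    have z\<Omega>: "ball z (4 * \<rho>) \<subseteq> \<Omega>" using open_subset_domain[of "ball z (4 * \<rho>)"] z elem(4)[OF pe(1)] unfolding z4 by auto
    obtain g c where Yg: "\<And>x. x \<in> T' \<Longrightarrow> Y x = g \<bullet> x + c" using Y pe(1) by (auto simp: Vh_def)
    define K where "K = (1 + (6 * real ?d + 24) * (32 * \<sigma>\<^sup>2)\<^sup>2) * (32 * \<sigma>\<^sup>2) ^ ?d / (27 / 64 * ?v / 2 ^ ?d)"
    have K0: "0 \<le> K" using v by (simp add: K_def)
    have pt: "\<bar>gq T' \<bullet> x1 + cq T'\<bar> \<le> K * W" if x1: "norm (x1 - z) \<le> \<rho>" for x1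
    proof -
      have sub: "cball x1 \<rho> \<subseteq> ball z (4 * \<rho>)"
      proof
        fix x assume "x \<in> cball x1 \<rho>"
        then have "norm (x - x1) \<le> \<rho>" by (simp add: dist_norm norm_minus_commute)
        then have "norm (x - z) \<le> 2 * \<rho>" using x1 norm_triangle_ineq[of "x - x1" "x1 - z"] by simp
        then show "x \<in> ball z (4 * \<rho>)" using \<rho> by (simp add: dist_norm norm_minus_commute)
      qed
      have sT: "cball x1 \<rho> \<subseteq> T'" using sub z unfolding z4 by blast
      have s\<Omega>: "cball x1 \<rho> \<subseteq> \<Omega>" using sub z\<Omega> by blast
      have "\<bar>gq T' \<bullet> x1 + cq T'\<bar> * (27 / 64 * ?v / 2 ^ ?d * \<rho> ^ ?d)
        \<le> (LINT x|lebesgue_on (cball x1 \<rho>). \<bar>f x - (gq T' \<bullet> x + cq T')\<bar>) + (6 * real ?d + 24) / \<rho>\<^sup>2 * (LINT x|lebesgue_on (cball x1 \<rho>). \<bar>y x - Y x\<bar>)"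
        by (rule element_residual[OF w f sets_domain \<Omega>(2) \<rho> s\<Omega> Yg]) (use sT in auto)
      also have "\<dots> \<le> \<Phi> * h ^ ?d + (6 * real ?d + 24) / \<rho>\<^sup>2 * (A * h ^ ?d)"
      proof (intro add_mono mult_left_mono)
        have "cball x1 \<rho> \<inter> T' = cball x1 \<rho>" using sT by auto
        then show "(LINT x|lebesgue_on (cball x1 \<rho>). \<bar>f x - (gq T' \<bullet> x + cq T')\<bar>) \<le> \<Phi> * h ^ ?d"
          using hF[OF T' \<rho> _ s\<Omega>] \<rho>h by (simp add: h_def)
        have "cball x1 \<rho> \<subseteq> \<Union>(patch \<T> T)" using sT T' by auto
        then show "(LINT x|lebesgue_on (cball x1 \<rho>). \<bar>y x - Y x\<bar>) \<le> A * h ^ ?d"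
          using hA[OF \<rho> _ s\<Omega>] \<rho>h by (simp add: h_def)
      qed simp
      also have "\<dots> \<le> (1 + (6 * real ?d + 24) * (32 * \<sigma>\<^sup>2)\<^sup>2) * W * (32 * \<sigma>\<^sup>2) ^ ?d * \<rho> ^ ?d"
        unfolding W_def using h \<rho> \<rho>m \<sigma> A0 \<Phi>0 by (intro residual_scaling) auto
      finally have "(\<bar>gq T' \<bullet> x1 + cq T'\<bar> * (27 / 64 * ?v / 2 ^ ?d)) * \<rho> ^ ?d
          \<le> ((1 + (6 * real ?d + 24) * (32 * \<sigma>\<^sup>2)\<^sup>2) * W * (32 * \<sigma>\<^sup>2) ^ ?d) * \<rho> ^ ?d" by (simp only: mult.assoc)
      then have "\<bar>gq T' \<bullet> x1 + cq T'\<bar> * (27 / 64 * ?v / 2 ^ ?d) \<le> (1 + (6 * real ?d + 24) * (32 * \<sigma>\<^sup>2)\<^sup>2) * W * (32 * \<sigma>\<^sup>2) ^ ?d"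
        using \<rho> by (simp only: mult_le_cancel_right_pos zero_less_power)
      then have "\<bar>gq T' \<bullet> x1 + cq T'\<bar> \<le> (1 + (6 * real ?d + 24) * (32 * \<sigma>\<^sup>2)\<^sup>2) * W * (32 * \<sigma>\<^sup>2) ^ ?d / (27 / 64 * ?v / 2 ^ ?d)"
        using v by (subst pos_le_divide_eq) auto
      then show ?thesis by (simp add: K_def mult_ac)
    qed
    have p0: "\<bar>gq T' \<bullet> z + cq T'\<bar> \<le> K * W" by (rule pt) (use \<rho> in simp)
    \<comment> \<open>A second test point in the direction of the gradient: the difference of the
      two values is \<rho> |gq|, which controls the slope.\<close>
    have p1: "\<bar>gq T' \<bullet> (z + \<rho> *\<^sub>R sgn (gq T')) + cq T'\<bar> \<le> K * W"
      by (rule pt) (use \<rho> in \<open>auto simp: norm_sgn\<close>)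
    have ng: "gq T' \<bullet> sgn (gq T') = norm (gq T')"
      by (cases "gq T' = 0") (auto simp: sgn_div_norm power2_norm_eq_inner[symmetric] power2_eq_square)
    have "gq T' \<bullet> (z + \<rho> *\<^sub>R sgn (gq T')) + cq T' = (gq T' \<bullet> z + cq T') + \<rho> * norm (gq T')"
      by (simp add: inner_add_right ng)
    then have gn: "\<rho> * norm (gq T') \<le> 2 * (K * W)" using p0 p1 by linarith
    have zT: "z \<in> T'" using z h' \<sigma> by (auto simp: subset_iff)
    have "norm (x - z) \<le> ?h" using diameter_bounded_bound[OF elem(2)[OF pe(1)] xT zT] by (simp add: dist_norm)
    also have "?h = 8 * \<sigma> * \<rho>" using \<sigma> by (simp add: \<rho>_def)
    finally have "norm (gq T') * norm (x - z) \<le> norm (gq T') * (8 * \<sigma> * \<rho>)" by (intro mult_left_mono) auto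
    also have "\<dots> = 8 * \<sigma> * (\<rho> * norm (gq T'))" by simp
    also have "\<dots> \<le> 8 * \<sigma> * (2 * (K * W))" using gn \<sigma> by (intro mult_left_mono) auto
    finally have gx: "norm (gq T') * norm (x - z) \<le> 16 * \<sigma> * (K * W)" by simp
    have "gq T' \<bullet> x + cq T' = (gq T' \<bullet> z + cq T') + gq T' \<bullet> (x - z)" by (simp add: inner_diff_right)
    then have "\<bar>gq T' \<bullet> x + cq T'\<bar> \<le> K * W + 16 * \<sigma> * (K * W)"
      using p0 gx Cauchy_Schwarz_ineq2[of "gq T'" "x - z"] by linarith
    also have "\<dots> = elem_const ?d \<sigma> * W" unfolding elem_const_def K_def[symmetric] by (simp add: algebra_simps)
    finally show ?thesis by (simp add: W_def h_def)
  qed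
  show "\<bar>jump \<T> Y e\<bar> \<le> jump_const ?d \<sigma> * diameter T * (\<Phi> + A / (diameter T)\<^sup>2)" if e: "e \<in> sides \<T> T" for e
  proof -
    obtain Tp Tm x0 g c s where p: "Tp \<in> patch \<T> T" "Tm \<in> patch \<T> T" and s: "s = 1 \<or> s = - 1"
      and sub: "cball x0 (h / (512 * \<sigma> ^ 4)) \<subseteq> Tp \<union> Tm"
      and Yx: "\<And>x. x \<in> cball x0 (h / (512 * \<sigma> ^ 4)) \<Longrightarrow> Y x = g \<bullet> x + c + s / 2 * jump \<T> Y e * \<bar>side_normal e \<bullet> (x - x0)\<bar>"
      unfolding h_def by (rule Vh_near_side[OF T e Y]) blast
    have ad: "aff_dim e = int ?d - 1" using e by (auto simp: sides_def)
    define C1 where "C1 = elem_const ?d \<sigma>"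
    have C10: "0 \<le> C1" unfolding C1_def by (rule elem_const_nonneg[OF \<sigma>])
    define m where "m = 1024 * \<sigma> ^ 4"
    have s4: "1 \<le> \<sigma> ^ 4" using \<sigma> by (rule one_le_power)
    have m: "m \<ge> 1" using s4 by (simp add: m_def)
    \<comment> \<open>Half of the radius in \<open>Vh_near_side\<close>: the closed ball then lies
      in an open ball contained in the closure of \<Omega>, hence in \<Omega>.\<close>
    define r where "r = h / m"
    have r: "r > 0" "r \<le> h" using h m by (auto simp: r_def field_simps)
    have rk: "r < h / (512 * \<sigma> ^ 4)" using h s4 unfolding r_def m_def by (intro divide_strict_left_mono) auto
    let ?B = "cball x0 r"
    have Bk: "?B \<subseteq> ball x0 (h / (512 * \<sigma> ^ 4))" using rk by auto
    have pT: "Tp \<in> \<T>" "Tm \<in> \<T>" using patch_elem(1)[OF T] p by auto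
    have "ball x0 (h / (512 * \<sigma> ^ 4)) \<subseteq> closure \<Omega>"
      using subset_trans[OF ball_subset_cball sub] elem(4)[OF pT(1)] elem(4)[OF pT(2)] by blast
    then have "ball x0 (h / (512 * \<sigma> ^ 4)) \<subseteq> \<Omega>" by (rule open_subset_domain[OF open_ball])
    then have B\<Omega>: "?B \<subseteq> \<Omega>" using Bk by blast
    have BT: "?B \<subseteq> Tp \<union> Tm" using Bk ball_subset_cball sub by blast
    then have BN: "?B \<subseteq> \<Union>(patch \<T> T)" using p by blast
    have Bs: "?B \<in> sets lebesgue" by simp
    have fi: "integrable (lebesgue_on ?B) f"
      by (rule integrable_lebesgue_on_subset[OF L2fun_integrable[OF f \<Omega>(2) sets_domain] B\<Omega> Bs sets_domain])
    have piece: "(LINT x|lebesgue_on (?B \<inter> T'). \<bar>f x\<bar>) \<le> (\<Phi> + C1 * W * ?v) * h ^ ?d" if T': "T' \<in> patch \<T> T" for T'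
    proof -
      have Ts: "T' \<in> sets lebesgue" by (rule elem(7)[OF patch_elem(1)[OF T T']])
      have Xs: "?B \<inter> T' \<in> sets lebesgue" using Bs Ts by (rule sets.Int)
      have Xm: "?B \<inter> T' \<in> lmeasurable" using Xs by (intro bounded_set_imp_lmeasurable) (auto intro: bounded_Int)
      have fX: "integrable (lebesgue_on (?B \<inter> T')) f" by (rule integrable_lebesgue_on_subset[OF fi _ Xs Bs]) auto
      have aX: "integrable (lebesgue_on (?B \<inter> T')) (\<lambda>x. gq T' \<bullet> x + cq T')"
        by (rule integrable_continuous_lebesgue_on[OF _ _ Xs]) (auto intro!: continuous_intros bounded_Int)
      interpret X: finite_measure "lebesgue_on (?B \<inter> T')" by (rule finite_measure_lebesgue_on[OF Xm])
      have "(LINT x|lebesgue_on (?B \<inter> T'). \<bar>f x\<bar>) \<le> (LINT x|lebesgue_on (?B \<inter> T'). \<bar>f x - (gq T' \<bullet> x + cq T')\<bar> + C1 * W)"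
      proof (rule integral_mono)
        fix x assume "x \<in> space (lebesgue_on (?B \<inter> T'))"
        then have "\<bar>gq T' \<bullet> x + cq T'\<bar> \<le> C1 * W" using E[OF T', of x] by (simp add: C1_def W_def h_def)
        then show "\<bar>f x\<bar> \<le> \<bar>f x - (gq T' \<bullet> x + cq T')\<bar> + C1 * W" by linarith
      qed (use fX aX in auto)
      also have "\<dots> = (LINT x|lebesgue_on (?B \<inter> T'). \<bar>f x - (gq T' \<bullet> x + cq T')\<bar>) + C1 * W * measure lebesgue (?B \<inter> T')"
        using fX aX Xs by (subst Bochner_Integration.integral_add) (auto simp: measure_restrict_space mult_ac)
      also have "\<dots> \<le> \<Phi> * h ^ ?d + C1 * W * (?v * h ^ ?d)"
      proof (intro add_mono mult_left_mono)
        show "(LINT x|lebesgue_on (?B \<inter> T'). \<bar>f x - (gq T' \<bullet> x + cq T')\<bar>) \<le> \<Phi> * h ^ ?d"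
          using hF[OF T' r(1) _ B\<Omega>] r(2) by (simp add: h_def)
        have "measure lebesgue (?B \<inter> T') \<le> measure lebesgue ?B"
          by (rule measure_mono_fmeasurable) (use Xs in auto)
        also have "\<dots> \<le> ?v * h ^ ?d" by (rule vh[OF r])
        finally show "measure lebesgue (?B \<inter> T') \<le> ?v * h ^ ?d" .
      qed (use C10 W0 in auto)
      finally show ?thesis by (simp add: algebra_simps)
    qed
    have "(LINT x|lebesgue_on ?B. \<bar>f x\<bar>) \<le> (LINT x|lebesgue_on (?B \<inter> Tp). \<bar>f x\<bar>) + (LINT x|lebesgue_on (?B \<inter> Tm). \<bar>f x\<bar>)"
      by (rule integral_le_cover[OF _ _ Bs elem(7)[OF pT(1)] elem(7)[OF pT(2)] BT]) (use fi in auto)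
    also have "\<dots> \<le> (\<Phi> + C1 * W * ?v) * h ^ ?d + (\<Phi> + C1 * W * ?v) * h ^ ?d" by (intro add_mono piece p)
    also have "\<dots> = (2 * (\<Phi> + C1 * W * ?v)) * h ^ ?d" by (simp add: algebra_simps)
    finally have F: "(LINT x|lebesgue_on ?B. \<bar>f x\<bar>) \<le> (2 * (\<Phi> + C1 * W * ?v)) * h ^ ?d" .
    have "\<bar>s / 2 * jump \<T> Y e\<bar> * (27 / 64 * ?v / 8 ^ ?d * r ^ ?d / r)
      \<le> (LINT x|lebesgue_on ?B. \<bar>f x\<bar>) + (6 * real ?d + 24) / r\<^sup>2 * (LINT x|lebesgue_on ?B. \<bar>y x - Y x\<bar>)"
      by (rule jump_residual[OF w f sets_domain \<Omega>(2) r(1) B\<Omega> side_normal(1)[OF ad] Yx]) (use Bk ball_subset_cball in blast)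
    also have "\<dots> \<le> (2 * (\<Phi> + C1 * W * ?v)) * h ^ ?d + (6 * real ?d + 24) / r\<^sup>2 * (A * h ^ ?d)"
      using hA[OF r(1) _ B\<Omega> BN] r(2) by (intro add_mono mult_left_mono F) (auto simp: h_def)
    also have "\<dots> \<le> ((2 + 2 * C1 * ?v) + (6 * real ?d + 24) * m\<^sup>2) * (\<Phi> + A / h\<^sup>2) * m ^ ?d * r ^ ?d"
    proof (rule residual_scaling)
      have "\<Phi> \<le> W" using A0 by (simp add: W_def)
      then show "2 * (\<Phi> + C1 * W * ?v) \<le> (2 + 2 * C1 * ?v) * (\<Phi> + A / h\<^sup>2)"
        unfolding W_def[symmetric] by (simp add: algebra_simps)
    qed (use h r m A0 \<Phi>0 C10 W0 in \<open>auto simp: r_def\<close>)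
    finally have "(\<bar>s / 2 * jump \<T> Y e\<bar> * (27 / 64 * ?v / 8 ^ ?d) / r) * r ^ ?d
       \<le> (((2 + 2 * C1 * ?v) + (6 * real ?d + 24) * m\<^sup>2) * W * m ^ ?d) * r ^ ?d"
      unfolding W_def by (simp add: mult_ac)
    then have "\<bar>s / 2 * jump \<T> Y e\<bar> * (27 / 64 * ?v / 8 ^ ?d) / r \<le> ((2 + 2 * C1 * ?v) + (6 * real ?d + 24) * m\<^sup>2) * W * m ^ ?d"
      using r(1) by (simp only: mult_le_cancel_right_pos zero_less_power)
    moreover have "\<bar>s / 2 * jump \<T> Y e\<bar> = \<bar>jump \<T> Y e\<bar> / 2" using s by auto
    ultimately have "\<bar>jump \<T> Y e\<bar> / 2 * (27 / 64 * ?v / 8 ^ ?d) \<le> ((2 + 2 * C1 * ?v) + (6 * real ?d + 24) * m\<^sup>2) * W * m ^ ?d * r"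
      using r(1) by (simp only: pos_divide_le_eq)
    also have "\<dots> \<le> ((2 + 2 * C1 * ?v) + (6 * real ?d + 24) * m\<^sup>2) * W * m ^ ?d * h"
      using r(2) W0 C10 v m by (intro mult_left_mono mult_nonneg_nonneg add_nonneg_nonneg) auto
    finally have "\<bar>jump \<T> Y e\<bar> \<le> 2 * (((2 + 2 * C1 * ?v) + (6 * real ?d + 24) * m\<^sup>2) * W * m ^ ?d * h) / (27 / 64 * ?v / 8 ^ ?d)"
      using v by (subst pos_le_divide_eq) auto
    also have "\<dots> = jump_const ?d \<sigma> * h * W"
      unfolding jump_const_def C1_def[symmetric] m_def[symmetric] by (simp add: mult_ac add_ac)
    finally show ?thesis by (simp add: W_def h_def)
  qed
qed

end


section \<open>Efficiency of the error indicators\<close>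

lemma square_sum_le: "(a + b)\<^sup>2 \<le> 2 * a\<^sup>2 + 2 * b\<^sup>2" for a b :: real
  using zero_le_power2[of "a - b"] by (simp add: power2_sum power2_diff)

lemma square_sum3_le: "(a + b + c)\<^sup>2 \<le> 3 * (a\<^sup>2 + b\<^sup>2 + c\<^sup>2)" for a b c :: real
proof -
  have "0 \<le> (a - b)\<^sup>2 + (b - c)\<^sup>2 + (a - c)\<^sup>2" by simp
  then show ?thesis by (simp add: power2_eq_square algebra_simps)
qed

context regular_mesh
begin

lemma L2fun_closure_subset:
  assumes "L2fun \<Omega> g" and S: "S \<subseteq> closure \<Omega>" "S \<in> sets lebesgue"
  shows "L2fun S g"
proof -
  have "integrable (lebesgue_on S) g"
    by (rule integrable_on_closure_subset[OF L2fun_integrable[OF assms(1) \<Omega>(2) sets_domain] S])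
  moreover have "integrable (lebesgue_on S) (\<lambda>x. (g x)\<^sup>2)"
    by (rule integrable_on_closure_subset[OF _ S]) (use assms(1) in \<open>simp add: L2fun_def\<close>)
  ultimately show ?thesis by (auto simp: L2fun_def)
qed

lemma patch_union:
  assumes T: "T \<in> \<T>"
  shows "\<Union>(patch \<T> T) \<subseteq> closure \<Omega>" "\<Union>(patch \<T> T) \<in> sets lebesgue" "T \<in> patch \<T> T" "finite (patch \<T> T)"
proof -
  have sub: "patch \<T> T \<subseteq> \<T>" using patch_elem(1)[OF T] by blast
  show fin: "finite (patch \<T> T)" using sub tr by (auto simp: triangulation_def intro: finite_subset)
  show "T \<in> patch \<T> T" by (simp add: patch_def)
  show "\<Union>(patch \<T> T) \<subseteq> closure \<Omega>" using sub elem(4) by blast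
  show "\<Union>(patch \<T> T) \<in> sets lebesgue" using sub elem(7) fin by (intro sets.finite_Union) auto
qed

lemma diameter_elem_le:
  assumes "T \<in> \<T>"
  shows "diameter T \<le> diameter (closure \<Omega>)"
  by (rule diameter_subset[OF elem(4)[OF assms] bounded_closure[OF \<Omega>(2)]])

text \<open>\<open>F\<close> is split into its oscillation around the affine data and the data
  themselves, which are bounded pointwise; the measure of \<open>T\<close> is at most that of a ball
  of radius diam T.\<close>

lemma residual_indicator_le:
  assumes T: "T \<in> \<T>" and F: "L2fun T F" and W0: "0 \<le> W"
    and q: "\<And>x. x \<in> T \<Longrightarrow> \<bar>gq \<bullet> x + cq\<bar> \<le> elem_const DIM('a) \<sigma> * W"
  shows "(L2norm T F)\<^sup>2 \<le> 2 * (L2norm T (\<lambda>x. F x - (gq \<bullet> x + cq)))\<^sup>2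
     + 2 * (elem_const DIM('a) \<sigma>)\<^sup>2 * unit_ball_vol DIM('a) * (diameter T ^ DIM('a) * W\<^sup>2)"
proof -
  let ?C = "elem_const DIM('a) \<sigma>" and ?M = "lebesgue_on T" and ?q = "\<lambda>x. gq \<bullet> x + cq"
  have Ts: "T \<in> sets lebesgue" "bounded T" using elem[OF T] by auto
  have Tm: "T \<in> lmeasurable" using Ts by (intro bounded_set_imp_lmeasurable)
  interpret finite_measure ?M by (rule finite_measure_lebesgue_on[OF Tm])
  have q2: "L2fun T ?q" using Ts by (intro L2fun_continuous) (auto intro!: continuous_intros)
  have d2: "L2fun T (\<lambda>x. F x - ?q x)" by (rule L2fun_diff[OF F q2])
  have "(LINT x|?M. (F x)\<^sup>2) \<le> (LINT x|?M. 2 * (F x - ?q x)\<^sup>2 + 2 * (?C * W)\<^sup>2)"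
  proof (rule integral_mono)
    fix x assume "x \<in> space ?M"
    then have "\<bar>?q x\<bar> \<le> ?C * W" using q by simp
    then have "(?q x)\<^sup>2 \<le> (?C * W)\<^sup>2" using power_mono[of "\<bar>?q x\<bar>" "?C * W" 2] by simp
    then show "(F x)\<^sup>2 \<le> 2 * (F x - ?q x)\<^sup>2 + 2 * (?C * W)\<^sup>2" using square_sum_le[of "F x - ?q x" "?q x"] by simp
  qed (use F d2 in \<open>auto simp: L2fun_def\<close>)
  also have "\<dots> = 2 * (LINT x|?M. (F x - ?q x)\<^sup>2) + 2 * (?C * W)\<^sup>2 * measure lebesgue T"
    using d2 Ts by (subst Bochner_Integration.integral_add) (auto simp: L2fun_def measure_restrict_space)
  also have "\<dots> \<le> 2 * (LINT x|?M. (F x - ?q x)\<^sup>2) + 2 * (?C * W)\<^sup>2 * (unit_ball_vol DIM('a) * diameter T ^ DIM('a))"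
  proof (intro add_left_mono mult_left_mono)
    obtain x where x: "x \<in> T" using elem(3)[OF T] by (cases "T = {}") auto
    have "T \<subseteq> cball x (diameter T)" using diameter_bounded_bound[OF Ts(2) x] by auto
    then have "measure lebesgue T \<le> measure lebesgue (cball x (diameter T))"
      by (rule measure_mono_fmeasurable) (use Ts in auto)
    also have "\<dots> = unit_ball_vol DIM('a) * diameter T ^ DIM('a)" using elem(3)[OF T] by (simp add: content_cball)
    finally show "measure lebesgue T \<le> unit_ball_vol DIM('a) * diameter T ^ DIM('a)" .
  qed simp
  finally show ?thesis unfolding L2norm_square by (simp add: power_mult_distrib mult_ac)
qed

text \<open>The constant of \<open>side_measure_le\<close> with every element diameter bounded by
  that of the closed domain; it depends on \<Omega> alone.\<close>

definition side_const where
  "side_const = (1 + 2 * diameter (closure \<Omega>)) * (unit_ball_vol DIM('a) * 2 ^ DIM('a))"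

lemma side_const_nonneg: "0 \<le> side_const"
  using diameter_ge_0[OF bounded_closure[OF \<Omega>(2)]] by (simp add: side_const_def)

text \<open>Power count: h^3 (h W)^2 h^(d-1) = h^4 h^d W^2, for at most d + 1 sides.\<close>

lemma jump_indicator_le:
  assumes T: "T \<in> \<T>" and W0: "0 \<le> W"
    and J: "\<And>e. e \<in> sides \<T> T \<Longrightarrow> \<bar>jump \<T> Y e\<bar> \<le> jump_const DIM('a) \<sigma> * diameter T * W"
  shows "(\<Sum>e\<in>sides \<T> T. diameter T ^ 3 * ((jump \<T> Y e)\<^sup>2 * side_measure e))
     \<le> real (DIM('a) + 1) * ((jump_const DIM('a) \<sigma>)\<^sup>2 * side_const) * (diameter T ^ 4 * (diameter T ^ DIM('a) * W\<^sup>2))"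
proof -
  let ?h = "diameter T" and ?C = "jump_const DIM('a) \<sigma>"
  have h: "?h > 0" by (rule elem(3)[OF T])
  let ?X = "(?C\<^sup>2 * side_const) * (?h ^ 4 * (?h ^ DIM('a) * W\<^sup>2))"
  have X0: "0 \<le> ?X" using side_const_nonneg h by simp
  have one: "?h ^ 3 * ((jump \<T> Y e)\<^sup>2 * side_measure e) \<le> ?X" if e: "e \<in> sides \<T> T" for e
  proof -
    have ad: "aff_dim e = int DIM('a) - 1" using e by (auto simp: sides_def)
    obtain x0 where x0: "x0 \<in> e" using ad by fastforce
    have eT: "e \<subseteq> T" using e by (auto simp: sides_def)
    have "e \<subseteq> cball x0 ?h" unfolding subset_iff mem_cball using diameter_bounded_bound[OF elem(2)[OF T]] eT x0 by blast
    from side_measure_le[OF ad this h diameter_elem_le[OF T]]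
    have sm: "side_measure e \<le> side_const * ?h ^ DIM('a) / ?h" unfolding side_const_def .
    have sm0: "0 \<le> side_measure e" by (simp add: side_measure_def)
    have "(jump \<T> Y e)\<^sup>2 \<le> (?C * ?h * W)\<^sup>2" using power_mono[OF J[OF e], of 2] by simp
    then have "?h ^ 3 * ((jump \<T> Y e)\<^sup>2 * side_measure e) \<le> ?h ^ 3 * ((?C * ?h * W)\<^sup>2 * (side_const * ?h ^ DIM('a) / ?h))"
      using h sm sm0 by (intro mult_left_mono mult_mono) auto
    also have "\<dots> = ?X" using h by (simp add: power_mult_distrib power3_eq_cube power4_eq_xxxx power2_eq_square)
    finally show ?thesis .
  qed
  have "(\<Sum>e\<in>sides \<T> T. ?h ^ 3 * ((jump \<T> Y e)\<^sup>2 * side_measure e)) \<le> real (card (sides \<T> T)) * ?X"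
    using sum_bounded_above[of "sides \<T> T", OF one] by simp
  also have "\<dots> \<le> real (DIM('a) + 1) * ?X"
    using card_sides_le(2)[OF tr T] X0 by (intro mult_right_mono) auto
  finally show ?thesis by (simp only: mult.assoc)
qed

lemma jump_max_le:
  assumes T: "T \<in> \<T>" and W0: "0 \<le> W"
    and J: "\<And>e. e \<in> sides \<T> T \<Longrightarrow> \<bar>jump \<T> Y e\<bar> \<le> jump_const DIM('a) \<sigma> * diameter T * W"
  shows "(diameter T * Max (insert 0 ((\<lambda>e. \<bar>jump \<T> Y e\<bar>) ` sides \<T> T)))\<^sup>2 \<le> (jump_const DIM('a) \<sigma>)\<^sup>2 * (diameter T ^ 4 * W\<^sup>2)"
proof -
  let ?h = "diameter T" and ?C = "jump_const DIM('a) \<sigma>" and ?X = "insert 0 ((\<lambda>e. \<bar>jump \<T> Y e\<bar>) ` sides \<T> T)"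
  have h: "?h > 0" by (rule elem(3)[OF T])
  have f: "finite ?X" using card_sides_le(1)[OF tr T] by simp
  have "0 \<le> ?C * ?h * W" using jump_const_nonneg[OF \<sigma>] h W0 by simp
  then have "Max ?X \<le> ?C * ?h * W" using f J by (subst Max_le_iff) auto
  moreover have "0 \<le> Max ?X" using f by (rule Max_ge) simp
  ultimately have "(?h * Max ?X)\<^sup>2 \<le> (?h * (?C * ?h * W))\<^sup>2" using h by (intro power_mono mult_left_mono) auto
  also have "\<dots> = ?C\<^sup>2 * (?h ^ 4 * W\<^sup>2)" by (simp add: power_mult_distrib power4_eq_xxxx power2_eq_square)
  finally show ?thesis .
qed

text \<open>The root of the summed squares dominates each element's oscillation and turns into the
  oscillation sum of the claim when squared.\<close>

definition patch_osc where
  "patch_osc T g = sqrt (\<Sum>T'\<in>patch \<T> T. (L2norm T' (\<lambda>x. g x - avg T' g))\<^sup>2)"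

lemma osc_le_patch_osc:
  assumes T: "T \<in> \<T>" and T': "T' \<in> patch \<T> T"
  shows "L2norm T' (\<lambda>x. g x - avg T' g) \<le> patch_osc T g"
proof -
  have "(L2norm T' (\<lambda>x. g x - avg T' g))\<^sup>2 \<le> (\<Sum>T'\<in>patch \<T> T. (L2norm T' (\<lambda>x. g x - avg T' g))\<^sup>2)"
    using patch_union(4)[OF T] T' by (intro member_le_sum) auto
  then show ?thesis unfolding patch_osc_def by (rule real_le_rsqrt)
qed

lemma ball_measure_le:
  fixes x :: 'a
  assumes "0 < r" "r \<le> h"
  shows "measure lebesgue (cball x r) \<le> unit_ball_vol DIM('a) * h ^ DIM('a)"
  using assms by (simp add: content_cball power_mono)

lemma ball_inter_elem:
  assumes "T' \<in> \<T>" "0 < r" "r \<le> h"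
  shows "cball x r \<inter> T' \<in> lmeasurable" "measure lebesgue (cball x r \<inter> T') \<le> unit_ball_vol DIM('a) * h ^ DIM('a)"
proof -
  have s: "cball x r \<inter> T' \<in> sets lebesgue" using elem(7)[OF assms(1)] by (intro sets.Int) auto
  then show "cball x r \<inter> T' \<in> lmeasurable" by (intro bounded_set_imp_lmeasurable) (auto intro: bounded_Int)
  have "measure lebesgue (cball x r \<inter> T') \<le> measure lebesgue (cball x r)"
    by (rule measure_mono_fmeasurable) (use s in auto)
  also have "\<dots> \<le> unit_ball_vol DIM('a) * h ^ DIM('a)" by (rule ball_measure_le[OF assms(2,3)])
  finally show "measure lebesgue (cball x r \<inter> T') \<le> unit_ball_vol DIM('a) * h ^ DIM('a)" .
qed

text \<open>Splits off from the Cauchy-Schwarz factor of a ball the power h^d that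
  \<open>local_bounds\<close> expects.\<close>

lemma sqrt_volume_scaling:
  "h > 0 \<Longrightarrow> sqrt (unit_ball_vol DIM('a) * h ^ DIM('a)) = sqrt (unit_ball_vol DIM('a) / h ^ DIM('a)) * h ^ DIM('a)"
proof -
  assume h: "h > 0"
  have "unit_ball_vol DIM('a) * h ^ DIM('a) = (unit_ball_vol DIM('a) / h ^ DIM('a)) * (h ^ DIM('a))\<^sup>2"
    using h by (simp add: power2_eq_square)
  then show ?thesis using h by (simp only: real_sqrt_mult real_sqrt_abs) simp
qed

text \<open>The affine data on each element are the constant mean of the control. The control error
  is kept in L1; the oscillation and the state error pass from L2 to L1 by Cauchy-Schwarz.
  \<open>H\<close> is h^(4-d), here given through its product with h^d.\<close>

lemma state_estimate:
  assumes T: "T \<in> \<T>" and w: "weak_sol \<Omega> u y" and u: "L2fun \<Omega> u" and ul: "L2fun \<Omega> ul" and yl: "yl \<in> Vh \<Omega> \<T>"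
    and h: "h = diameter T" and V: "V = unit_ball_vol DIM('a)" and N: "N = \<Union>(patch \<T> T)"
    and H: "H * h ^ DIM('a) = h ^ 4"
    and B: "B = 2 * (elem_const DIM('a) \<sigma>)\<^sup>2 * V + real (DIM('a) + 1) * ((jump_const DIM('a) \<sigma>)\<^sup>2 * side_const)"
  shows "E_st2 \<T> ul yl T \<le> 2 * h ^ 4 * (patch_osc T ul)\<^sup>2
     + B * (3 * (H * (L1norm N (\<lambda>x. u x - ul x))\<^sup>2 + V * (h ^ 4 * (patch_osc T ul)\<^sup>2) + V * (L2norm N (\<lambda>x. y x - yl x))\<^sup>2))"
proof -
  let ?d = "DIM('a)"
  define L where "L = L1norm N (\<lambda>x. u x - ul x)"
  define O1 where "O1 = patch_osc T ul"
  define Yn where "Yn = L2norm N (\<lambda>x. y x - yl x)"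
  define A where "A = sqrt (V / h ^ ?d) * Yn"
  define \<Phi> where "\<Phi> = L / h ^ ?d + sqrt (V / h ^ ?d) * O1"
  define W where "W = \<Phi> + A / h\<^sup>2"
  note hp = elem(3)[OF T, folded h]
  have Vp: "V > 0" by (simp add: V)
  have N': "N \<subseteq> closure \<Omega>" "N \<in> sets lebesgue" using patch_union[OF T] by (auto simp: N)
  have Nb: "bounded N" by (rule bounded_subset[OF bounded_closure[OF \<Omega>(2)] N'(1)])
  have sv: "sqrt (V * h ^ ?d) = sqrt (V / h ^ ?d) * h ^ ?d" using sqrt_volume_scaling[OF hp] by (simp add: V)
  have L0: "0 \<le> L" by (simp add: L_def L1norm_def)
  have O0: "0 \<le> O1" by (simp add: O1_def patch_osc_def sum_nonneg)
  have Y0: "0 \<le> Yn" by (simp add: Yn_def L2norm_nonneg)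
  have A0: "0 \<le> A" using Y0 Vp hp by (simp add: A_def)
  have P0: "0 \<le> \<Phi>" using L0 O0 Vp hp by (simp add: \<Phi>_def)
  have W0: "0 \<le> W" using A0 P0 by (simp add: W_def)
  have yL: "L2fun \<Omega> y" using w by (auto simp: weak_sol_def H10_def)
  have ylL: "L2fun \<Omega> yl" using yl \<Omega>(2) sets_domain by (intro L2fun_continuous) (auto simp: Vh_def)
  have yyN: "L2fun N (\<lambda>x. y x - yl x)" by (rule L2fun_closure_subset[OF L2fun_diff[OF yL ylL] N'])
  have uuN: "integrable (lebesgue_on N) (\<lambda>x. u x - ul x)"
    by (rule L2fun_integrable[OF L2fun_closure_subset[OF L2fun_diff[OF u ul] N'] Nb N'(2)])
  have hA: "(LINT x|lebesgue_on (cball x r). \<bar>y x - yl x\<bar>) \<le> A * h ^ ?d"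
    if "0 < r" "r \<le> h" "cball x r \<subseteq> N" for x r
  proof -
    have "(LINT x|lebesgue_on (cball x r). \<bar>y x - yl x\<bar>) \<le> sqrt (V * h ^ ?d) * Yn"
      unfolding Yn_def by (rule L1_le_L2norm(2)[OF yyN that(3) _ N'(2)]) (use ball_measure_le[OF that(1,2)] in \<open>auto simp: V\<close>)
    then show ?thesis unfolding sv A_def by (simp add: mult_ac)
  qed
  have hF: "(LINT x|lebesgue_on (cball x r \<inter> T'). \<bar>u x - (0 \<bullet> x + avg T' ul)\<bar>) \<le> \<Phi> * h ^ ?d"
    if T': "T' \<in> patch \<T> T" and r: "0 < r" "r \<le> h" for T' x r
  proof -
    have T'T: "T' \<in> \<T>" by (rule patch_elem(1)[OF T T'])
    let ?X = "cball x r \<inter> T'"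
    have Xm: "?X \<in> lmeasurable" "measure lebesgue ?X \<le> V * h ^ ?d" using ball_inter_elem[OF T'T r] by (auto simp: V)
    have Xs: "?X \<in> sets lebesgue" using Xm(1) by (rule fmeasurableD)
    have XN: "?X \<subseteq> N" using T' by (auto simp: N)
    have oL: "L2fun T' (\<lambda>x. ul x - avg T' ul)"
      using elem[OF T'T] by (intro L2fun_diff L2fun_closure_subset[OF ul] L2fun_continuous) (auto intro: continuous_on_const)
    note o = L1_le_L2norm[OF oL Int_lower2 Xm(1) elem(7)[OF T'T] Xm(2)]
    have ui: "integrable (lebesgue_on ?X) (\<lambda>x. u x - ul x)" by (rule integrable_lebesgue_on_subset[OF uuN XN Xs N'(2)])
    have su: "integrable (lebesgue_on ?X) (\<lambda>x. (u x - ul x) + (ul x - avg T' ul))" using ui o(1) by (rule Bochner_Integration.integrable_add)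
    have "(LINT x|lebesgue_on ?X. \<bar>u x - (0 \<bullet> x + avg T' ul)\<bar>) \<le> (LINT x|lebesgue_on ?X. \<bar>u x - ul x\<bar> + \<bar>ul x - avg T' ul\<bar>)"
      using su ui o(1) by (intro integral_mono) auto
    also have "\<dots> = (LINT x|lebesgue_on ?X. \<bar>u x - ul x\<bar>) + (LINT x|lebesgue_on ?X. \<bar>ul x - avg T' ul\<bar>)"
      using ui o(1) by (intro Bochner_Integration.integral_add) auto
    also have "\<dots> \<le> L + sqrt (V * h ^ ?d) * O1"
    proof (rule add_mono)
      show "(LINT x|lebesgue_on ?X. \<bar>u x - ul x\<bar>) \<le> L"
        unfolding L_def L1norm_def by (rule integral_lebesgue_on_mono_set[OF XN Xs N'(2)]) (use uuN in auto)
      have "sqrt (V * h ^ ?d) * L2norm T' (\<lambda>x. ul x - avg T' ul) \<le> sqrt (V * h ^ ?d) * O1"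
        unfolding O1_def using Vp hp by (intro mult_left_mono osc_le_patch_osc[OF T T']) auto
      then show "(LINT x|lebesgue_on ?X. \<bar>ul x - avg T' ul\<bar>) \<le> sqrt (V * h ^ ?d) * O1" using o(2) by linarith
    qed
    also have "\<dots> = \<Phi> * h ^ ?d" unfolding sv \<Phi>_def using hp by (simp add: field_simps)
    finally show ?thesis .
  qed
  have lb1: "\<bar>0 \<bullet> x + avg T' ul\<bar> \<le> elem_const ?d \<sigma> * W" if "T' \<in> patch \<T> T" "x \<in> T'" for T' x
    unfolding W_def h by (rule local_bounds(1)[OF T w u yl A0 P0 _ _ that]; (rule hA[unfolded h N] | rule hF[unfolded h N]); assumption)
  have lb2: "\<bar>jump \<T> yl e\<bar> \<le> jump_const ?d \<sigma> * diameter T * W" if "e \<in> sides \<T> T" for e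
    unfolding W_def h by (rule local_bounds(2)[OF T w u yl A0 P0 _ _ that]; (rule hA[unfolded h N] | rule hF[unfolded h N]); assumption)
  have ulT: "L2fun T ul" by (rule L2fun_closure_subset[OF ul elem(4)[OF T] elem(7)[OF T]])
  have R1: "(L2norm T ul)\<^sup>2 \<le> 2 * (L2norm T (\<lambda>x. ul x - (0 \<bullet> x + avg T ul)))\<^sup>2 + 2 * (elem_const ?d \<sigma>)\<^sup>2 * V * (h ^ ?d * W\<^sup>2)"
    unfolding V h by (rule residual_indicator_le[OF T ulT W0]) (rule lb1[OF patch_union(3)[OF T]])
  have R2: "(L2norm T (\<lambda>x. ul x - (0 \<bullet> x + avg T ul)))\<^sup>2 \<le> O1\<^sup>2"
    using osc_le_patch_osc[OF T patch_union(3)[OF T], of ul] L2norm_nonneg unfolding O1_def by (intro power_mono) auto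
  have "h ^ 4 * (L2norm T ul)\<^sup>2 \<le> h ^ 4 * (2 * O1\<^sup>2 + 2 * (elem_const ?d \<sigma>)\<^sup>2 * V * (h ^ ?d * W\<^sup>2))"
  proof (rule mult_left_mono)
    show "(L2norm T ul)\<^sup>2 \<le> 2 * O1\<^sup>2 + 2 * (elem_const ?d \<sigma>)\<^sup>2 * V * (h ^ ?d * W\<^sup>2)" using R1 R2 by linarith
  qed (use hp in simp)
  moreover have "(\<Sum>e\<in>sides \<T> T. h ^ 3 * ((jump \<T> yl e)\<^sup>2 * side_measure e))
      \<le> real (?d + 1) * ((jump_const ?d \<sigma>)\<^sup>2 * side_const) * (h ^ 4 * (h ^ ?d * W\<^sup>2))"
    unfolding h by (rule jump_indicator_le[OF T W0]) (rule lb2)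
  ultimately have R3: "E_st2 \<T> ul yl T \<le> 2 * h ^ 4 * O1\<^sup>2 + B * (h ^ 4 * (h ^ ?d * W\<^sup>2))"
    unfolding E_st2_def h[symmetric] B by (simp add: algebra_simps)
  have R4: "B * (h ^ 4 * (h ^ ?d * W\<^sup>2)) \<le> B * (3 * (H * L\<^sup>2 + V * (h ^ 4 * O1\<^sup>2) + V * Yn\<^sup>2))"
  proof (rule mult_left_mono)
    show "0 \<le> B" unfolding B using Vp side_const_nonneg by simp
    have hd: "h ^ ?d > 0" using hp by simp
    have sq: "(sqrt (V / h ^ ?d))\<^sup>2 = V / h ^ ?d" using Vp hp by (intro real_sqrt_pow2) simp
    have h22: "(h\<^sup>2)\<^sup>2 = h ^ 4" by (simp flip: power_mult)
    \<comment> \<open>The three parts of W, squared and multiplied by h^4 h^d, become h^(4-d) times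
      the squared control error, h^4 times the squared oscillation, and the squared state error
      without any power of h.\<close>
    have "W\<^sup>2 \<le> 3 * ((L / h ^ ?d)\<^sup>2 + (sqrt (V / h ^ ?d) * O1)\<^sup>2 + (A / h\<^sup>2)\<^sup>2)"
      unfolding W_def \<Phi>_def by (rule square_sum3_le)
    also have "\<dots> = 3 * (L\<^sup>2 / (h ^ ?d)\<^sup>2 + V / h ^ ?d * O1\<^sup>2 + V / h ^ ?d * Yn\<^sup>2 / h ^ 4)"
      unfolding A_def power_mult_distrib power_divide sq h22 ..
    finally have "h ^ 4 * (h ^ ?d * W\<^sup>2) \<le> h ^ 4 * (h ^ ?d * (3 * (L\<^sup>2 / (h ^ ?d)\<^sup>2 + V / h ^ ?d * O1\<^sup>2 + V / h ^ ?d * Yn\<^sup>2 / h ^ 4)))"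
      using hp by (intro mult_left_mono) auto
    also have "\<dots> = 3 * (H * L\<^sup>2 + V * (h ^ 4 * O1\<^sup>2) + V * Yn\<^sup>2)"
    proof -
      define D where "D = h ^ ?d"
      have D: "D > 0" "h ^ 4 = H * D" using hd H by (auto simp: D_def)
      have h4: "h ^ 4 > 0" using hp by simp
      have "h ^ 4 * (D * (3 * (L\<^sup>2 / D\<^sup>2 + V / D * O1\<^sup>2 + V / D * Yn\<^sup>2 / h ^ 4)))
          = 3 * (h ^ 4 / D * L\<^sup>2 + V * (h ^ 4 * O1\<^sup>2) + V * Yn\<^sup>2)"
        using D(1) h4 by (simp add: field_simps power2_eq_square)
      also have "h ^ 4 / D = H" using D by simp
      finally show ?thesis by (simp only: D_def)
    qed
    finally show "h ^ 4 * (h ^ ?d * W\<^sup>2) \<le> 3 * (H * L\<^sup>2 + V * (h ^ 4 * O1\<^sup>2) + V * Yn\<^sup>2)" .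
  qed
  from order_trans[OF R3 add_left_mono[OF R4]] show ?thesis unfolding O1_def L_def Yn_def .
qed

text \<open>The data are y - z; their affine part on an element is \<open>yl\<close> minus the mean
  of \<open>z\<close>, so the deviation consists of the state error and the oscillation of
  \<open>z\<close>. Both parts rest on one bound for h^4 W^2: the L2-type indicator carries an
  additional h^d, the maximum-type one does not.\<close>

lemma adjoint_estimate:
  assumes d23: "DIM('a) = 2 \<or> DIM('a) = 3"
    and T: "T \<in> \<T>" and w: "weak_sol \<Omega> (\<lambda>x. y x - z x) p" and y: "L2fun \<Omega> y" and z: "L2fun \<Omega> z"
    and yl: "yl \<in> Vh \<Omega> \<T>" and pl: "pl \<in> Vh \<Omega> \<T>"
    and h: "h = diameter T" and V: "V = unit_ball_vol DIM('a)" and N: "N = \<Union>(patch \<T> T)"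
    and H: "H = h powr (4 - real DIM('a))" "H * h ^ DIM('a) = h ^ 4"
    and B: "B = 2 * (elem_const DIM('a) \<sigma>)\<^sup>2 * V + real (DIM('a) + 1) * ((jump_const DIM('a) \<sigma>)\<^sup>2 * side_const)"
    and B2: "B2 = 4 * (elem_const DIM('a) \<sigma>)\<^sup>2 * V + 2 * (jump_const DIM('a) \<sigma>)\<^sup>2"
    and Yn: "Yn = L2norm N (\<lambda>x. y x - yl x)" and Li: "Li = Linfnorm N (\<lambda>x. p x - pl x)"
  shows "E_adj2 \<T> z yl pl T \<le> 2 * h ^ 4 * (patch_osc T z)\<^sup>2
     + B * (4 * V * (h ^ 4 * (Yn\<^sup>2 + (patch_osc T z)\<^sup>2)) + 2 * V\<^sup>2 * (h ^ DIM('a) * Li\<^sup>2))"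
    and "(E_adj_inf \<T> z yl pl T)\<^sup>2 \<le> 4 * H * (patch_osc T z)\<^sup>2
     + B2 * (4 * V * (H * (Yn\<^sup>2 + (patch_osc T z)\<^sup>2)) + 2 * V\<^sup>2 * Li\<^sup>2)"
proof -
  let ?d = "DIM('a)"
  define O1 where "O1 = patch_osc T z"
  note hp = elem(3)[OF T, folded h]
  have hd: "h ^ ?d > 0" using hp by simp
  have Vp: "V > 0" by (simp add: V)
  have N': "N \<subseteq> closure \<Omega>" "N \<in> sets lebesgue" using patch_union[OF T] by (auto simp: N)
  have sv: "sqrt (V * h ^ ?d) = sqrt (V / h ^ ?d) * h ^ ?d" using sqrt_volume_scaling[OF hp] by (simp add: V)
  have O0: "0 \<le> O1" by (simp add: O1_def patch_osc_def sum_nonneg)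
  have Y0: "0 \<le> Yn" by (simp add: Yn L2norm_nonneg)
  have fL: "L2fun \<Omega> (\<lambda>x. y x - z x)" by (rule L2fun_diff[OF y z])
  have ylL: "L2fun \<Omega> yl" using yl \<Omega>(2) sets_domain by (intro L2fun_continuous) (auto simp: Vh_def)
  have plc: "continuous_on UNIV pl" using pl by (auto simp: Vh_def)
  have plL: "L2fun \<Omega> pl" using plc \<Omega>(2) sets_domain by (intro L2fun_continuous)
  have pL: "L2fun \<Omega> p" using w by (auto simp: weak_sol_def H10_def)
  have yyN: "L2fun N (\<lambda>x. y x - yl x)" by (rule L2fun_closure_subset[OF L2fun_diff[OF y ylL] N'])
  have ppN: "L2fun N (\<lambda>x. p x - pl x)" by (rule L2fun_closure_subset[OF L2fun_diff[OF pL plL] N'])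
  \<comment> \<open>Finiteness of the essential supremum follows from that of \<open>p\<close> and
    from continuity of \<open>pl\<close> on the compact closure. The patch may touch the boundary,
    where \<open>p\<close> is uncontrolled; that null set is discarded.\<close>
  have AEp: "AE x in lebesgue_on N. \<bar>p x - pl x\<bar> \<le> Li"
  proof -
    obtain b where b: "AE x in lebesgue_on \<Omega>. \<bar>p x\<bar> \<le> b" using weak_sol_bounded[OF d23 w fL \<Omega>(1,2)] by blast
    have "bounded (pl ` closure \<Omega>)"
      by (intro compact_imp_bounded compact_continuous_image continuous_on_subset[OF plc]) (use \<Omega>(2) in auto)
    then obtain b' where b': "\<And>x. x \<in> closure \<Omega> \<Longrightarrow> norm (pl x) \<le> b'" unfolding bounded_iff by blast
    have "AE x in lebesgue. x \<in> \<Omega> \<longrightarrow> \<bar>p x\<bar> \<le> b" using b sets_domain by (simp add: AE_restrict_space_iff)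
    then have "AE x in lebesgue. x \<in> N \<longrightarrow> ereal \<bar>p x - pl x\<bar> \<le> ereal (b + b')"
      using AE_not_in[OF null_boundary]
    proof eventually_elim
      fix x assume 1: "x \<in> \<Omega> \<longrightarrow> \<bar>p x\<bar> \<le> b" "x \<notin> closure \<Omega> - \<Omega>"
      show "x \<in> N \<longrightarrow> ereal \<bar>p x - pl x\<bar> \<le> ereal (b + b')"
      proof
        assume "x \<in> N"
        then have "x \<in> closure \<Omega>" using N'(1) by blast
        then have "\<bar>p x\<bar> \<le> b" "\<bar>pl x\<bar> \<le> b'" using 1 b'[of x] by auto
        then show "ereal \<bar>p x - pl x\<bar> \<le> ereal (b + b')" by simp
      qed
    qed
    then have "AE x in lebesgue_on N. ereal \<bar>p x - pl x\<bar> \<le> ereal (b + b')"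
      using N'(2) by (simp add: AE_restrict_space_iff)
    moreover have "(\<lambda>x. ereal \<bar>p x - pl x\<bar>) \<in> borel_measurable (lebesgue_on N)"
      using ppN by (intro borel_measurable_ereal borel_measurable_abs) (auto simp: L2fun_def)
    ultimately have fin: "esssup (lebesgue_on N) (\<lambda>x. ereal \<bar>p x - pl x\<bar>) \<le> ereal (b + b')" by (intro esssup_I)
    show ?thesis using esssup_AE[of "\<lambda>x. ereal \<bar>p x - pl x\<bar>" "lebesgue_on N"]
    proof eventually_elim
      fix x assume le: "ereal \<bar>p x - pl x\<bar> \<le> esssup (lebesgue_on N) (\<lambda>x. ereal \<bar>p x - pl x\<bar>)"
      then show "\<bar>p x - pl x\<bar> \<le> Li" using fin unfolding Li Linfnorm_def
        by (cases "esssup (lebesgue_on N) (\<lambda>x. ereal \<bar>p x - pl x\<bar>)") auto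
    qed
  qed
  \<comment> \<open>The absolute value spares a separate proof that \<open>Li\<close> is
    nonnegative.\<close>
  define A where "A = V * \<bar>Li\<bar>"
  define \<Phi> where "\<Phi> = sqrt (V / h ^ ?d) * (Yn + O1)"
  define W where "W = \<Phi> + A / h\<^sup>2"
  have A0: "0 \<le> A" using Vp by (simp add: A_def)
  have P0: "0 \<le> \<Phi>" using Y0 O0 Vp hp by (simp add: \<Phi>_def)
  have W0: "0 \<le> W" using A0 P0 by (simp add: W_def)
  have "\<forall>T'. \<exists>g c. T' \<in> \<T> \<longrightarrow> (\<forall>x\<in>T'. yl x = g \<bullet> x + c)" using yl by (auto simp: Vh_def)
  then obtain gy cy where gy: "\<And>T' x. T' \<in> \<T> \<Longrightarrow> x \<in> T' \<Longrightarrow> yl x = gy T' \<bullet> x + cy T'" by metis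
  define cq where "cq T' = cy T' - avg T' z" for T'
  have hA: "(LINT x|lebesgue_on (cball x r). \<bar>p x - pl x\<bar>) \<le> A * h ^ ?d"
    if r: "0 < r" "r \<le> h" and sub: "cball x r \<subseteq> N" for x r
  proof -
    let ?B = "cball x r"
    have Bs: "?B \<in> sets lebesgue" by simp
    interpret finite_measure "lebesgue_on ?B" by (rule finite_measure_lebesgue_on) simp
    have i: "integrable (lebesgue_on ?B) (\<lambda>x. p x - pl x)"
      by (rule L1_le_L2norm(1)[OF ppN sub _ N'(2) order_refl]) simp
    have "AE x in lebesgue. x \<in> N \<longrightarrow> \<bar>p x - pl x\<bar> \<le> Li" using AEp N'(2) by (simp add: AE_restrict_space_iff)
    then have "AE x in lebesgue. x \<in> ?B \<longrightarrow> \<bar>p x - pl x\<bar> \<le> \<bar>Li\<bar>"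
    proof eventually_elim
      fix x assume "x \<in> N \<longrightarrow> \<bar>p x - pl x\<bar> \<le> Li"
      then show "x \<in> ?B \<longrightarrow> \<bar>p x - pl x\<bar> \<le> \<bar>Li\<bar>" using subsetD[OF sub, of x] by linarith
    qed
    then have "AE x in lebesgue_on ?B. \<bar>p x - pl x\<bar> \<le> \<bar>Li\<bar>" using Bs by (simp add: AE_restrict_space_iff)
    then have "(LINT x|lebesgue_on ?B. \<bar>p x - pl x\<bar>) \<le> (LINT x|lebesgue_on ?B. \<bar>Li\<bar>)"
      using i by (intro integral_mono_AE) auto
    also have "\<dots> = \<bar>Li\<bar> * measure lebesgue ?B" by (simp add: measure_restrict_space)
    also have "\<dots> \<le> \<bar>Li\<bar> * (V * h ^ ?d)" unfolding V by (intro mult_left_mono ball_measure_le r) auto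
    finally show ?thesis by (simp add: A_def mult_ac)
  qed
  have hF: "(LINT x|lebesgue_on (cball x r \<inter> T'). \<bar>(y x - z x) - (gy T' \<bullet> x + cq T')\<bar>) \<le> \<Phi> * h ^ ?d"
    if T': "T' \<in> patch \<T> T" and r: "0 < r" "r \<le> h" for T' x r
  proof -
    have T'T: "T' \<in> \<T>" by (rule patch_elem(1)[OF T T'])
    let ?X = "cball x r \<inter> T'"
    have Xm: "?X \<in> lmeasurable" "measure lebesgue ?X \<le> V * h ^ ?d" using ball_inter_elem[OF T'T r] by (auto simp: V)
    have XN: "?X \<subseteq> N" using T' by (auto simp: N)
    have oL: "L2fun T' (\<lambda>x. z x - avg T' z)"
      using elem[OF T'T] by (intro L2fun_diff L2fun_closure_subset[OF z] L2fun_continuous) (auto intro: continuous_on_const)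
    note o = L1_le_L2norm[OF oL Int_lower2 Xm(1) elem(7)[OF T'T] Xm(2)]
    note yy = L1_le_L2norm[OF yyN XN Xm(1) N'(2) Xm(2)]
    have "(LINT x|lebesgue_on ?X. \<bar>(y x - z x) - (gy T' \<bullet> x + cq T')\<bar>) = (LINT x|lebesgue_on ?X. \<bar>(y x - yl x) - (z x - avg T' z)\<bar>)"
      by (rule Bochner_Integration.integral_cong) (use gy[OF T'T] in \<open>auto simp: cq_def\<close>)
    also have "\<dots> \<le> (LINT x|lebesgue_on ?X. \<bar>y x - yl x\<bar> + \<bar>z x - avg T' z\<bar>)"
      by (rule integral_mono[OF integrable_abs[OF Bochner_Integration.integrable_diff[OF yy(1) o(1)]]
        Bochner_Integration.integrable_add[OF integrable_abs[OF yy(1)] integrable_abs[OF o(1)]]]) (rule abs_triangle_ineq4)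
    also have "\<dots> = (LINT x|lebesgue_on ?X. \<bar>y x - yl x\<bar>) + (LINT x|lebesgue_on ?X. \<bar>z x - avg T' z\<bar>)"
      using yy(1) o(1) by (intro Bochner_Integration.integral_add) auto
    also have "\<dots> \<le> sqrt (V * h ^ ?d) * Yn + sqrt (V * h ^ ?d) * O1"
    proof (rule add_mono)
      show "(LINT x|lebesgue_on ?X. \<bar>y x - yl x\<bar>) \<le> sqrt (V * h ^ ?d) * Yn" using yy(2) by (simp add: Yn)
      have "sqrt (V * h ^ ?d) * L2norm T' (\<lambda>x. z x - avg T' z) \<le> sqrt (V * h ^ ?d) * O1"
        unfolding O1_def using Vp hp by (intro mult_left_mono osc_le_patch_osc[OF T T']) auto
      then show "(LINT x|lebesgue_on ?X. \<bar>z x - avg T' z\<bar>) \<le> sqrt (V * h ^ ?d) * O1" using o(2) by linarith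
    qed
    also have "\<dots> = \<Phi> * h ^ ?d" unfolding sv \<Phi>_def by (simp add: distrib_left distrib_right mult_ac)
    finally show ?thesis .
  qed
  have lb1: "\<bar>gy T' \<bullet> x + cq T'\<bar> \<le> elem_const ?d \<sigma> * W" if "T' \<in> patch \<T> T" "x \<in> T'" for T' x
    unfolding W_def h by (rule local_bounds(1)[OF T w fL pl A0 P0 _ _ that]; (rule hA[unfolded h N] | rule hF[unfolded h N]); assumption)
  have lb2: "\<bar>jump \<T> pl e\<bar> \<le> jump_const ?d \<sigma> * diameter T * W" if "e \<in> sides \<T> T" for e
    unfolding W_def h by (rule local_bounds(2)[OF T w fL pl A0 P0 _ _ that]; (rule hA[unfolded h N] | rule hF[unfolded h N]); assumption)
  have FT: "L2fun T (\<lambda>x. yl x - z x)" by (rule L2fun_closure_subset[OF L2fun_diff[OF ylL z] elem(4)[OF T] elem(7)[OF T]])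
  have R1: "(L2norm T (\<lambda>x. yl x - z x))\<^sup>2 \<le> 2 * (L2norm T (\<lambda>x. (yl x - z x) - (gy T \<bullet> x + cq T)))\<^sup>2 + 2 * (elem_const ?d \<sigma>)\<^sup>2 * V * (h ^ ?d * W\<^sup>2)"
    unfolding V h by (rule residual_indicator_le[OF T FT W0]) (rule lb1[OF patch_union(3)[OF T]])
  have R2: "L2norm T (\<lambda>x. (yl x - z x) - (gy T \<bullet> x + cq T)) = L2norm T (\<lambda>x. z x - avg T z)"
    unfolding L2norm_def
  proof (intro arg_cong[where f = sqrt] Bochner_Integration.integral_cong refl)
    fix x assume "x \<in> space (lebesgue_on T)"
    then have "(yl x - z x) - (gy T \<bullet> x + cq T) = - (z x - avg T z)" using gy[OF T, of x] by (simp add: cq_def)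
    then show "((yl x - z x) - (gy T \<bullet> x + cq T))\<^sup>2 = (z x - avg T z)\<^sup>2" by (simp only: power2_minus)
  qed
  have R3: "(L2norm T (\<lambda>x. z x - avg T z))\<^sup>2 \<le> O1\<^sup>2"
    using osc_le_patch_osc[OF T patch_union(3)[OF T], of z] L2norm_nonneg unfolding O1_def by (intro power_mono) auto
  have R: "(L2norm T (\<lambda>x. yl x - z x))\<^sup>2 \<le> 2 * O1\<^sup>2 + 2 * (elem_const ?d \<sigma>)\<^sup>2 * V * (h ^ ?d * W\<^sup>2)"
    using R1[unfolded R2] R3 by linarith
  have sq: "(sqrt (V / h ^ ?d))\<^sup>2 = V / h ^ ?d" using Vp hp by (intro real_sqrt_pow2) simp
  have h22: "(h\<^sup>2)\<^sup>2 = h ^ 4" by (simp flip: power_mult)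
  have "W\<^sup>2 \<le> 2 * \<Phi>\<^sup>2 + 2 * (A / h\<^sup>2)\<^sup>2" unfolding W_def by (rule square_sum_le)
  also have "\<dots> = 2 * (V / h ^ ?d) * (Yn + O1)\<^sup>2 + 2 * V\<^sup>2 * Li\<^sup>2 / h ^ 4"
    unfolding \<Phi>_def A_def power_mult_distrib power_divide sq h22 by simp
  also have "\<dots> \<le> 2 * (V / h ^ ?d) * (2 * Yn\<^sup>2 + 2 * O1\<^sup>2) + 2 * V\<^sup>2 * Li\<^sup>2 / h ^ 4"
    using Vp hp by (intro add_right_mono mult_left_mono square_sum_le) auto
  finally have W1: "W\<^sup>2 \<le> 2 * (V / h ^ ?d) * (2 * Yn\<^sup>2 + 2 * O1\<^sup>2) + 2 * V\<^sup>2 * Li\<^sup>2 / h ^ 4" .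
  have W2: "W\<^sup>2 \<le> 4 * (V / h ^ ?d) * (Yn\<^sup>2 + O1\<^sup>2) + 2 * V\<^sup>2 * Li\<^sup>2 / h ^ 4"
  proof -
    have "2 * k * (2 * a + 2 * b) = 4 * k * (a + b)" for k a b :: real by (simp add: algebra_simps)
    then show ?thesis using W1 by (simp only:)
  qed
  have "h ^ 4 * W\<^sup>2 \<le> h ^ 4 * (4 * (V / h ^ ?d) * (Yn\<^sup>2 + O1\<^sup>2) + 2 * V\<^sup>2 * Li\<^sup>2 / h ^ 4)"
    using hp W2 by (intro mult_left_mono) auto
  also have "\<dots> = 4 * V * ((h ^ 4 / h ^ ?d) * (Yn\<^sup>2 + O1\<^sup>2)) + 2 * V\<^sup>2 * Li\<^sup>2"
    using hp by (simp add: field_simps)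
  also have "h ^ 4 / h ^ ?d = H" unfolding H(2)[symmetric] using hp by simp
  finally have W4: "h ^ 4 * W\<^sup>2 \<le> 4 * V * (H * (Yn\<^sup>2 + O1\<^sup>2)) + 2 * V\<^sup>2 * Li\<^sup>2" .
  have "h ^ 4 * (h ^ ?d * W\<^sup>2) = h ^ ?d * (h ^ 4 * W\<^sup>2)" by (simp only: mult.left_commute)
  also have "\<dots> \<le> h ^ ?d * (4 * V * (H * (Yn\<^sup>2 + O1\<^sup>2)) + 2 * V\<^sup>2 * Li\<^sup>2)"
    using W4 hp by (intro mult_left_mono) auto
  also have "\<dots> = 4 * V * ((H * h ^ ?d) * (Yn\<^sup>2 + O1\<^sup>2)) + 2 * V\<^sup>2 * (h ^ ?d * Li\<^sup>2)"
    by (simp only: distrib_left mult_ac)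
  finally have W4d: "h ^ 4 * (h ^ ?d * W\<^sup>2) \<le> 4 * V * (h ^ 4 * (Yn\<^sup>2 + O1\<^sup>2)) + 2 * V\<^sup>2 * (h ^ ?d * Li\<^sup>2)"
    unfolding H(2) .
  have B0: "0 \<le> B" unfolding B using Vp side_const_nonneg by simp
  have B20: "0 \<le> B2" unfolding B2 using Vp by simp
  have "h ^ 4 * (L2norm T (\<lambda>x. yl x - z x))\<^sup>2 \<le> h ^ 4 * (2 * O1\<^sup>2 + 2 * (elem_const ?d \<sigma>)\<^sup>2 * V * (h ^ ?d * W\<^sup>2))"
    using hp R by (intro mult_left_mono) auto
  moreover have "(\<Sum>e\<in>sides \<T> T. h ^ 3 * ((jump \<T> pl e)\<^sup>2 * side_measure e))
      \<le> real (?d + 1) * ((jump_const ?d \<sigma>)\<^sup>2 * side_const) * (h ^ 4 * (h ^ ?d * W\<^sup>2))"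
    unfolding h by (rule jump_indicator_le[OF T W0 lb2])
  ultimately have "E_adj2 \<T> z yl pl T \<le> 2 * h ^ 4 * O1\<^sup>2 + B * (h ^ 4 * (h ^ ?d * W\<^sup>2))"
    unfolding E_adj2_def h[symmetric] B by (simp add: algebra_simps)
  also have "\<dots> \<le> 2 * h ^ 4 * O1\<^sup>2 + B * (4 * V * (h ^ 4 * (Yn\<^sup>2 + O1\<^sup>2)) + 2 * V\<^sup>2 * (h ^ ?d * Li\<^sup>2))"
    by (intro add_left_mono mult_left_mono W4d B0)
  finally show "E_adj2 \<T> z yl pl T \<le> 2 * h ^ 4 * (patch_osc T z)\<^sup>2
     + B * (4 * V * (h ^ 4 * (Yn\<^sup>2 + (patch_osc T z)\<^sup>2)) + 2 * V\<^sup>2 * (h ^ DIM('a) * Li\<^sup>2))"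
    unfolding O1_def .
  have H0: "0 \<le> H" unfolding H(1) by simp
  have Hs: "(h powr (2 - real ?d / 2))\<^sup>2 = H"
    unfolding H(1) power2_eq_square powr_add[symmetric] by (rule arg_cong[where f = "\<lambda>a. h powr a"]) simp
  let ?Mx = "h * Max (insert 0 ((\<lambda>e. \<bar>jump \<T> pl e\<bar>) ` sides \<T> T))"
  have "(E_adj_inf \<T> z yl pl T)\<^sup>2 \<le> 2 * (h powr (2 - real ?d / 2) * L2norm T (\<lambda>x. yl x - z x))\<^sup>2 + 2 * ?Mx\<^sup>2"
    unfolding E_adj_inf_def h[symmetric] by (rule square_sum_le)
  also have "\<dots> = 2 * (H * (L2norm T (\<lambda>x. yl x - z x))\<^sup>2) + 2 * ?Mx\<^sup>2"
    unfolding power_mult_distrib[of "h powr (2 - real ?d / 2)"] Hs ..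
  also have "\<dots> \<le> 2 * (H * (2 * O1\<^sup>2 + 2 * (elem_const ?d \<sigma>)\<^sup>2 * V * (h ^ ?d * W\<^sup>2))) + 2 * ((jump_const ?d \<sigma>)\<^sup>2 * (h ^ 4 * W\<^sup>2))"
    using jump_max_le[OF T W0 lb2] by (intro add_mono mult_left_mono R H0) (auto simp: h)
  also have "\<dots> = 4 * H * O1\<^sup>2 + B2 * (h ^ 4 * W\<^sup>2)"
    unfolding B2 H(2)[symmetric] by (simp add: algebra_simps)
  also have "\<dots> \<le> 4 * H * O1\<^sup>2 + B2 * (4 * V * (H * (Yn\<^sup>2 + O1\<^sup>2)) + 2 * V\<^sup>2 * Li\<^sup>2)"
    by (intro add_left_mono mult_left_mono W4 B20)
  finally show "(E_adj_inf \<T> z yl pl T)\<^sup>2 \<le> 4 * H * (patch_osc T z)\<^sup>2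
     + B2 * (4 * V * (H * (Yn\<^sup>2 + (patch_osc T z)\<^sup>2)) + 2 * V\<^sup>2 * Li\<^sup>2)"
    unfolding O1_def .
qed

end

theorem theorem3p5:
  fixes \<Omega> :: "'a::euclidean_space set" and \<TT> :: "'a set set set" and \<T>0 :: "'a set set"
  assumes "DIM('a) = 2 \<or> DIM('a) = 3"
    and "open \<Omega>" and "bounded \<Omega>" and "convex \<Omega>" and "\<Omega> \<noteq> {}" and "polytope (closure \<Omega>)"
    and "triangulation \<Omega> \<T>0"
    and "\<forall>\<T>\<in>\<TT>. triangulation \<Omega> \<T> \<and> refines \<T> \<T>0"
    and "shape_regular \<TT>"
  shows "\<exists>C>0. \<forall>y\<^sub>\<Omega> a b ubar ybar pbar \<T> ul yl pl T.
    a < b \<and> L2fun \<Omega> y\<^sub>\<Omega> \<and>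
    cont_opt \<Omega> y\<^sub>\<Omega> a b ubar \<and> weak_sol \<Omega> ubar ybar \<and>
    weak_sol \<Omega> (\<lambda>x. ybar x - y\<^sub>\<Omega> x) pbar \<and>
    \<T> \<in> \<TT> \<and> semi_opt \<Omega> \<T> y\<^sub>\<Omega> a b ul \<and> dsol \<Omega> \<T> ul yl \<and>
    dsol \<Omega> \<T> (\<lambda>x. yl x - y\<^sub>\<Omega> x) pl \<and> T \<in> \<T> \<longrightarrow>
    (let h = diameter T; d = real DIM('a); N = \<Union>(patch \<T> T) in
      E_st2 \<T> ul yl T + E_adj2 \<T> y\<^sub>\<Omega> yl pl T + (E_adj_inf \<T> y\<^sub>\<Omega> yl pl T)\<^sup>2
      \<le> C * ((1 + h ^ 4 + h powr (4 - d)) * (L2norm N (\<lambda>x. ybar x - yl x))\<^sup>2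
           + (1 + h powr d) * (Linfnorm N (\<lambda>x. pbar x - pl x))\<^sup>2
           + h powr (4 - d) * (L1norm N (\<lambda>x. ubar x - ul x))\<^sup>2
           + (\<Sum>T'\<in>patch \<T> T. h ^ 4 * (L2norm T' (\<lambda>x. ul x - avg T' ul))\<^sup>2)
           + (\<Sum>T'\<in>patch \<T> T. (h ^ 4 + h powr (4 - d)) * (L2norm T' (\<lambda>x. y\<^sub>\<Omega> x - avg T' y\<^sub>\<Omega>))\<^sup>2)))"
proof -
  obtain \<sigma>0 where \<sigma>0: "\<And>\<T> T. \<T> \<in> \<TT> \<Longrightarrow> T \<in> \<T> \<Longrightarrow> diameter T \<le> \<sigma>0 * inradius T"
    using assms(9) unfolding shape_regular_def by blast
  \<comment> \<open>Enlarging the regularity constant to at least 1 is harmless because inradii of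
    bounded sets are nonnegative.\<close>
  define \<sigma> where "\<sigma> = max \<sigma>0 1"
  have mesh: "regular_mesh \<Omega> \<T> \<sigma>" if \<T>: "\<T> \<in> \<TT>" for \<T>
  proof
    show "triangulation \<Omega> \<T>" using assms(8) \<T> by blast
    fix T assume T: "T \<in> \<T>"
    then have "bounded T" using \<open>triangulation \<Omega> \<T>\<close>
      by (auto simp: triangulation_def intro: compact_imp_bounded compact_simplex)
    then have "\<sigma>0 * inradius T \<le> \<sigma> * inradius T"
      by (intro mult_right_mono inradius_nonneg) (simp add: \<sigma>_def)
    then show "diameter T \<le> \<sigma> * inradius T" using \<sigma>0[OF \<T> T] by linarith
  qed (use assms in \<open>auto simp: \<sigma>_def\<close>)
  define V where "V = unit_ball_vol DIM('a)"
  define B where "B = 2 * (elem_const DIM('a) \<sigma>)\<^sup>2 * V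
    + real (DIM('a) + 1) * ((jump_const DIM('a) \<sigma>)\<^sup>2 * regular_mesh.side_const \<Omega>)"
  define B2 where "B2 = 4 * (elem_const DIM('a) \<sigma>)\<^sup>2 * V + 2 * (jump_const DIM('a) \<sigma>)\<^sup>2"
  \<comment> \<open>One summand per indicator. The sign of \<open>B\<close> is only established once
    a mesh is fixed, whereas \<open>C\<close> must be positive beforehand; hence the absolute
    values.\<close>
  define C where "C = (2 + \<bar>B\<bar> * (3 * (1 + 2 * V))) + (2 + \<bar>B\<bar> * (4 * V + 2 * V\<^sup>2)) + (4 + B2 * (4 * V + 2 * V\<^sup>2))"
  have V0: "0 < V" by (simp add: V_def)
  have B20: "0 \<le> B2" using V0 by (simp add: B2_def)
  have C0: "C > 0" using V0 B20 by (auto simp: C_def intro!: add_pos_nonneg add_nonneg_nonneg mult_nonneg_nonneg)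
  show ?thesis
  proof (intro exI[of _ C] conjI C0 allI impI; (elim conjE)?)
    fix y\<^sub>\<Omega> a b ubar ybar pbar \<T> ul yl pl T
    assume z: "L2fun \<Omega> y\<^sub>\<Omega>" and co: "cont_opt \<Omega> y\<^sub>\<Omega> a b ubar" and wy: "weak_sol \<Omega> ubar ybar"
      and wp: "weak_sol \<Omega> (\<lambda>x. ybar x - y\<^sub>\<Omega> x) pbar" and \<T>: "\<T> \<in> \<TT>" and so: "semi_opt \<Omega> \<T> y\<^sub>\<Omega> a b ul"
      and dy: "dsol \<Omega> \<T> ul yl" and dp: "dsol \<Omega> \<T> (\<lambda>x. yl x - y\<^sub>\<Omega> x) pl" and T: "T \<in> \<T>"
    interpret regular_mesh \<Omega> \<T> \<sigma> by (rule mesh[OF \<T>])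
    have u: "L2fun \<Omega> ubar" "L2fun \<Omega> ul" using co so by (auto simp: cont_opt_def semi_opt_def Uad_def)
    have y: "L2fun \<Omega> ybar" using wy by (auto simp: weak_sol_def H10_def)
    have vh: "yl \<in> Vh \<Omega> \<T>" "pl \<in> Vh \<Omega> \<T>" using dy dp by (auto simp: dsol_def)
    define h where "h = diameter T"
    define N where "N = \<Union>(patch \<T> T)"
    define H where "H = h powr (4 - real DIM('a))"
    define D where "D = h ^ DIM('a)"
    have h: "h > 0" unfolding h_def by (rule elem(3)[OF T])
    have D: "h powr real DIM('a) = D" using h by (simp add: D_def powr_realpow)
    have HD: "H * h ^ DIM('a) = h ^ 4"
    proof -
      have "H * h ^ DIM('a) = h powr (4 - real DIM('a)) * h powr real DIM('a)" using h by (simp add: H_def powr_realpow)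
      also have "\<dots> = h powr 4" by (simp flip: powr_add)
      also have "\<dots> = h ^ 4" using h powr_realpow[of h 4] by simp
      finally show ?thesis .
    qed
    define Yn where "Yn = L2norm N (\<lambda>x. ybar x - yl x)"
    define Li where "Li = Linfnorm N (\<lambda>x. pbar x - pl x)"
    define L where "L = L1norm N (\<lambda>x. ubar x - ul x)"
    define Ou where "Ou = patch_osc T ul"
    define Oy where "Oy = patch_osc T y\<^sub>\<Omega>"
    have Ou2: "(\<Sum>T'\<in>patch \<T> T. h ^ 4 * (L2norm T' (\<lambda>x. ul x - avg T' ul))\<^sup>2) = h ^ 4 * Ou\<^sup>2"
      unfolding Ou_def patch_osc_def by (simp add: sum_distrib_left[symmetric] sum_nonneg)
    have Oy2: "(\<Sum>T'\<in>patch \<T> T. (h ^ 4 + H) * (L2norm T' (\<lambda>x. y\<^sub>\<Omega> x - avg T' y\<^sub>\<Omega>))\<^sup>2) = (h ^ 4 + H) * Oy\<^sup>2"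
      unfolding Oy_def patch_osc_def by (simp add: sum_distrib_left[symmetric] sum_nonneg)
    \<comment> \<open>The bracket of the claim. Each term in the state and adjoint estimates is a
      constant times a part of it, so all estimates can be compared with this one number.\<close>
    define R where "R = (1 + h ^ 4 + H) * Yn\<^sup>2 + (1 + D) * Li\<^sup>2 + H * L\<^sup>2 + h ^ 4 * Ou\<^sup>2 + (h ^ 4 + H) * Oy\<^sup>2"
    have H0: "0 \<le> H" and D0: "0 \<le> D" using h by (auto simp: H_def D_def)
    have n: "0 \<le> Yn\<^sup>2" "0 \<le> h ^ 4 * Yn\<^sup>2" "0 \<le> H * Yn\<^sup>2" "0 \<le> Li\<^sup>2" "0 \<le> D * Li\<^sup>2" "0 \<le> H * L\<^sup>2"
        "0 \<le> h ^ 4 * Ou\<^sup>2" "0 \<le> h ^ 4 * Oy\<^sup>2" "0 \<le> H * Oy\<^sup>2" using H0 D0 h by auto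
    have R: "R = Yn\<^sup>2 + h ^ 4 * Yn\<^sup>2 + H * Yn\<^sup>2 + Li\<^sup>2 + D * Li\<^sup>2 + H * L\<^sup>2 + h ^ 4 * Ou\<^sup>2 + h ^ 4 * Oy\<^sup>2 + H * Oy\<^sup>2"
      by (simp add: R_def algebra_simps)
    have t: "Yn\<^sup>2 \<le> R" "h ^ 4 * (Yn\<^sup>2 + Oy\<^sup>2) \<le> R" "H * (Yn\<^sup>2 + Oy\<^sup>2) \<le> R" "Li\<^sup>2 \<le> R" "D * Li\<^sup>2 \<le> R" "H * L\<^sup>2 \<le> R"
        "h ^ 4 * Ou\<^sup>2 \<le> R" "h ^ 4 * Oy\<^sup>2 \<le> R" "H * Oy\<^sup>2 \<le> R"
      unfolding R distrib_left using n by linarith+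
    have R0: "0 \<le> R" using t(1) n(1) by linarith
    have Bs: "B = 2 * (elem_const DIM('a) \<sigma>)\<^sup>2 * V + real (DIM('a) + 1) * ((jump_const DIM('a) \<sigma>)\<^sup>2 * side_const)"
      by (simp add: B_def)
    have B0: "0 \<le> B" unfolding Bs using V0 side_const_nonneg by simp
    have e1: "E_st2 \<T> ul yl T \<le> (2 + B * (3 * (1 + 2 * V))) * R"
    proof -
      have "E_st2 \<T> ul yl T \<le> 2 * h ^ 4 * Ou\<^sup>2 + B * (3 * (H * L\<^sup>2 + V * (h ^ 4 * Ou\<^sup>2) + V * Yn\<^sup>2))"
        unfolding Ou_def L_def Yn_def by (rule state_estimate[OF T wy u vh(1) h_def V_def N_def HD Bs])
      also have "\<dots> \<le> 2 * R + B * (3 * (R + V * R + V * R))"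
        using t(7) by (intro add_mono mult_left_mono t B0) (use V0 in auto)
      also have "\<dots> = (2 + B * (3 * (1 + 2 * V))) * R" by (simp add: algebra_simps)
      finally show ?thesis .
    qed
    note ae = adjoint_estimate[OF assms(1) T wp y z vh h_def V_def N_def H_def HD Bs B2_def Yn_def Li_def]
    have e2: "E_adj2 \<T> y\<^sub>\<Omega> yl pl T \<le> (2 + B * (4 * V + 2 * V\<^sup>2)) * R"
    proof -
      have "E_adj2 \<T> y\<^sub>\<Omega> yl pl T \<le> 2 * h ^ 4 * Oy\<^sup>2 + B * (4 * V * (h ^ 4 * (Yn\<^sup>2 + Oy\<^sup>2)) + 2 * V\<^sup>2 * (D * Li\<^sup>2))"
        unfolding Oy_def D_def by (rule ae(1))
      also have "\<dots> \<le> 2 * R + B * (4 * V * R + 2 * V\<^sup>2 * R)"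
        using t(8) by (intro add_mono mult_left_mono t B0) (use V0 in auto)
      also have "\<dots> = (2 + B * (4 * V + 2 * V\<^sup>2)) * R" by (simp add: algebra_simps)
      finally show ?thesis .
    qed
    have e3: "(E_adj_inf \<T> y\<^sub>\<Omega> yl pl T)\<^sup>2 \<le> (4 + B2 * (4 * V + 2 * V\<^sup>2)) * R"
    proof -
      have "(E_adj_inf \<T> y\<^sub>\<Omega> yl pl T)\<^sup>2 \<le> 4 * H * Oy\<^sup>2 + B2 * (4 * V * (H * (Yn\<^sup>2 + Oy\<^sup>2)) + 2 * V\<^sup>2 * Li\<^sup>2)"
        unfolding Oy_def by (rule ae(2))
      also have "\<dots> \<le> 4 * R + B2 * (4 * V * R + 2 * V\<^sup>2 * R)"
        using t(9) by (intro add_mono mult_left_mono t B20) (use V0 in auto)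
      also have "\<dots> = (4 + B2 * (4 * V + 2 * V\<^sup>2)) * R" by (simp add: algebra_simps)
      finally show ?thesis .
    qed
    have "E_st2 \<T> ul yl T + E_adj2 \<T> y\<^sub>\<Omega> yl pl T + (E_adj_inf \<T> y\<^sub>\<Omega> yl pl T)\<^sup>2 \<le> C * R"
      using e1 e2 e3 B0 unfolding C_def by (simp add: distrib_right)
    then show "let h = diameter T; d = real DIM('a); N = \<Union>(patch \<T> T) in
      E_st2 \<T> ul yl T + E_adj2 \<T> y\<^sub>\<Omega> yl pl T + (E_adj_inf \<T> y\<^sub>\<Omega> yl pl T)\<^sup>2
      \<le> C * ((1 + h ^ 4 + h powr (4 - d)) * (L2norm N (\<lambda>x. ybar x - yl x))\<^sup>2
           + (1 + h powr d) * (Linfnorm N (\<lambda>x. pbar x - pl x))\<^sup>2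
           + h powr (4 - d) * (L1norm N (\<lambda>x. ubar x - ul x))\<^sup>2
           + (\<Sum>T'\<in>patch \<T> T. h ^ 4 * (L2norm T' (\<lambda>x. ul x - avg T' ul))\<^sup>2)
           + (\<Sum>T'\<in>patch \<T> T. (h ^ 4 + h powr (4 - d)) * (L2norm T' (\<lambda>x. y\<^sub>\<Omega> x - avg T' y\<^sub>\<Omega>))\<^sup>2))"
      unfolding Let_def h_def[symmetric] N_def[symmetric] H_def[symmetric] D Ou2 Oy2
        Yn_def[symmetric] Li_def[symmetric] L_def[symmetric] R_def[symmetric] .
  qed
qed

end
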